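(* Let $\Gamma_{47}=\langle C(f_{47}),C(g_{47})\rangle$ and $\Gamma_{55}=\langle C(f_{55}),C(g_{55})\rangle$ be the subgroups of $\mathrm{GL}_6(\mathbb{Z})$ generated by the companion matrices of the polynomials \[ f_{47}=x^6-x^5-x+1,\qquad g_{47}=x^6+4x^5+8x^4+10x^3+8x^2+4x+1, \] \[ f_{55}=x^6-2x^5+x^4+x^2-2x+1,\qquad g_{55}=x^6+2x^5-2x^3+2x+1 \] (these are the degree-six symplectic hypergeometric monodromy groups labelled C-47 and C-55). Let $\Omega_{47}$ and $\Omega_{55}$ be the nondegenerate integral symplectic forms preserved by $\Gamma_{47}$ and $\Gamma_{55}$ respectively, given by the explicit matrices in the context. Then $\Gamma_{47}$ is a finite-index subgroup of $\mathrm{Sp}_{\Omega_{47}}(\mathbb{Z})$, and $\Gamma_{55}$ is a finite-index subgroup of $\mathrm{Sp}_{\Omega_{55}}(\mathbb{Z})$. In particular, both groups are arithmetic.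
   Context: For a monic polynomial $h(x)=x^6+c_5x^5+c_4x^4+c_3x^3+c_2x^2+c_1x+c_0$, the companion matrix is \[ C(h)=\begin{pmatrix} 0&0&0&0&0&-c_0\\ 1&0&0&0&0&-c_1\\ 0&1&0&0&0&-c_2\\ 0&0&1&0&0&-c_3\\ 0&0&0&1&0&-c_4\\ 0&0&0&0&1&-c_5 \end{pmatrix}. \] The polynomials arise as $f=\prod_{j=1}^6(x-e^{2\pi i\alpha_j})$ and $g=\prod_{j=1}^6(x-e^{2\pi i\beta_j})$ from the hypergeometric parameters as follows. For C-47, $\alpha=(0,0,\tfrac15,\tfrac25,\tfrac35,\tfrac45)$ and $\beta=(\tfrac12,\tfrac12,\tfrac13,\tfrac13,\tfrac23,\tfrac23)$. For C-55, $\alpha=(0,0,\tfrac18,\tfrac38,\tfrac58,\tfrac78)$ and $\beta=(\tfrac12,\tfrac12,\tfrac1{12},\tfrac5{12},\tfrac7{12},\tfrac{11}{12})$. The preserved integral symplectic forms are given by the following matrices, with $\Omega(x,y)=x^t\Omega y$: \[ \Omega_{47}=\begin{pmatrix} 0&29&-50&51&-28&1\\ -29&0&29&-50&51&-28\\ 50&-29&0&29&-50&51\\ -51&50&-29&0&29&-50\\ 28&-51&50&-29&0&29\\ -1&28&-51&50&-29&0 \end{pmatrix}, \qquad \Omega_{55}=\begin{pmatrix} 0&1&6&3&4&5\\ -1&0&1&6&3&4\\ -6&-1&0&1&6&3\\ -3&-6&-1&0&1&6\\ -4&-3&-6&-1&0&1\\ -5&-4&-3&-6&-1&0 \end{pmatrix}.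 \] For such a form $\Omega$, the ambient integral symplectic group is $\mathrm{Sp}_\Omega(\mathbb{Z})=\{M\in \mathrm{GL}_6(\mathbb{Z}) : M^t\Omega M=\Omega\}$. A subgroup of $\mathrm{Sp}_\Omega(\mathbb{Z})$ is called arithmetic here if it has finite index in $\mathrm{Sp}_\Omega(\mathbb{Z})$. *)

theory Defs
  imports
    "Jordan_Normal_Form.Determinant"
    "HOL-Algebra.Generated_Groups"
    "HOL-Computational_Algebra.Polynomial"
    Complex_Main
begin

section \<open>Integral linear and symplectic groups\<close>

definition GLZ :: "nat \<Rightarrow> int mat monoid" where
  "GLZ n = units_of (ring_mat TYPE(int) n ())"

definition SpZ :: "int mat \<Rightarrow> int mat monoid" where
  "SpZ \<Omega> = (GLZ (dim_row \<Omega>))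
     \<lparr>carrier := {M \<in> carrier (GLZ (dim_row \<Omega>)). transpose_mat M * \<Omega> * M = \<Omega>}\<rparr>"

text \<open>In characteristic zero, a bilinear form is alternating iff its Gram matrix is skew-symmetric.\<close>

definition symplectic_form_mat :: "nat \<Rightarrow> int mat \<Rightarrow> bool" where
  "symplectic_form_mat n \<Omega> \<longleftrightarrow>
     \<Omega> \<in> carrier_mat n n \<and> transpose_mat \<Omega> = - \<Omega> \<and> det \<Omega> \<noteq> 0"

definition finite_index_subgroup :: "'a set \<Rightarrow> ('a, 'b) monoid_scheme \<Rightarrow> bool" where
  "finite_index_subgroup H G \<longleftrightarrow> subgroup H G \<and> finite (rcosets\<^bsub>G\<^esub> H)"

definition arithmetic_subgroup :: "int mat \<Rightarrow> int mat set \<Rightarrow> bool" where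
  "arithmetic_subgroup \<Omega> H \<longleftrightarrow> finite_index_subgroup H (SpZ \<Omega>)"


section \<open>Hypergeometric groups\<close>

text \<open>Rows and columns are numbered from \<open>0\<close>. The polynomial is meant to be monic.\<close>

definition companion_mat :: "int poly \<Rightarrow> int mat" where
  "companion_mat h = mat (degree h) (degree h)
     (\<lambda>(i, j). if j = degree h - 1 then - coeff h i else if i = Suc j then 1 else 0)"

definition hypergeometric_group :: "int poly \<Rightarrow> int poly \<Rightarrow> int mat set" where
  "hypergeometric_group f g = generate (GLZ (degree f)) {companion_mat f, companion_mat g}"

definition hypergeometric_poly :: "real list \<Rightarrow> complex poly" where
  "hypergeometric_poly as = (\<Prod>a\<leftarrow>as. [:- exp (2 * of_real pi * \<i> * of_real a), 1:])"


section \<open>The two groups and their invariant forms\<close>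

text \<open>Coefficients are listed in order of increasing degree.\<close>

definition f47 :: "int poly" where
  "f47 = [:1, -1, 0, 0, 0, -1, 1:]"

definition g47 :: "int poly" where
  "g47 = [:1, 4, 8, 10, 8, 4, 1:]"

definition f55 :: "int poly" where
  "f55 = [:1, -2, 1, 0, 1, -2, 1:]"

definition g55 :: "int poly" where
  "g55 = [:1, 2, 0, -2, 0, 2, 1:]"

definition \<Gamma>47 :: "int mat set" where
  "\<Gamma>47 = hypergeometric_group f47 g47"

definition \<Gamma>55 :: "int mat set" where
  "\<Gamma>55 = hypergeometric_group f55 g55"

definition \<Omega>47 :: "int mat" where
  "\<Omega>47 = mat_of_rows_list 6
     [[  0,  29, -50,  51, -28,   1],
      [-29,   0,  29, -50,  51, -28],
      [ 50, -29,   0,  29, -50,  51],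
      [-51,  50, -29,   0,  29, -50],
      [ 28, -51,  50, -29,   0,  29],
      [ -1,  28, -51,  50, -29,   0]]"

definition \<Omega>55 :: "int mat" where
  "\<Omega>55 = mat_of_rows_list 6
     [[ 0,  1,  6,  3,  4, 5],
      [-1,  0,  1,  6,  3, 4],
      [-6, -1,  0,  1,  6, 3],
      [-3, -6, -1,  0,  1, 6],
      [-4, -3, -6, -1,  0, 1],
      [-5, -4, -3, -6, -1, 0]]"


section \<open>Consistency of the data\<close>

subsection \<open>The polynomials come from the hypergeometric parameters\<close>

lemma exp_cis: "exp (2 * of_real pi * \<i> * of_real a) = cis (2 * pi * a)"
  by (simp add: cis_conv_exp mult_ac)

lemma conj_pair:
  assumes "t + s = 2 * pi" "cos t = c"
  shows "[:- cis t, 1:] * [:- cis s, 1:] = [:1, of_real (- 2 * c), 1:]"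
proof -
  have s: "s = 2 * pi - t" using assms(1) by simp
  have "cis s = cnj (cis t)"
    unfolding s by (simp add: complex_eq_iff cos_diff sin_diff)
  moreover have "cis t * cnj (cis t) = 1"
    by (simp add: cis_cnj cis_mult)
  moreover have "cis t + cnj (cis t) = of_real (2 * c)"
    using assms(2) by (simp add: complex_eq_iff)
  ultimately show ?thesis
    by (simp add: algebra_simps)
qed

lemma cos_fifths:
  defines "c \<equiv> cos (2 * pi / 5)" and "d \<equiv> cos (4 * pi / 5)"
  shows "c + d = - 1 / 2" "c * d = - 1 / 4"
proof -
  have d: "d = 2 * c\<^sup>2 - 1"
    using cos_double_cos[of "2 * pi / 5"] by (simp add: c_def d_def)
  have "cos (3 * (2 * pi / 5)) = d"
  proof -
    have "3 * (2 * pi / 5) = 2 * pi - 4 * pi / 5" by simp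
    then show ?thesis unfolding d_def by (metis cos_2pi_minus)
  qed
  then have "4 * c ^ 3 - 3 * c = 2 * c\<^sup>2 - 1"
    using cos_treble_cos[of "2 * pi / 5"] d by (simp add: c_def)
  then have "(c - 1) * (4 * c\<^sup>2 + 2 * c - 1) = 0"
    by (simp add: algebra_simps power2_eq_square power3_eq_cube)
  moreover have "c \<noteq> 1"
    using cos_monotone_0_pi[of 0 "2 * pi / 5"] by (simp add: c_def)
  ultimately have e: "4 * c\<^sup>2 = 1 - 2 * c" by simp
  show "c + d = - 1 / 2" using d e by simp
  have "4 * (c * d) = 2 * c * (4 * c\<^sup>2) - 4 * c"
    by (simp add: d algebra_simps power2_eq_square)
  also have "\<dots> = - 1" unfolding e using e by (simp add: algebra_simps power2_eq_square)
  finally show "c * d = - 1 / 4" by simp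
qed

lemma f47_hypergeometric:
  "hypergeometric_poly [0, 0, 1/5, 2/5, 3/5, 4/5] = map_poly of_int f47"
proof -
  let ?c = "cos (2 * pi / 5)" and ?d = "cos (4 * pi / 5)"
  have 1: "[:- cis (2 * pi * (1/5)), 1:] * [:- cis (2 * pi * (4/5)), 1:]
      = [:1, of_real (- 2 * ?c), 1:]"
    by (rule conj_pair) simp_all
  have 2: "[:- cis (2 * pi * (2/5)), 1:] * [:- cis (2 * pi * (3/5)), 1:]
      = [:1, of_real (- 2 * ?d), 1:]"
    by (rule conj_pair) simp_all
  have "hypergeometric_poly [0, 0, 1/5, 2/5, 3/5, 4/5] = [:- 1, 1:] * [:- 1, 1:] *
     ([:- cis (2 * pi * (1/5)), 1:] * [:- cis (2 * pi * (4/5)), 1:]) *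
     ([:- cis (2 * pi * (2/5)), 1:] * [:- cis (2 * pi * (3/5)), 1:])"
    unfolding hypergeometric_poly_def exp_cis list.map prod_list.Cons prod_list.Nil
    by (simp only: mult_ac mult_1_left mult_zero_left cis_zero)
  also have "\<dots> = [:- 1, 1:] * [:- 1, 1:] *
     ([:1, of_real (- 2 * ?c), 1:] * [:1, of_real (- 2 * ?d), 1:])"
    unfolding 1 2 by (simp only: mult.assoc)
  also have "[:1, of_real (- 2 * ?c), 1:] * [:1, of_real (- 2 * ?d), 1:] =
     [:1, of_real (- 2 * (?c + ?d)), of_real (2 + 4 * (?c * ?d)), of_real (- 2 * (?c + ?d)), 1 :: complex:]"
    by (simp add: algebra_simps)
  also have "\<dots> = [:1, 1, 1, 1, 1:]" unfolding cos_fifths by simp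
  also have "[:- 1, 1:] * [:- 1, 1:] * [:1, 1, 1, 1, 1:] = (map_poly of_int f47 :: complex poly)"
    by (simp add: f47_def map_poly_pCons)
  finally show ?thesis .
qed

lemma g47_hypergeometric:
  "hypergeometric_poly [1/2, 1/2, 1/3, 1/3, 2/3, 2/3] = map_poly of_int g47"
proof -
  have 1: "[:- cis (2 * pi * (1/3)), 1:] * [:- cis (2 * pi * (2/3)), 1:]
      = [:1, of_real (- 2 * (- 1/2)), 1:]"
    by (rule conj_pair) (simp_all add: cos_120)
  have h: "cis (2 * pi * (1/2)) = - 1" by simp
  have "hypergeometric_poly [1/2, 1/2, 1/3, 1/3, 2/3, 2/3] = [:- (- 1), 1:] * [:- (- 1), 1:] *
     ([:- cis (2 * pi * (1/3)), 1:] * [:- cis (2 * pi * (2/3)), 1:]) *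
     ([:- cis (2 * pi * (1/3)), 1:] * [:- cis (2 * pi * (2/3)), 1:])"
    unfolding hypergeometric_poly_def exp_cis list.map prod_list.Cons prod_list.Nil h
    by (simp only: mult_ac mult_1_left)
  also have "\<dots> = (map_poly of_int g47 :: complex poly)"
    unfolding 1 by (simp add: g47_def map_poly_pCons)
  finally show ?thesis .
qed

lemma f55_hypergeometric:
  "hypergeometric_poly [0, 0, 1/8, 3/8, 5/8, 7/8] = map_poly of_int f55"
proof -
  have c: "cos (2 * pi * (3/8)) = - (sqrt 2 / 2)"
    using cos_pi_minus[of "pi / 4"] by (simp add: cos_45 field_simps)
  have 1: "[:- cis (2 * pi * (1/8)), 1:] * [:- cis (2 * pi * (7/8)), 1:]
      = [:1, of_real (- 2 * (sqrt 2 / 2)), 1:]"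
    by (rule conj_pair) (simp_all add: cos_45)
  have 2: "[:- cis (2 * pi * (3/8)), 1:] * [:- cis (2 * pi * (5/8)), 1:]
      = [:1, of_real (- 2 * (- (sqrt 2 / 2))), 1:]"
    by (rule conj_pair[OF _ c]) simp
  have "hypergeometric_poly [0, 0, 1/8, 3/8, 5/8, 7/8] = [:- 1, 1:] * [:- 1, 1:] *
     (([:- cis (2 * pi * (1/8)), 1:] * [:- cis (2 * pi * (7/8)), 1:]) *
     ([:- cis (2 * pi * (3/8)), 1:] * [:- cis (2 * pi * (5/8)), 1:]))"
    unfolding hypergeometric_poly_def exp_cis list.map prod_list.Cons prod_list.Nil
    by (simp only: mult_ac mult_1_left mult_zero_left cis_zero)
  also have "([:- cis (2 * pi * (1/8)), 1:] * [:- cis (2 * pi * (7/8)), 1:]) *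
     ([:- cis (2 * pi * (3/8)), 1:] * [:- cis (2 * pi * (5/8)), 1:]) = [:1, 0, 0, 0, 1:]"
    unfolding 1 2 by (simp flip: of_real_mult)
  also have "[:- 1, 1:] * [:- 1, 1:] * [:1, 0, 0, 0, 1:] = (map_poly of_int f55 :: complex poly)"
    by (simp add: f55_def map_poly_pCons)
  finally show ?thesis .
qed

lemma g55_hypergeometric:
  "hypergeometric_poly [1/2, 1/2, 1/12, 5/12, 7/12, 11/12] = map_poly of_int g55"
proof -
  have c: "cos (2 * pi * (5/12)) = - (sqrt 3 / 2)"
    using cos_pi_minus[of "pi / 6"] by (simp add: cos_30 field_simps)
  have 1: "[:- cis (2 * pi * (1/12)), 1:] * [:- cis (2 * pi * (11/12)), 1:]
      = [:1, of_real (- 2 * (sqrt 3 / 2)), 1:]"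
    by (rule conj_pair) (simp_all add: cos_30)
  have 2: "[:- cis (2 * pi * (5/12)), 1:] * [:- cis (2 * pi * (7/12)), 1:]
      = [:1, of_real (- 2 * (- (sqrt 3 / 2))), 1:]"
    by (rule conj_pair[OF _ c]) simp
  have h: "cis (2 * pi * (1/2)) = - 1" by simp
  have "hypergeometric_poly [1/2, 1/2, 1/12, 5/12, 7/12, 11/12] = [:- (- 1), 1:] * [:- (- 1), 1:] *
     (([:- cis (2 * pi * (1/12)), 1:] * [:- cis (2 * pi * (11/12)), 1:]) *
     ([:- cis (2 * pi * (5/12)), 1:] * [:- cis (2 * pi * (7/12)), 1:]))"
    unfolding hypergeometric_poly_def exp_cis list.map prod_list.Cons prod_list.Nil h
    by (simp only: mult_ac mult_1_left)
  also have "([:- cis (2 * pi * (1/12)), 1:] * [:- cis (2 * pi * (11/12)), 1:]) *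
     ([:- cis (2 * pi * (5/12)), 1:] * [:- cis (2 * pi * (7/12)), 1:]) = [:1, 0, -1, 0, 1:]"
    unfolding 1 2 by (simp flip: of_real_mult)
  also have "[:- (- 1), 1:] * [:- (- 1), 1:] * [:1, 0, -1, 0, 1:] = (map_poly of_int g55 :: complex poly)"
    by (simp add: g55_def map_poly_pCons)
  finally show ?thesis .
qed


subsection \<open>The forms are nondegenerate and symplectic\<close>

lemma less_6: "(i :: nat) < 6 \<longleftrightarrow> i = 0 \<or> i = 1 \<or> i = 2 \<or> i = 3 \<or> i = 4 \<or> i = 5"
  by auto

lemma eq_mat_6:
  assumes "A \<in> carrier_mat 6 6" "B \<in> carrier_mat 6 6"
    "\<forall>i\<in>{0, 1, 2, 3, 4, 5}. \<forall>j\<in>{0, 1, 2, 3, 4, 5}. A $$ (i, j) = B $$ (i, j)"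
  shows "A = B"
  by (rule eq_matI) (use assms in \<open>auto simp: less_6\<close>)

lemma index_mult_6:
  fixes A B :: "int mat"
  assumes "A \<in> carrier_mat 6 6" "B \<in> carrier_mat 6 6" "i < 6" "j < 6"
  shows "(A * B) $$ (i, j) = A $$ (i, 0) * B $$ (0, j) + A $$ (i, 1) * B $$ (1, j) +
    A $$ (i, 2) * B $$ (2, j) + A $$ (i, 3) * B $$ (3, j) +
    A $$ (i, 4) * B $$ (4, j) + A $$ (i, 5) * B $$ (5, j)"
proof -
  have "{0..<6 :: nat} = {0, 1, 2, 3, 4, 5}" by (auto simp: less_6)
  then show ?thesis using assms by (simp add: scalar_prod_def add.assoc)
qed

lemma rows_carrier_6: "length rs = 6 \<Longrightarrow> mat_of_rows_list 6 rs \<in> carrier_mat 6 6"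
  by (simp add: mat_of_rows_list_def)

lemma rows_index_6:
  "length rs = 6 \<Longrightarrow> i < 6 \<Longrightarrow> j < 6 \<Longrightarrow> mat_of_rows_list 6 rs $$ (i, j) = rs ! i ! j"
  by (simp add: mat_of_rows_list_def)

lemma rows_mult_6:
  fixes ra rb :: "int list list"
  assumes "length ra = 6" "length rb = 6"
  shows "mat_of_rows_list 6 ra * mat_of_rows_list 6 rb = mat_of_rows_list 6
    (map (\<lambda>r. map (\<lambda>j. r ! 0 * rb ! 0 ! j + r ! 1 * rb ! 1 ! j + r ! 2 * rb ! 2 ! j +
      r ! 3 * rb ! 3 ! j + r ! 4 * rb ! 4 ! j + r ! 5 * rb ! 5 ! j) [0, 1, 2, 3, 4, 5]) ra)"
proof (rule eq_mat_6)
  show "mat_of_rows_list 6 ra * mat_of_rows_list 6 rb \<in> carrier_mat 6 6"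
    using assms by (intro mult_carrier_mat[of _ 6 6] rows_carrier_6)
qed (use assms in \<open>simp_all add: rows_carrier_6 index_mult_6 rows_index_6 del: index_mult_mat\<close>)

lemma index_transpose_6:
  "A \<in> carrier_mat 6 6 \<Longrightarrow> i < 6 \<Longrightarrow> j < 6 \<Longrightarrow> transpose_mat A $$ (i, j) = A $$ (j, i)"
  by simp

lemma index_uminus_6:
  "A \<in> carrier_mat 6 6 \<Longrightarrow> i < 6 \<Longrightarrow> j < 6 \<Longrightarrow> (- A) $$ (i, j) = - A $$ (i, j)"
  by simp

lemma rows_transpose_6:
  "length rs = 6 \<Longrightarrow> transpose_mat (mat_of_rows_list 6 rs) =
    mat_of_rows_list 6 (map (\<lambda>j. map (\<lambda>r. r ! j) rs) [0, 1, 2, 3, 4, 5])"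
  by (rule eq_mat_6) (simp_all add: rows_carrier_6 rows_index_6 index_transpose_6 index_uminus_6)

lemma rows_uminus_6:
  fixes rs :: "int list list"
  shows "length rs = 6 \<Longrightarrow> - mat_of_rows_list 6 rs =
    mat_of_rows_list 6 (map (\<lambda>r. map (\<lambda>j. - (r ! j)) [0, 1, 2, 3, 4, 5]) rs)"
  by (rule eq_mat_6) (simp_all add: rows_carrier_6 rows_index_6 index_transpose_6 index_uminus_6)

lemma rows_scalar_6:
  "mat_of_rows_list 6
    [[k, 0, 0, 0, 0, 0], [0, k, 0, 0, 0, 0], [0, 0, k, 0, 0, 0],
     [0, 0, 0, k, 0, 0], [0, 0, 0, 0, k, 0], [0, 0, 0, 0, 0, k]] = (k :: int) \<cdot>\<^sub>m 1\<^sub>m 6"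
  by (rule eq_mat_6) (simp_all add: rows_carrier_6 rows_index_6 index_transpose_6 index_uminus_6)

lemma one_smult_one_mat: "(1 :: int) \<cdot>\<^sub>m 1\<^sub>m n = 1\<^sub>m n"
  by (rule eq_matI) simp_all

lemmas compute_6 = rows_mult_6 rows_transpose_6 rows_uminus_6 rows_scalar_6 one_smult_one_mat

lemma det_nonzero_if_scaled_inverse:
  fixes A B :: "int mat"
  assumes "A \<in> carrier_mat n n" "B \<in> carrier_mat n n" "A * B = k \<cdot>\<^sub>m 1\<^sub>m n" "k \<noteq> 0"
  shows "det A \<noteq> 0"
proof
  assume "det A = 0"
  with assms have "det (k \<cdot>\<^sub>m 1\<^sub>m n) = 0" using det_mult[of A n B] by simp
  with assms(4) show False by simp
qed

lemma \<Omega>47_symplectic: "symplectic_form_mat 6 \<Omega>47"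
proof -
  define W :: "int mat" where "W = mat_of_rows_list 6
    [[0, -5, -8, -10, -8, -5], [5, 0, 3, 2, -2, -8], [8, -3, 0, 3, 2, -10],
     [10, -2, -3, 0, 3, -8], [8, 2, -2, -3, 0, -5], [5, 8, 10, 8, 5, 0]]"
  have c: "\<Omega>47 \<in> carrier_mat 6 6" "W \<in> carrier_mat 6 6"
    by (simp_all add: \<Omega>47_def W_def rows_carrier_6)
  have "\<Omega>47 * W = 36 \<cdot>\<^sub>m 1\<^sub>m 6"
    by (simp add: \<Omega>47_def W_def compute_6)
  moreover have "transpose_mat \<Omega>47 = - \<Omega>47"
    by (simp add: \<Omega>47_def compute_6)
  ultimately show ?thesis
    unfolding symplectic_form_mat_def using c det_nonzero_if_scaled_inverse[of \<Omega>47 6 W 36] by simp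
qed

lemma \<Omega>55_symplectic: "symplectic_form_mat 6 \<Omega>55"
proof -
  define W :: "int mat" where "W = mat_of_rows_list 6
    [[0, -4, 1, 2, 1, -4], [4, 0, -2, -3, 4, 1], [-1, 2, 0, 0, -3, 2],
     [-2, 3, 0, 0, -2, 1], [-1, -4, 3, 2, 0, -4], [4, -1, -2, -1, 4, 0]]"
  have c: "\<Omega>55 \<in> carrier_mat 6 6" "W \<in> carrier_mat 6 6"
    by (simp_all add: \<Omega>55_def W_def rows_carrier_6)
  have "\<Omega>55 * W = 8 \<cdot>\<^sub>m 1\<^sub>m 6"
    by (simp add: \<Omega>55_def W_def compute_6)
  moreover have "transpose_mat \<Omega>55 = - \<Omega>55"
    by (simp add: \<Omega>55_def compute_6)
  ultimately show ?thesis
    unfolding symplectic_form_mat_def using c det_nonzero_if_scaled_inverse[of \<Omega>55 6 W 8] by simp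
qed


subsection \<open>The groups preserve the forms\<close>

lemma companion_mat_6:
  "companion_mat [:c0, c1, c2, c3, c4, c5, 1:] = mat_of_rows_list 6
    [[0, 0, 0, 0, 0, - c0], [1, 0, 0, 0, 0, - c1], [0, 1, 0, 0, 0, - c2],
     [0, 0, 1, 0, 0, - c3], [0, 0, 0, 1, 0, - c4], [0, 0, 0, 0, 1, - c5]]"
proof (rule eq_mat_6)
  let ?h = "[:c0, c1, c2, c3, c4, c5, 1:]"
  have d: "degree ?h = 6" by simp
  have coeffs: "coeff ?h 0 = c0" "coeff ?h 1 = c1" "coeff ?h 2 = c2" "coeff ?h 3 = c3"
      "coeff ?h 4 = c4" "coeff ?h 5 = c5"
    by (simp_all add: numeral_eq_Suc)
  show "companion_mat [:c0, c1, c2, c3, c4, c5, 1:] \<in> carrier_mat 6 6"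
    unfolding companion_mat_def d by simp
  show "\<forall>i\<in>{0, 1, 2, 3, 4, 5}. \<forall>j\<in>{0, 1, 2, 3, 4, 5}.
      companion_mat [:c0, c1, c2, c3, c4, c5, 1:] $$ (i, j) = mat_of_rows_list 6
      [[0, 0, 0, 0, 0, - c0], [1, 0, 0, 0, 0, - c1], [0, 1, 0, 0, 0, - c2],
       [0, 0, 1, 0, 0, - c3], [0, 0, 0, 1, 0, - c4], [0, 0, 0, 0, 1, - c5]] $$ (i, j)"
    unfolding companion_mat_def d using coeffs by (simp add: rows_index_6 del: coeff_pCons)
qed (simp add: rows_carrier_6)

lemma companion_mat_invertible:
  "companion_mat [:1, c1, c2, c3, c4, c5, 1:] \<in> carrier (GLZ 6)"
proof -
  let ?C = "companion_mat [:1, c1, c2, c3, c4, c5, 1:]"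
  define W :: "int mat" where "W = mat_of_rows_list 6
    [[- c1, 1, 0, 0, 0, 0], [- c2, 0, 1, 0, 0, 0], [- c3, 0, 0, 1, 0, 0],
     [- c4, 0, 0, 0, 1, 0], [- c5, 0, 0, 0, 0, 1], [- 1, 0, 0, 0, 0, 0]]"
  have c: "?C \<in> carrier_mat 6 6" "W \<in> carrier_mat 6 6"
    by (simp_all add: companion_mat_6 W_def rows_carrier_6)
  have "W * ?C = 1\<^sub>m 6" "?C * W = 1\<^sub>m 6"
    by (simp_all add: companion_mat_6 W_def compute_6)
  with c show ?thesis
    by (auto simp: GLZ_def units_of_def Units_def ring_mat_simps)
qed

lemma \<Omega>47_preserved:
  "companion_mat f47 \<in> carrier (SpZ \<Omega>47)" "companion_mat g47 \<in> carrier (SpZ \<Omega>47)"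
proof -
  have c: "\<Omega>47 \<in> carrier_mat 6 6" "companion_mat f47 \<in> carrier_mat 6 6" "companion_mat g47 \<in> carrier_mat 6 6"
    by (simp_all add: \<Omega>47_def f47_def g47_def companion_mat_6 rows_carrier_6)
  have "transpose_mat (companion_mat f47) * \<Omega>47 * companion_mat f47 = \<Omega>47"
    by (simp add: f47_def \<Omega>47_def companion_mat_6 compute_6)
  moreover have "transpose_mat (companion_mat g47) * \<Omega>47 * companion_mat g47 = \<Omega>47"
    by (simp add: g47_def \<Omega>47_def companion_mat_6 compute_6)
  ultimately show "companion_mat f47 \<in> carrier (SpZ \<Omega>47)" "companion_mat g47 \<in> carrier (SpZ \<Omega>47)"
    using c companion_mat_invertible by (auto simp: SpZ_def f47_def g47_def)
qed

lemma \<Omega>55_preserved: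
  "companion_mat f55 \<in> carrier (SpZ \<Omega>55)" "companion_mat g55 \<in> carrier (SpZ \<Omega>55)"
proof -
  have c: "\<Omega>55 \<in> carrier_mat 6 6" "companion_mat f55 \<in> carrier_mat 6 6" "companion_mat g55 \<in> carrier_mat 6 6"
    by (simp_all add: \<Omega>55_def f55_def g55_def companion_mat_6 rows_carrier_6)
  have "transpose_mat (companion_mat f55) * \<Omega>55 * companion_mat f55 = \<Omega>55"
    by (simp add: f55_def \<Omega>55_def companion_mat_6 compute_6)
  moreover have "transpose_mat (companion_mat g55) * \<Omega>55 * companion_mat g55 = \<Omega>55"
    by (simp add: g55_def \<Omega>55_def companion_mat_6 compute_6)
  ultimately show "companion_mat f55 \<in> carrier (SpZ \<Omega>55)" "companion_mat g55 \<in> carrier (SpZ \<Omega>55)"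
    using c companion_mat_invertible by (auto simp: SpZ_def f55_def g55_def)
qed

end

(*
  Gamma contains, for v the image vector of B A^-1 - 1 (a symplectic transvection), all
  transvections along the orbit of v. Two orbit vectors with pairing 1 or -1 (found by a computer
  search among long words whose dominant eigenvalues are complex) generate a copy of SL_2(Z) acting
  on their plane P and fixing its orthogonal complement. An orbit vector u + z with u in P and z
  orthogonal to P then gives the transvection along u + z times the inverse of the one along u; as
  SL_2(Z) moves u, in particular to -u, this yields unipotents that mix P with z. Collecting them
  over an orbit basis, Gamma contains the N-th power of the transvection along every vector of a
  lattice of full rank.

  It remains to see that the normal subgroup K generated by the N-th powers t_x^N of all
  transvections of Sp_6(Z) has finite index. If x and w are orthogonal, then t_(x + N w) and t_x
  agree modulo K; chaining three such steps, t_x depends modulo K only on x modulo N^2. Hence the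
  quotient is generated by a finite, conjugation-invariant set of torsion elements, and such a group
  is finite (Dietzmann's lemma). This replaces the congruence subgroup property.
*)
theory Submission
  imports Defs "HOL-Analysis.Product_Vector"
begin

section \<open>Transvections contained in a group of isometries\<close>

text \<open>On \<open>Z^6\<close> neither form is a multiple of a unimodular one: the smallest
  elementary divisor is 1, the largest is 36 for C-47 and 8 for C-55. Generation by transvections
  and the chain of orthogonal steps need a symplectic basis, so they take place on a lattice
  \<open>Lam\<close> inside the span of the orbit vectors, where the form divided by
  \<open>c\<close> is unimodular. Elements of the integral symplectic group need not preserve
  \<open>Lam\<close>. But \<open>Lam\<close> contains \<open>c Z^6\<close>, so two elements that are
  congruent modulo \<open>c\<close> differ by one that does preserve it, and there are finitely many
  residue classes. One matrix is therefore used at two scales: \<open>1/\<kappa>\<close>, where the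
  initial transvection has parameter 1, and \<open>1/c\<close>. Real parameters of transvections
  make the scales comparable.

  The pairing 1 is the delicate input. For pairing \<open>m\<close>, the two transvections act on
  their plane by matrices with off-diagonal entries \<open>- m\<close> and \<open>m\<close>; if
  \<open>m\<close> is at least 3 in absolute value, these generate a subgroup of infinite index in
  \<open>SL_2(Z)\<close>.\<close>

text \<open>Euclid's algorithm by additions and subtractions. Each step is an elementary matrix of
  \<open>SL_2(Z)\<close> acting on \<open>(a, b)\<close>, so the rule serves both for membership
  (all integral points of a plane) and for reachability (reducing a vector to a multiple of a basis
  vector).\<close>

lemma euclid_induct:
  fixes a b :: int
  assumes add1: "\<And>a b. Q (a + b) b \<Longrightarrow> Q a b" and sub1: "\<And>a b. Q (a - b) b \<Longrightarrow> Q a b"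
    and add2: "\<And>a b. Q a (b + a) \<Longrightarrow> Q a b" and sub2: "\<And>a b. Q a (b - a) \<Longrightarrow> Q a b"
    and base: "\<And>d. Q d 0"
  shows "Q a b"
proof (induction "nat (\<bar>a\<bar> + \<bar>b\<bar>)" arbitrary: a b rule: less_induct)
  case less
  have shrink: "\<bar>x + y\<bar> < \<bar>x\<bar> \<or> \<bar>x - y\<bar> < \<bar>x\<bar>" if "y \<noteq> 0" "\<bar>y\<bar> \<le> \<bar>x\<bar>" for x y :: int
    using that by (cases "x \<ge> 0"; cases "y \<ge> 0") (simp_all add: abs_if)
  have IH: "Q c d" if "\<bar>c\<bar> + \<bar>d\<bar> < \<bar>a\<bar> + \<bar>b\<bar>" for c d
    using less[of c d] that by simp
  consider "b = 0" | "a = 0" | "b \<noteq> 0" "\<bar>b\<bar> \<le> \<bar>a\<bar>" | "a \<noteq> 0" "\<bar>a\<bar> \<le> \<bar>b\<bar>"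
    by linarith
  then show ?case
  proof cases
    case 1
    then show ?thesis using base by simp
  next
    case 2
    \<comment> \<open>No step shortens \<open>(0, b)\<close>, hence the detour
      \<open>(0, b)\<close>, \<open>(b, b)\<close>, \<open>(b, 0)\<close>.\<close>
    have "Q b b" using sub2[of b b] base[of b] by simp
    then show ?thesis using add1[of 0 b] 2 by simp
  next
    case 3
    from shrink[OF this] show ?thesis
      using IH[of "a + b" b] IH[of "a - b" b] add1[of a b] sub1[of a b] by auto
  next
    case 4
    from shrink[OF this] show ?thesis
      using IH[of a "b + a"] IH[of a "b - a"] add2[of a b] sub2[of a b] by auto
  qed
qed

text \<open>One signed generator at a time: the form in which the unipotents attached to the members
  of \<open>Y\<close> are later collected by induction.\<close>

inductive_set zspan :: "'v::ab_group_add set \<Rightarrow> 'v set" for Y where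
  zero: "0 \<in> zspan Y"
| add: "x \<in> zspan Y \<Longrightarrow> y \<in> Y \<Longrightarrow> x + y \<in> zspan Y"
| sub: "x \<in> zspan Y \<Longrightarrow> y \<in> Y \<Longrightarrow> x - y \<in> zspan Y"

lemma zspan_base: "y \<in> Y \<Longrightarrow> y \<in> zspan Y"
  using zspan.add[OF zspan.zero, of y Y] by simp

lemma zspan_add: "y \<in> zspan Y \<Longrightarrow> x \<in> zspan Y \<Longrightarrow> x + y \<in> zspan Y"
proof (induction rule: zspan.induct)
  case (add z y)
  then show ?case using zspan.add[of "x + z" Y y] by (simp add: add.assoc)
next
  case (sub z y)
  then show ?case using zspan.sub[of "x + z" Y y] by (simp add: add_diff_eq)
qed simp

lemma zspan_uminus: "x \<in> zspan Y \<Longrightarrow> - x \<in> zspan Y"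
proof (induction rule: zspan.induct)
  case (add x y)
  then show ?case using zspan.sub[of "- x" Y y] by (simp add: algebra_simps)
next
  case (sub x y)
  then show ?case using zspan.add[of "- x" Y y] by (simp add: algebra_simps)
qed (simp add: zspan.zero)

lemma zspan_scale:
  fixes x :: "'v::real_vector"
  assumes "x \<in> zspan Y"
  shows "of_int k *\<^sub>R x \<in> zspan Y"
proof -
  have n: "of_nat n *\<^sub>R x \<in> zspan Y" for n
    by (induction n) (simp_all add: zspan.zero zspan_add assms scaleR_left_distrib)
  show ?thesis
  proof (cases "k \<ge> 0")
    case True
    then show ?thesis using n[of "nat k"] by simp
  next
    case False
    then show ?thesis using zspan_uminus[OF n[of "nat (- k)"]] by simp
  qed
qed

section \<open>Transvections and mixed unipotents of a symplectic space\<close>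

locale symplectic_space =
  fixes \<omega> :: "'v::real_vector \<Rightarrow> 'v \<Rightarrow> real"
  assumes add_left [simp]: "\<omega> (x + y) z = \<omega> x z + \<omega> y z"
    and scale_left [simp]: "\<omega> (c *\<^sub>R x) z = c * \<omega> x z"
    and alternating [simp]: "\<omega> x x = 0"
    and skew: "\<omega> x y = - \<omega> y x"
begin

lemma add_right [simp]: "\<omega> z (x + y) = \<omega> z x + \<omega> z y"
  using add_left[of x y z] skew[of z "x + y"] skew[of x z] skew[of y z] by linarith

lemma scale_right [simp]: "\<omega> z (c *\<^sub>R x) = c * \<omega> z x"
proof -
  have "\<omega> z (c *\<^sub>R x) = - (c * \<omega> x z)" using scale_left[of c x z] skew[of z "c *\<^sub>R x"] by linarith
  then show ?thesis using skew[of x z] by simp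
qed

lemma zero_left [simp]: "\<omega> 0 z = 0" using scale_left[of 0] by simp
lemma zero_right [simp]: "\<omega> z 0 = 0" using scale_right[of _ 0] by simp
lemma minus_left [simp]: "\<omega> (- x) z = - \<omega> x z" using scale_left[of "-1"] by simp
lemma minus_right [simp]: "\<omega> z (- x) = - \<omega> z x" using scale_right[of _ "-1"] by simp
lemma diff_left [simp]: "\<omega> (x - y) z = \<omega> x z - \<omega> y z" using add_left[of x "- y"] by simp
lemma diff_right [simp]: "\<omega> z (x - y) = \<omega> z x - \<omega> z y" using add_right[of z x "- y"] by simp

lemma orth_sym: "\<omega> x y = 0 \<Longrightarrow> \<omega> y x = 0" using skew[of y x] by simp

text \<open>The parameter makes the transvections along \<open>v\<close> a one-parameter group; for
  integral \<open>q\<close> this is the \<open>q\<close>-th power of the transvection along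
  \<open>v\<close>.\<close>

definition T :: "real \<Rightarrow> 'v \<Rightarrow> 'v \<Rightarrow> 'v" where
  "T q v x = x + (q * \<omega> x v) *\<^sub>R v"

text \<open>The polarisation of \<open>T q\<close> in its vector argument. For orthogonal
  \<open>u\<close>, \<open>z\<close> it is the short root element (Eichler transformation) of the
  pair, and the mixed term of \<open>T q (u + z)\<close>, see \<open>T_plus\<close>.\<close>

definition S :: "real \<Rightarrow> 'v \<Rightarrow> 'v \<Rightarrow> 'v \<Rightarrow> 'v" where
  "S q u z x = x + (q * \<omega> x z) *\<^sub>R u + (q * \<omega> x u) *\<^sub>R z"

definition isometry :: "('v \<Rightarrow> 'v) \<Rightarrow> bool" where
  "isometry g \<longleftrightarrow> linear g \<and> bij g \<and> (\<forall>x y. \<omega> (g x) (g y) = \<omega> x y)"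

lemma T_0 [simp]: "T 0 v = id" by (auto simp: T_def)

lemma T_add: "T p v \<circ> T q v = T (p + q) v"
  by (auto simp: T_def algebra_simps)

lemma T_scale: "T q (c *\<^sub>R v) = T (q * c\<^sup>2) v"
  by (auto simp: T_def power2_eq_square algebra_simps)

lemma T_orth: "\<omega> x v = 0 \<Longrightarrow> T q v x = x" by (simp add: T_def)

lemma T_isometry: "isometry (T q v)"
proof -
  have "T q v \<circ> T (- q) v = id" "T (- q) v \<circ> T q v = id" by (simp_all add: T_add)
  then have "bij (T q v)" using o_bij by blast
  moreover have "linear (T q v)" by (rule linearI) (simp_all add: T_def algebra_simps)
  moreover have "\<omega> (T q v x) (T q v y) = \<omega> x y" for x y
    using skew[of v y] by (simp add: T_def algebra_simps)
  ultimately show ?thesis unfolding isometry_def by blast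
qed

lemma T_conj: "isometry g \<Longrightarrow> g \<circ> T q v = T q (g v) \<circ> g"
  by (auto simp: isometry_def T_def linear_add linear_scale)

lemma S_commute: "S q u z = S q z u" by (auto simp: S_def algebra_simps)

lemma S_scale: "S q (c *\<^sub>R u) z = S (q * c) u z" by (auto simp: S_def algebra_simps)

lemma S_add: "\<omega> u z = 0 \<Longrightarrow> S p u z \<circ> S q u z = S (p + q) u z"
  using orth_sym[of u z] by (auto simp: S_def algebra_simps)

lemma S_0 [simp]: "S 0 u z = id" by (auto simp: S_def)

lemma T_plus: "\<omega> u z = 0 \<Longrightarrow> T q (u + z) = S q u z \<circ> T q u \<circ> T q z"
  using orth_sym[of u z] by (auto simp: S_def T_def algebra_simps)

lemma S_eq_T: "\<omega> u z = 0 \<Longrightarrow> S q u z = T q (u + z) \<circ> T (- q) u \<circ> T (- q) z"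
  using orth_sym[of u z] by (auto simp: S_def T_def algebra_simps)

text \<open>For fixed \<open>u\<close>, the maps \<open>S q u z\<close> with \<open>z\<close>
  orthogonal to \<open>u\<close>, together with the maps \<open>T r u\<close>, form a Heisenberg
  group whose centre contains the latter. The factor \<open>T\<close> is its cocycle, and it is the
  source of the integrality conditions on \<open>\<omega> z z'\<close> later on.\<close>

lemma S_plus:
  assumes "\<omega> u z = 0" "\<omega> u z' = 0"
  shows "S q u (z + z') = S q u z \<circ> S q u z' \<circ> T (q\<^sup>2 * \<omega> z z') u"
  using assms orth_sym[OF assms(1)] orth_sym[OF assms(2)] skew[of z' z]
  by (auto simp: S_def T_def algebra_simps power2_eq_square)

section \<open>Isometry groups containing two transvections with pairing one\<close>

definition isom_group :: "('v \<Rightarrow> 'v) set \<Rightarrow> bool" where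
  "isom_group H \<longleftrightarrow> id \<in> H \<and> (\<forall>f\<in>H. \<forall>g\<in>H. f \<circ> g \<in> H) \<and> (\<forall>g\<in>H. isometry g \<and> inv_into UNIV g \<in> H)"

context
  fixes H
  assumes H: "isom_group H"
begin

lemma H_id: "id \<in> H" and H_comp: "f \<in> H \<Longrightarrow> g \<in> H \<Longrightarrow> f \<circ> g \<in> H"
  and H_isometry: "g \<in> H \<Longrightarrow> isometry g" and H_inv: "g \<in> H \<Longrightarrow> inv_into UNIV g \<in> H"
  using H unfolding isom_group_def by blast+

lemma H_inv_eq:
  assumes "f \<in> H" "f \<circ> g = id"
  shows "g \<in> H"
proof -
  have "inv_into UNIV f (f x) = x" for x
    using H_isometry[OF assms(1)] by (simp add: isometry_def bij_is_inj)
  then have "g x = inv_into UNIV f x" for x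
    using fun_cong[OF assms(2), of x] by (metis comp_apply id_apply)
  then have "g = inv_into UNIV f" by blast
  then show ?thesis using H_inv[OF assms(1)] by simp
qed

lemma H_T_uminus: "T q v \<in> H \<Longrightarrow> T (- q) v \<in> H"
  by (rule H_inv_eq[of "T q v"]) (simp_all add: T_add)

lemma H_S_uminus: "S q u z \<in> H \<Longrightarrow> \<omega> u z = 0 \<Longrightarrow> S (- q) u z \<in> H"
  by (rule H_inv_eq[of "S q u z"]) (simp_all add: S_add)

lemma H_T_int:
  assumes a: "T q v \<in> H"
  shows "T (of_int k * q) v \<in> H"
proof -
  have n: "T (of_nat n * q) v \<in> H" for n
  proof (induction n)
    case (Suc n)
    have "T q v \<circ> T (of_nat n * q) v \<in> H" using a Suc by (rule H_comp)
    then show ?case by (simp add: T_add algebra_simps)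
  qed (use H_id in \<open>simp add: id_def\<close>)
  show ?thesis
  proof (cases "k \<ge> 0")
    case True
    then show ?thesis using n[of "nat k"] by simp
  next
    case False
    then show ?thesis using H_T_uminus[OF n[of "nat (- k)"]] by simp
  qed
qed

lemma H_S_int:
  assumes a: "S q u z \<in> H" "\<omega> u z = 0"
  shows "S (of_int k * q) u z \<in> H"
proof -
  have n: "S (of_nat n * q) u z \<in> H" for n
  proof (induction n)
    case (Suc n)
    have "S q u z \<circ> S (of_nat n * q) u z \<in> H" using a(1) Suc by (rule H_comp)
    then show ?case using a(2) by (simp add: S_add algebra_simps)
  qed (use H_id in \<open>simp add: id_def\<close>)
  show ?thesis
  proof (cases "k \<ge> 0")
    case True
    then show ?thesis using n[of "nat k"] by simp
  next
    case False
    then show ?thesis using H_S_uminus[OF n[of "nat (- k)"] a(2)] by simp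
  qed
qed

lemma H_T_image:
  assumes a: "T q v \<in> H" "g \<in> H"
  shows "T q (g v) \<in> H"
proof -
  have "g (inv_into UNIV g x) = x" for x
    using H_isometry[OF a(2)] by (simp add: isometry_def bij_is_surj surj_f_inv_f)
  then have "T q (g v) x = (g \<circ> T q v \<circ> inv_into UNIV g) x" for x
    using fun_cong[OF T_conj[OF H_isometry[OF a(2)], of q v], of "inv_into UNIV g x"] by simp
  then have "T q (g v) = g \<circ> T q v \<circ> inv_into UNIV g" by blast
  then show ?thesis using H_comp[OF H_comp[OF a(2) a(1)] H_inv[OF a(2)]] by simp
qed

lemma H_T_int':
  assumes "T q v \<in> H" "r / q \<in> \<int>" "q \<noteq> 0"
  shows "T r v \<in> H"
proof -
  obtain k where "r / q = of_int k" using assms(2) by (elim Ints_cases)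
  then have "r = of_int k * q" using assms(3) by (simp add: field_simps)
  then show ?thesis using H_T_int[OF assms(1)] by simp
qed

context
  fixes w1 w2
  assumes hyp: "\<omega> w1 w2 = 1" and w1: "T 1 w1 \<in> H" and w2: "T 1 w2 \<in> H"
begin

lemma hyp': "\<omega> w2 w1 = -1" using skew[of w2 w1] hyp by simp

definition pt :: "int \<Rightarrow> int \<Rightarrow> 'v" where
  "pt a b = of_int a *\<^sub>R w1 + of_int b *\<^sub>R w2"

lemma pt_add: "pt (a + c) (b + d) = pt a b + pt c d"
  by (simp add: pt_def algebra_simps)

lemma pt_orth: "\<omega> w1 z = 0 \<Longrightarrow> \<omega> w2 z = 0 \<Longrightarrow> \<omega> (pt a b) z = 0"
  by (simp add: pt_def)

lemma pt_int: "\<omega> (pt a b) (pt c d) = of_int (a * d - b * c)"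
  by (simp add: pt_def hyp hyp' algebra_simps)

text \<open>The transvections along \<open>w1\<close>, \<open>w2\<close> and their inverses act on
  the plane as elementary matrices and fix \<open>z\<close>, so conjugation by them changes only the
  plane part.\<close>

lemma pt_step:
  assumes z: "\<omega> w1 z = 0" "\<omega> w2 z = 0" and X: "T 1 (pt a b + z) \<in> H"
  shows "T 1 (pt (a + b) b + z) \<in> H" "T 1 (pt (a - b) b + z) \<in> H"
    and "T 1 (pt a (b + a) + z) \<in> H" "T 1 (pt a (b - a) + z) \<in> H"
proof -
  note z' = orth_sym[OF z(1)] orth_sym[OF z(2)]
  have "T (-1) w1 (pt a b + z) = pt (a + b) b + z" "T 1 w1 (pt a b + z) = pt (a - b) b + z"
    "T 1 w2 (pt a b + z) = pt a (b + a) + z" "T (-1) w2 (pt a b + z) = pt a (b - a) + z"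
    by (simp_all add: T_def pt_def hyp hyp' z' algebra_simps)
  then show "T 1 (pt (a + b) b + z) \<in> H" "T 1 (pt (a - b) b + z) \<in> H"
      "T 1 (pt a (b + a) + z) \<in> H" "T 1 (pt a (b - a) + z) \<in> H"
    using H_T_image[OF X, of "T (-1) w1"] H_T_image[OF X, of "T 1 w1"] H_T_image[OF X, of "T 1 w2"]
      H_T_image[OF X, of "T (-1) w2"] w1 w2 H_T_uminus[of 1] by auto
qed

text \<open>The steps \<open>(a, b)\<close>, \<open>(a - b, b)\<close>, \<open>(a - b, a)\<close>,
  \<open>(- b, a)\<close> make a quarter turn. Two quarter turns negate the plane part and keep
  \<open>z\<close>.\<close>

lemma pt_rot:
  assumes z: "\<omega> w1 z = 0" "\<omega> w2 z = 0" and X: "T 1 (pt a b + z) \<in> H"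
  shows "T 1 (pt (- b) a + z) \<in> H"
  using pt_step(2)[OF z pt_step(3)[OF z pt_step(2)[OF z X]]] by simp

lemma T_pt: "T 1 (pt a b) \<in> H"
proof (induction a b rule: euclid_induct)
  case (5 d)
  \<comment> \<open>The transvection along \<open>d w1\<close> is the power of that along
    \<open>w1\<close> with exponent \<open>d * d\<close>, so imprimitive points are covered
    too.\<close>
  have "T (of_int (d * d) * 1) w1 \<in> H" by (rule H_T_int[OF w1])
  then show ?case by (simp add: pt_def T_scale power2_eq_square)
next
  case (1 a b)
  then show ?case using pt_step(2)[of 0 "a + b" b] by simp
next
  case (2 a b)
  then show ?case using pt_step(1)[of 0 "a - b" b] by simp
next
  case (3 a b)
  then show ?case using pt_step(4)[of 0 a "b + a"] by simp
next
  case (4 a b)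
  then show ?case using pt_step(3)[of 0 a "b - a"] by simp
qed

lemma T_pt_int: "q \<in> \<int> \<Longrightarrow> T q (pt a b) \<in> H"
  using H_T_int'[OF T_pt] by simp

text \<open>The vectors \<open>u + z\<close> and \<open>- u + z\<close> have opposite mixed terms,
  so the product of their transvections is \<open>T 2 u\<close> times \<open>T 2 z\<close>, and the
  first factor lies in \<open>H\<close>. This is the origin of the factor 2 in the next
  lemmas.\<close>

lemma T2_H:
  assumes z: "\<omega> w1 z = 0" "\<omega> w2 z = 0" and X: "T 1 (pt a b + z) \<in> H"
  shows "T 2 z \<in> H"
proof -
  let ?u = "pt a b"
  have "T 1 (pt (- a) (- b) + z) \<in> H" using pt_rot[OF z pt_rot[OF z X]] .
  moreover have "pt (- a) (- b) = - ?u" by (simp add: pt_def)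
  ultimately have "T 1 (?u + z) \<circ> T 1 (- ?u + z) \<circ> T (- 2) ?u \<in> H"
    using X by (auto intro!: H_comp T_pt_int)
  moreover have "T 1 (?u + z) \<circ> T 1 (- ?u + z) \<circ> T (- 2) ?u = T 2 z"
  proof
    fix x
    show "(T 1 (?u + z) \<circ> T 1 (- ?u + z) \<circ> T (- 2) ?u) x = T 2 z x"
      using pt_orth[OF z, of a b] orth_sym[OF pt_orth[OF z, of a b]]
        scaleR_left_distrib[of "\<omega> x z" "\<omega> x z" z] scaleR_left_distrib[of "\<omega> x ?u" "\<omega> x ?u" ?u]
      by (simp add: T_def algebra_simps)
  qed
  ultimately show ?thesis by simp
qed

lemma S2_H:
  assumes z: "\<omega> w1 z = 0" "\<omega> w2 z = 0" and X: "T 1 (pt a b + z) \<in> H"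
  shows "S 2 (pt a b) z \<in> H"
proof -
  have "T 2 (pt a b + z) \<in> H" "T (- 2) z \<in> H"
    using H_T_int'[OF X, of 2] H_T_uminus[OF T2_H[OF z X]] by auto
  then show ?thesis
    unfolding S_eq_T[OF pt_orth[OF z]] by (intro H_comp T_pt_int) auto
qed

text \<open>The points \<open>(a, b)\<close> with \<open>S 2 (pt a b) z\<close> in \<open>H\<close>
  form a subgroup of the integral plane, because in the Heisenberg relation centred at
  \<open>z\<close> the cocycle is a multiple of 4 and \<open>T 4 z\<close> lies in \<open>H\<close>.
  Differences of elementary steps put a multiple of each basis vector into this subgroup, and
  rescaling gives one \<open>n\<close> for all points.\<close>

lemma S_pt_H:
  assumes z: "\<omega> w1 z = 0" "\<omega> w2 z = 0" and X: "T 1 (pt a b + z) \<in> H" and nz: "a \<noteq> 0 \<or> b \<noteq> 0"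
  shows "\<exists>n::int. n > 0 \<and> (\<forall>m k. S (of_int n) (pt m k) z \<in> H)"
proof -
  define Q where "Q a b \<longleftrightarrow> S 2 (pt a b) z \<in> H" for a b
  have T4: "T (4 * of_int j) z \<in> H" for j
    using H_T_int[OF T2_H[OF z X], of "2 * j"] by (simp add: mult.commute)
  have Qadd: "Q (a + c) (b + d)" if "Q a b" "Q c d" for a b c d
  proof -
    have "S 2 z (pt a b + pt c d) = S 2 z (pt a b) \<circ> S 2 z (pt c d) \<circ> T (4 * of_int (a * d - b * c)) z"
      using S_plus[of z "pt a b" "pt c d" 2, OF orth_sym[OF pt_orth[OF z]] orth_sym[OF pt_orth[OF z]]]
      by (simp add: pt_int)
    moreover have "S 2 z (pt a b) \<circ> S 2 z (pt c d) \<circ> T (4 * of_int (a * d - b * c)) z \<in> H"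
      using that unfolding Q_def S_commute[of 2 z] by (intro H_comp T4)
    ultimately show ?thesis unfolding Q_def pt_add S_commute[of 2 _ z] by simp
  qed
  have Qneg: "Q (- a) (- b)" if "Q a b" for a b
  proof -
    have "pt (- a) (- b) = (-1) *\<^sub>R pt a b" by (simp add: pt_def)
    then have "S 2 (pt (- a) (- b)) z = S (- 2) (pt a b) z" using S_scale[of 2 "-1"] by simp
    then show ?thesis using H_S_uminus[OF that[unfolded Q_def] pt_orth[OF z]] unfolding Q_def by simp
  qed
  \<comment> \<open>Here \<open>(a + b, b) - (a, b) = (b, 0)\<close> and
    \<open>(a, b + a) - (a, b) = (0, a)\<close>.\<close>
  have Q1: "Q b 0" "Q 0 a" if X: "T 1 (pt a b + z) \<in> H" for a b
  proof -
    have "Q a b" "Q (a + b) b" "Q a (b + a)"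
      using S2_H[OF z X] S2_H[OF z pt_step(1)[OF z X]] S2_H[OF z pt_step(3)[OF z X]] by (simp_all add: Q_def)
    then show "Q b 0" "Q 0 a"
      using Qadd[of "a + b" b "- a" "- b"] Qadd[of a "b + a" "- a" "- b"] Qneg by auto
  qed
  \<comment> \<open>The quarter turn \<open>(- b, a)\<close> supplies the two missing multiples, so
    whichever of \<open>a\<close>, \<open>b\<close> is nonzero can serve as
    \<open>d\<close>.\<close>
  have ab: "Q b 0" "Q 0 a" "Q a 0" "Q 0 (- b)"
    using Q1[OF X] Q1[OF pt_rot[OF z X]] by simp_all
  obtain d where d: "d \<noteq> 0" "Q d 0" "Q 0 d"
  proof (cases "a = 0")
    case True
    then show ?thesis using nz ab Qneg[of 0 "- b"] that[of b] by simp
  next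
    case False
    then show ?thesis using ab that[of a] by simp
  qed
  define n where "n = 2 * \<bar>d\<bar>"
  have d': "Q \<bar>d\<bar> 0" "Q 0 \<bar>d\<bar>" using d Qneg[of d 0] Qneg[of 0 d] by (auto simp: abs_if)
  have ndvd: "S (of_int n) (pt m k) z \<in> H" for m k
  proof -
    have "S (of_int m * 2) (pt \<bar>d\<bar> 0) z \<in> H" "S (of_int k * 2) (pt 0 \<bar>d\<bar>) z \<in> H"
      using H_S_int[OF d'(1)[unfolded Q_def] pt_orth[OF z]] H_S_int[OF d'(2)[unfolded Q_def] pt_orth[OF z]]
      by simp_all
    moreover have "(of_int m :: real) *\<^sub>R pt \<bar>d\<bar> 0 = pt (m * \<bar>d\<bar>) 0" "(of_int k :: real) *\<^sub>R pt 0 \<bar>d\<bar> = pt 0 (k * \<bar>d\<bar>)"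
      by (simp_all add: pt_def)
    ultimately have "Q (m * \<bar>d\<bar>) 0" "Q 0 (k * \<bar>d\<bar>)"
      unfolding Q_def using S_scale[of 2 "of_int m" "pt \<bar>d\<bar> 0" z] S_scale[of 2 "of_int k" "pt 0 \<bar>d\<bar>" z]
      by (simp_all add: mult.commute)
    from Qadd[OF this] have "S 2 (pt (m * \<bar>d\<bar>) (k * \<bar>d\<bar>)) z \<in> H" unfolding Q_def by simp
    moreover have "pt (m * \<bar>d\<bar>) (k * \<bar>d\<bar>) = of_int \<bar>d\<bar> *\<^sub>R pt m k" by (simp add: pt_def algebra_simps)
    ultimately show ?thesis using S_scale[of 2 "of_int \<bar>d\<bar>" "pt m k" z] by (simp add: n_def)
  qed
  show ?thesis using ndvd d(1) by (intro exI[of _ n]) (auto simp: n_def)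
qed

definition proj :: "'v \<Rightarrow> 'v" where
  "proj x = x - \<omega> x w2 *\<^sub>R w1 + \<omega> x w1 *\<^sub>R w2"

lemma proj_orth: "\<omega> w1 (proj x) = 0" "\<omega> w2 (proj x) = 0"
  using skew[of w1 x] skew[of w2 x] by (simp_all add: proj_def hyp hyp' algebra_simps)

text \<open>The floors only convert pairings that are integral by assumption to type
  \<open>int\<close>.\<close>

lemma proj_pt:
  assumes "\<omega> x w1 \<in> \<int>" "\<omega> x w2 \<in> \<int>"
  shows "x = pt \<lfloor>\<omega> x w2\<rfloor> \<lfloor>- \<omega> x w1\<rfloor> + proj x"
proof -
  obtain a b where "\<omega> x w1 = of_int a" "\<omega> x w2 = of_int b" using assms by (elim Ints_cases)
  then show ?thesis unfolding pt_def proj_def by simp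
qed

end

end

text \<open>By \<open>nz\<close> every generator has a nonzero plane part, so each yields mixed
  unipotents with its own multiplier \<open>n y\<close>. The product \<open>q\<close> of the
  multipliers serves for all of \<open>Y\<close>, the Heisenberg relation extends it to the span,
  and two mixed unipotents along \<open>w1\<close> and \<open>w2\<close> together give the
  transvection along the part orthogonal to the plane.\<close>

theorem transvections_in_group:
  assumes H: "isom_group H" and hyp: "\<omega> w1 w2 = 1" and w: "T 1 w1 \<in> H" "T 1 w2 \<in> H"
    and Y: "finite Y" "\<And>y. y \<in> Y \<Longrightarrow> T 1 y \<in> H"
    and int: "\<And>y. y \<in> Y \<Longrightarrow> \<omega> y w1 \<in> \<int>" "\<And>y. y \<in> Y \<Longrightarrow> \<omega> y w2 \<in> \<int>"
      "\<And>y y'. y \<in> Y \<Longrightarrow> y' \<in> Y \<Longrightarrow> \<omega> y y' \<in> \<int>"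
    and nz: "\<And>y. y \<in> Y \<Longrightarrow> \<omega> y w1 \<noteq> 0 \<or> \<omega> y w2 \<noteq> 0"
  shows "\<exists>N::int. N > 0 \<and> (\<forall>x\<in>zspan Y. T (of_int N) x \<in> H)"
proof -
  note pt_def = pt_def[OF H hyp w] and proj_def = proj_def[OF H hyp w]
  let ?pt = "pt w1 w2" and ?pr = "proj w1 w2"
  note orth = proj_orth[OF H hyp w] and pt_orth = pt_orth[OF H hyp w orth]
  have "\<exists>n::int. n > 0 \<and> (\<forall>m k. S (of_int n) (?pt m k) (?pr y) \<in> H)" if y: "y \<in> Y" for y
  proof -
    have i: "\<omega> y w1 \<in> \<int>" "\<omega> y w2 \<in> \<int>" using int y by auto
    have "T 1 (?pt \<lfloor>\<omega> y w2\<rfloor> \<lfloor>- \<omega> y w1\<rfloor> + ?pr y) \<in> H"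
      using Y(2)[OF y] proj_pt[OF H hyp w i] by simp
    moreover have "\<lfloor>\<omega> y w2\<rfloor> \<noteq> 0 \<or> \<lfloor>- \<omega> y w1\<rfloor> \<noteq> 0"
      using nz[OF y] i by (auto elim!: Ints_cases)
    ultimately show ?thesis by (rule S_pt_H[OF H hyp w orth])
  qed
  then obtain n where n: "\<And>y. y \<in> Y \<Longrightarrow> n y > (0::int)"
      "\<And>y m k. y \<in> Y \<Longrightarrow> S (of_int (n y)) (?pt m k) (?pr y) \<in> H"
    by metis
  define q where "q = (\<Prod>y\<in>Y. n y)"
  have "q > 0" unfolding q_def using n(1) by (rule prod_pos)
  have SY: "S (of_int q) (?pt m k) (?pr y) \<in> H" if y: "y \<in> Y" for y m k
  proof -
    have "q = (\<Prod>x\<in>Y - {y}. n x) * n y" unfolding q_def using Y(1) y by (simp add: prod.remove mult.commute)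
    then show ?thesis
      using H_S_int[OF H n(2)[OF y] pt_orth, of "\<Prod>x\<in>Y - {y}. n x"] by simp
  qed
  have zint: "\<omega> x w1 \<in> \<int>" "\<omega> x w2 \<in> \<int>" if "x \<in> zspan Y" for x
    using that by (induction; simp add: int)+
  have zintY: "\<omega> x y \<in> \<int>" if "x \<in> zspan Y" "y \<in> Y" for x y
    using that by (induction; simp add: int)
  have pr_add: "?pr (x + y) = ?pr x + ?pr y" and pr_minus: "?pr (- y) = - ?pr y" for x y
    unfolding proj_def by (simp_all add: algebra_simps)
  have pr_int: "\<omega> (?pr x) (?pr y) \<in> \<int>" if "x \<in> zspan Y" "y \<in> Y" for x y
  proof -
    have "\<omega> w1 y = - \<omega> y w1" "\<omega> w2 y = - \<omega> y w2" "\<omega> w2 w1 = -1" using skew hyp by metis+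
    then show ?thesis
      using zint[OF that(1)] zintY[OF that] int(1,2)[OF that(2)] unfolding proj_def by (simp add: hyp)
  qed
  \<comment> \<open>Here the Heisenberg relation is centred at a point of the plane. Its cocycle is
    a transvection along that point with integral parameter, which lies in \<open>H\<close>.\<close>
  have Sz: "S (of_int q) (?pt m k) (?pr x) \<in> H" if "x \<in> zspan Y" for x m k
    using that
  proof (induction)
    case zero
    have "?pr 0 = 0" by (simp add: proj_def)
    then have "S (of_int q) (?pt m k) (?pr 0) = id" by (auto simp: S_def)
    then show ?case using H_id[OF H] by (simp only:)
  next
    case (add x y)
    have "T ((of_int q)\<^sup>2 * \<omega> (?pr x) (?pr y)) (?pt m k) \<in> H"
      by (intro T_pt_int[OF H hyp w] Ints_mult Ints_power Ints_of_int pr_int add)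
    then show ?case unfolding pr_add S_plus[OF pt_orth pt_orth]
      by (intro H_comp[OF H] add SY)
  next
    case (sub x y)
    have "S (of_int q) (?pt m k) (?pr (- y)) = S (- of_int q) (?pt m k) (?pr y)"
      unfolding pr_minus by (auto simp: S_def)
    then have "S (of_int q) (?pt m k) (?pr (- y)) \<in> H" using H_S_uminus[OF H SY[OF sub(2)] pt_orth] by simp
    moreover have "T ((of_int q)\<^sup>2 * \<omega> (?pr x) (?pr (- y))) (?pt m k) \<in> H"
      unfolding pr_minus minus_right
      by (intro T_pt_int[OF H hyp w] Ints_mult Ints_power Ints_of_int Ints_minus pr_int sub)
    ultimately have "S (of_int q) (?pt m k) (?pr (x + (- y))) \<in> H" unfolding pr_add S_plus[OF pt_orth pt_orth]
      by (intro H_comp[OF H] sub)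
    then show ?case by simp
  qed
  have "T (of_int (q * q)) x \<in> H" if x: "x \<in> zspan Y" for x
  proof -
    define u z where "u = ?pt \<lfloor>\<omega> x w2\<rfloor> \<lfloor>- \<omega> x w1\<rfloor>" and "z = ?pr x"
    have uz: "x = u + z" "\<omega> u z = 0" unfolding u_def z_def using proj_pt[OF H hyp w zint[OF x]] pt_orth by auto
    have z: "\<omega> w1 z = 0" "\<omega> w2 z = 0" "\<omega> z w1 = 0" "\<omega> z w2 = 0"
      unfolding z_def using orth orth_sym by blast+
    have 1: "S (of_int q) w1 z \<in> H" "S (of_int q) w2 z \<in> H" "S (of_int q) (w1 + w2) z \<in> H"
      using Sz[OF x, of 1 0] Sz[OF x, of 0 1] Sz[OF x, of 1 1] unfolding z_def pt_def by simp_all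
    \<comment> \<open>This is \<open>S_plus\<close> centred at \<open>z\<close> for the sum
      \<open>w1 + w2\<close>, solved for the cocycle; its parameter is \<open>q * q\<close> because
      \<open>\<omega> w1 w2 = 1\<close>.\<close>
    have "T (of_int (q * q)) z = S (- of_int q) w2 z \<circ> S (- of_int q) w1 z \<circ> S (of_int q) (w1 + w2) z"
      using z hyp skew[of w2 w1] by (auto simp: T_def S_def algebra_simps)
    moreover have "\<dots> \<in> H" using 1 z by (intro H_comp[OF H] H_S_uminus[OF H]) auto
    ultimately have Tz: "T (of_int (q * q)) z \<in> H" by simp
    have "S (of_int (q * q)) u z \<in> H"
      using H_S_int[OF H Sz[OF x] pt_orth, of q] unfolding u_def z_def by simp
    moreover have "T (of_int (q * q)) u \<in> H"
      unfolding u_def by (rule T_pt_int[OF H hyp w]) simp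
    ultimately show ?thesis unfolding uz(1) T_plus[OF uz(2)] using Tz by (intro H_comp[OF H])
  qed
  then show ?thesis using \<open>q > 0\<close> by (intro exI[of _ "q * q"]) auto
qed

end

section \<open>The symplectic group of a lattice of rank six\<close>

text \<open>A letter moves to the front of a word by conjugating the letters it passes; these stay
  in \<open>X\<close>, so the length does not change. A word longer than \<open>card X * N\<close>
  contains some letter \<open>N\<close> times, and these copies cancel once they are in front. Hence
  words of length at most \<open>card X * N\<close> represent every element.\<close>

lemma (in group) finite_if_torsion_generators:
  fixes N :: nat
  assumes X: "finite X" "X \<subseteq> carrier G" "generate G X = carrier G"
    and conj: "\<And>x y. x \<in> X \<Longrightarrow> y \<in> X \<Longrightarrow> inv y \<otimes> x \<otimes> y \<in> X"
    and N: "N > 0" "\<And>x. x \<in> X \<Longrightarrow> x [^] N = \<one>"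
  shows "finite (carrier G)"
proof -
  define W where "W xs = foldr (\<otimes>) xs \<one>" for xs
  have W_simps: "W [] = \<one>" "W (x # xs) = x \<otimes> W xs" for x xs by (simp_all add: W_def)
  have W_closed: "set xs \<subseteq> X \<Longrightarrow> W xs \<in> carrier G" for xs
    using X(2) by (induction xs) (auto simp: W_simps)
  have W_append: "set xs \<subseteq> X \<Longrightarrow> set ys \<subseteq> X \<Longrightarrow> W (xs @ ys) = W xs \<otimes> W ys" for xs ys
    using X(2) by (induction xs) (auto simp: W_simps W_closed m_assoc subset_iff)
  have W_pow: "x \<in> X \<Longrightarrow> W (replicate n x) = x [^] n" for x n
    using X(2) nat_pow_Suc2[of x] by (induction n) (auto simp: W_simps subset_iff)
  have pull: "\<exists>ys. set ys \<subseteq> X \<and> W (x # ys) = W xs \<and> Suc (length ys) = length xs \<and> Suc (count_list ys x) = count_list xs x"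
    if "set xs \<subseteq> X" "x \<in> set xs" for x xs
    using that
  proof (induction xs)
    case (Cons y xs)
    show ?case
    proof (cases "y = x")
      case True
      then show ?thesis using Cons by (intro exI[of _ xs]) auto
    next
      case False
      then obtain ys where ys: "set ys \<subseteq> X" "W (x # ys) = W xs" "Suc (length ys) = length xs"
          "Suc (count_list ys x) = count_list xs x"
        using Cons by auto
      define z where "z = inv x \<otimes> y \<otimes> x"
      have xy: "x \<in> X" "y \<in> X" using Cons by auto
      then have c: "x \<in> carrier G" "y \<in> carrier G" using X(2) by auto
      have z: "z \<in> X" unfolding z_def using conj xy by blast
      \<comment> \<open>Conjugation by \<open>x\<close> fixes \<open>x\<close>, so no other letter
        turns into \<open>x\<close>. The count of the remaining copies is therefore exact, and
        pulling can be repeated.\<close>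
      have "z \<noteq> x"
      proof
        assume "z = x"
        then have "x \<otimes> (inv x \<otimes> y \<otimes> x) = x \<otimes> x" by (simp add: z_def)
        then have "y \<otimes> x = x \<otimes> x" using c by (simp add: m_assoc[symmetric])
        then show False using c False by simp
      qed
      have "W (x # z # ys) = x \<otimes> (inv x \<otimes> y \<otimes> x) \<otimes> W ys"
        using c W_closed[OF ys(1)] by (simp add: W_simps z_def m_assoc)
      also have "\<dots> = y \<otimes> (x \<otimes> W ys)"
        using c W_closed[OF ys(1)] by (simp add: m_assoc[symmetric])
      also have "\<dots> = W (y # xs)" using ys(2) by (simp add: W_simps)
      finally show ?thesis using ys z \<open>z \<noteq> x\<close> False by (intro exI[of _ "z # ys"]) auto
    qed
  qed simp
  have pulls: "\<exists>ys. set ys \<subseteq> X \<and> W xs = x [^] k \<otimes> W ys \<and> length ys + k = length xs"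
    if "set xs \<subseteq> X" "x \<in> X" "k \<le> count_list xs x" for x xs k
    using that
  proof (induction k arbitrary: xs)
    case 0
    then show ?case using W_closed by (intro exI[of _ xs]) auto
  next
    case (Suc k)
    then have "x \<in> set xs" using count_list_0_iff[of xs x] by fastforce
    from pull[OF Suc.prems(1) this] obtain ys where ys: "set ys \<subseteq> X" "W (x # ys) = W xs"
        "Suc (length ys) = length xs" "Suc (count_list ys x) = count_list xs x"
      by blast
    then have "k \<le> count_list ys x" using Suc.prems(3) by simp
    from Suc.IH[OF ys(1) Suc.prems(2) this] obtain zs where zs: "set zs \<subseteq> X"
        "W ys = x [^] k \<otimes> W zs" "length zs + k = length ys" by blast
    have "W xs = x [^] Suc k \<otimes> W zs"
      using nat_pow_Suc2[of x k] m_assoc[of x "x [^] k" "W zs"] Suc.prems(2) X(2) W_closed[OF zs(1)]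
      unfolding ys(2)[symmetric] W_simps zs(2) by (auto simp: subset_iff)
    then show ?case using zs ys(3) by (intro exI[of _ zs]) auto
  qed
  have short: "\<exists>ys. set ys \<subseteq> X \<and> W ys = W xs \<and> length ys \<le> card X * N" if "set xs \<subseteq> X" for xs
    using that
  proof (induction xs rule: length_induct)
    case (1 xs)
    show ?case
    proof (cases "length xs \<le> card X * N")
      case False
      have "\<exists>x\<in>X. N \<le> count_list xs x"
      proof (rule ccontr)
        assume "\<not> ?thesis"
        then have "sum (count_list xs) X \<le> card X * N"
          by (intro sum_bounded_above[where K = N, simplified]) auto
        then show False using False sum_count_set[OF 1(2) X(1)] by simp
      qed
      then obtain x where x: "x \<in> X" "N \<le> count_list xs x" by blast
      from pulls[OF 1(2) x] obtain ys where ys: "set ys \<subseteq> X" "W xs = x [^] N \<otimes> W ys" "length ys + N = length xs"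
        by blast
      then have "W xs = W ys" using N(2)[OF x(1)] W_closed[OF ys(1)] by simp
      then show ?thesis using 1(1) ys N(1) by force
    qed (use 1 in auto)
  qed
  have "\<exists>xs. set xs \<subseteq> X \<and> g = W xs" if "g \<in> generate G X" for g
    using that
  proof (induction)
    case one
    then show ?case by (intro exI[of _ "[]"]) (simp add: W_simps)
  next
    case (incl h)
    then show ?case using X(2) by (intro exI[of _ "[h]"]) (auto simp: W_simps)
  next
    case (inv h)
    then have h: "h \<in> carrier G" using X(2) by auto
    \<comment> \<open>Torsion turns the inverse of a generator into a positive word.\<close>
    have "h [^] (N - 1) \<otimes> h = \<one>" using nat_pow_Suc[of h "N - 1"] N(1) N(2)[OF inv] by simp
    then have "inv h = h [^] (N - 1)" using h by (simp add: inv_equality)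
    then show ?case using W_pow[OF inv, of "N - 1"] inv by (intro exI[of _ "replicate (N - 1) h"]) auto
  next
    case (eng h1 h2)
    then obtain xs ys where "set xs \<subseteq> X" "h1 = W xs" "set ys \<subseteq> X" "h2 = W ys" by blast
    then show ?case using W_append by (intro exI[of _ "xs @ ys"]) auto
  qed
  then have "carrier G \<subseteq> W ` {xs. set xs \<subseteq> X \<and> length xs \<le> card X * N}"
    using X(3) short by (smt (verit) image_eqI mem_Collect_eq subsetI)
  then show ?thesis using finite_lists_length_le[OF X(1)] finite_surj by blast
qed


section \<open>The unimodular lattice and its isometry group\<close>

locale symplectic_lattice = symplectic_space +
  fixes e1 e2 e3 f1 f2 f3 :: "'a::real_vector"
  assumes pairs: "\<omega> e1 f1 = 1" "\<omega> e2 f2 = 1" "\<omega> e3 f3 = 1"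
    and orth: "\<omega> e1 e2 = 0" "\<omega> e1 e3 = 0" "\<omega> e2 e3 = 0" "\<omega> f1 f2 = 0" "\<omega> f1 f3 = 0" "\<omega> f2 f3 = 0"
      "\<omega> e1 f2 = 0" "\<omega> e1 f3 = 0" "\<omega> e2 f1 = 0" "\<omega> e2 f3 = 0" "\<omega> e3 f1 = 0" "\<omega> e3 f2 = 0"
    and span: "x = \<omega> x f1 *\<^sub>R e1 - \<omega> x e1 *\<^sub>R f1 + \<omega> x f2 *\<^sub>R e2 - \<omega> x e2 *\<^sub>R f2 + \<omega> x f3 *\<^sub>R e3 - \<omega> x e3 *\<^sub>R f3"
begin

lemma pairs': "\<omega> f1 e1 = -1" "\<omega> f2 e2 = -1" "\<omega> f3 e3 = -1"
  using pairs skew[of f1 e1] skew[of f2 e2] skew[of f3 e3] by simp_all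

lemma orth': "\<omega> e2 e1 = 0" "\<omega> e3 e1 = 0" "\<omega> e3 e2 = 0" "\<omega> f2 f1 = 0" "\<omega> f3 f1 = 0" "\<omega> f3 f2 = 0"
  "\<omega> f2 e1 = 0" "\<omega> f3 e1 = 0" "\<omega> f1 e2 = 0" "\<omega> f3 e2 = 0" "\<omega> f1 e3 = 0" "\<omega> f2 e3 = 0"
  using orth orth_sym by simp_all

lemmas basis_simps = pairs orth pairs' orth'

text \<open>With a symplectic basis the lattice is its own dual, so this is the integral span of the
  basis (\<open>Lam_obtain\<close>). The description by pairings is the one that is easily verified
  for vectors given by congruences.\<close>

definition Lam :: "'a set" where
  "Lam = {x. \<omega> x e1 \<in> \<int> \<and> \<omega> x f1 \<in> \<int> \<and> \<omega> x e2 \<in> \<int> \<and> \<omega> x f2 \<in> \<int> \<and> \<omega> x e3 \<in> \<int> \<and> \<omega> x f3 \<in> \<int>}"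

lemma Lam_basis: "e1 \<in> Lam" "e2 \<in> Lam" "e3 \<in> Lam" "f1 \<in> Lam" "f2 \<in> Lam" "f3 \<in> Lam"
  by (simp_all add: Lam_def basis_simps)

lemma Lam_add: "x \<in> Lam \<Longrightarrow> y \<in> Lam \<Longrightarrow> x + y \<in> Lam"
  and Lam_diff: "x \<in> Lam \<Longrightarrow> y \<in> Lam \<Longrightarrow> x - y \<in> Lam"
  and Lam_scale: "x \<in> Lam \<Longrightarrow> q \<in> \<int> \<Longrightarrow> q *\<^sub>R x \<in> Lam"
  and Lam_minus: "x \<in> Lam \<Longrightarrow> - x \<in> Lam"
  by (simp_all add: Lam_def)

lemma Lam_obtain:
  assumes "x \<in> Lam"
  obtains a1 b1 a2 b2 a3 b3 :: int where
    "x = of_int a1 *\<^sub>R e1 + of_int b1 *\<^sub>R f1 + of_int a2 *\<^sub>R e2 + of_int b2 *\<^sub>R f2 + of_int a3 *\<^sub>R e3 + of_int b3 *\<^sub>R f3"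
proof -
  obtain a1 b1 a2 b2 a3 b3 where i: "\<omega> x e1 = of_int b1" "\<omega> x f1 = of_int a1" "\<omega> x e2 = of_int b2" "\<omega> x f2 = of_int a2"
      "\<omega> x e3 = of_int b3" "\<omega> x f3 = of_int a3"
    using assms by (auto simp: Lam_def elim!: Ints_cases)
  show ?thesis by (rule that[of a1 "- b1" a2 "- b2" a3 "- b3"]) (use span[of x] i in simp)
qed

lemma Lam_int: "x \<in> Lam \<Longrightarrow> y \<in> Lam \<Longrightarrow> \<omega> x y \<in> \<int>"
  by (erule Lam_obtain[of y]) (simp add: Lam_def)

lemma T_Lam: "v \<in> Lam \<Longrightarrow> x \<in> Lam \<Longrightarrow> q \<in> \<int> \<Longrightarrow> T q v x \<in> Lam"
  unfolding T_def by (intro Lam_add Lam_scale Ints_mult Lam_int)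

text \<open>A copy of \<open>Sp_6(Z)\<close>. Requiring the image of \<open>Lam\<close> to be all of
  \<open>Lam\<close> makes inverses stay inside.\<close>

definition G :: "('a \<Rightarrow> 'a) monoid" where
  "G = \<lparr>carrier = {g. isometry g \<and> g ` Lam = Lam}, mult = (\<circ>), one = id\<rparr>"

lemma G_simps: "x \<otimes>\<^bsub>G\<^esub> y = x \<circ> y" "\<one>\<^bsub>G\<^esub> = id" "g \<in> carrier G \<longleftrightarrow> isometry g \<and> g ` Lam = Lam"
  by (simp_all add: G_def)

lemma isometry_comp: "isometry f \<Longrightarrow> isometry g \<Longrightarrow> isometry (f \<circ> g)"
  by (simp add: isometry_def bij_comp linear_compose)

lemma isometry_inv: "isometry g \<Longrightarrow> isometry (inv_into UNIV g)"
proof -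
  assume g: "isometry g"
  then have i: "g (inv_into UNIV g x) = x" "inv_into UNIV g (g x) = x" for x
    by (simp_all add: isometry_def bij_is_surj surj_f_inv_f bij_is_inj)
  have inj: "g x = g y \<Longrightarrow> x = y" for x y using g by (simp add: isometry_def bij_is_inj inj_eq)
  have l: "linear g" and p: "\<omega> (g x) (g y) = \<omega> x y" for x y using g by (auto simp: isometry_def)
  have "linear (inv_into UNIV g)"
    by (rule linearI; rule inj) (simp_all add: i linear_add[OF l] linear_scale[OF l])
  moreover have "\<omega> (inv_into UNIV g x) (inv_into UNIV g y) = \<omega> x y" for x y
    using p[of "inv_into UNIV g x" "inv_into UNIV g y"] by (simp add: i)
  moreover have "bij (inv_into UNIV g)" using g by (simp add: isometry_def bij_imp_bij_inv)
  ultimately show ?thesis by (simp add: isometry_def)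
qed

lemma inv_Lam: "isometry g \<Longrightarrow> g ` Lam = Lam \<Longrightarrow> inv_into UNIV g ` Lam = Lam"
  by (metis isometry_def bij_is_inj inv_into_image_cancel subset_UNIV)

lemma group_G: "group G"
proof (rule groupI)
  fix g assume "g \<in> carrier G"
  then have g: "isometry g" "g ` Lam = Lam" by (simp_all add: G_simps)
  moreover have "inv_into UNIV g \<circ> g = id" using g(1) by (auto simp: isometry_def bij_is_inj)
  ultimately show "\<exists>h\<in>carrier G. h \<otimes>\<^bsub>G\<^esub> g = \<one>\<^bsub>G\<^esub>"
    by (intro bexI[of _ "inv_into UNIV g"]) (simp_all add: G_simps isometry_inv inv_Lam)
next
  show "\<one>\<^bsub>G\<^esub> \<in> carrier G" by (simp add: G_simps isometry_def linear_id)
next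
  fix f g assume "f \<in> carrier G" "g \<in> carrier G"
  then show "f \<otimes>\<^bsub>G\<^esub> g \<in> carrier G"
    unfolding G_simps image_comp[symmetric] by (simp add: isometry_comp del: comp_apply image_image)
qed (simp_all add: G_simps comp_assoc)

sublocale G: group G by (rule group_G)

lemma T_carrier: "v \<in> Lam \<Longrightarrow> q \<in> \<int> \<Longrightarrow> T q v \<in> carrier G"
proof -
  assume v: "v \<in> Lam" "q \<in> \<int>"
  have "T q v ` Lam \<subseteq> Lam" "T (- q) v ` Lam \<subseteq> Lam" using v T_Lam by auto
  moreover have "T q v (T (- q) v x) = x" for x using fun_cong[OF T_add[of q v "- q"], of x] by simp
  ultimately have "T q v ` Lam = Lam" by (metis image_eqI subsetI subset_antisym subset_iff)
  then show ?thesis by (simp add: G_simps T_isometry)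
qed

lemma T_inv: "v \<in> Lam \<Longrightarrow> q \<in> \<int> \<Longrightarrow> inv\<^bsub>G\<^esub> (T q v) = T (- q) v"
  by (rule G.inv_equality) (simp_all add: G_simps(1,2) T_add T_carrier)

lemma G_fun: "g \<in> carrier G \<Longrightarrow> linear g" "g \<in> carrier G \<Longrightarrow> \<omega> (g x) (g y) = \<omega> x y"
    "g \<in> carrier G \<Longrightarrow> x \<in> Lam \<Longrightarrow> g x \<in> Lam"
  by (auto simp: G_simps isometry_def)

section \<open>Generation of the lattice group by transvections\<close>

definition gens :: "real \<Rightarrow> 'a set \<Rightarrow> ('a \<Rightarrow> 'a) set" where
  "gens q U = {T q v | v. v \<in> Lam \<and> (\<forall>s\<in>U. \<omega> s v = 0)}"

lemma gens_carrier: "q \<in> \<int> \<Longrightarrow> gens q U \<subseteq> carrier G"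
  by (auto simp: gens_def T_carrier)

text \<open>The set \<open>U\<close> holds the part of the symplectic basis that is already in
  place: transvections along vectors orthogonal to \<open>U\<close> fix it pointwise, so reduction
  of the rank can continue in its complement.\<close>

definition R :: "'a set \<Rightarrow> ('a \<Rightarrow> 'a) set" where
  "R U = generate G (gens 1 U)"

lemma R_subgroup: "subgroup (R U) G"
  unfolding R_def by (intro G.generate_is_subgroup gens_carrier) simp

lemma R_carrier: "\<rho> \<in> R U \<Longrightarrow> \<rho> \<in> carrier G"
  using subgroup.mem_carrier[OF R_subgroup] .

lemma R_comp: "\<rho> \<in> R U \<Longrightarrow> \<sigma> \<in> R U \<Longrightarrow> \<rho> \<circ> \<sigma> \<in> R U"
  using subgroup.m_closed[OF R_subgroup, of \<rho> U \<sigma>] by (simp add: G_simps(1))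

lemma R_T: "v \<in> Lam \<Longrightarrow> \<forall>s\<in>U. \<omega> s v = 0 \<Longrightarrow> T (of_int k) v \<in> R U"
proof -
  assume v: "v \<in> Lam" "\<forall>s\<in>U. \<omega> s v = 0"
  have 1: "T 1 v \<in> R U" unfolding R_def by (intro generate.incl) (use v in \<open>auto simp: gens_def\<close>)
  have 0: "id \<in> R U" using subgroup.one_closed[OF R_subgroup] by (simp add: G_simps(2))
  have n: "T (of_nat n) v \<in> R U" for n
  proof (induction n)
    case (Suc n)
    from R_comp[OF 1 Suc] show ?case by (simp add: T_add)
  qed (use 0 in \<open>simp add: id_def\<close>)
  show ?thesis
  proof (cases "k \<ge> 0")
    case True
    then show ?thesis using n[of "nat k"] by simp
  next
    case False
    then have "inv\<^bsub>G\<^esub> (T (of_nat (nat (- k))) v) \<in> R U" by (intro subgroup.m_inv_closed[OF R_subgroup] n)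
    then show ?thesis using False T_inv[OF v(1), of "of_nat (nat (- k))"] by simp
  qed
qed

lemma R_S:
  assumes "u \<in> Lam" "z \<in> Lam" "\<omega> u z = 0" "\<forall>s\<in>U. \<omega> s u = 0" "\<forall>s\<in>U. \<omega> s z = 0"
  shows "S (of_int k) u z \<in> R U"
proof -
  have "T (of_int k) (u + z) \<in> R U" "T (of_int (- k)) u \<in> R U" "T (of_int (- k)) z \<in> R U"
    using assms by (intro R_T; simp add: Lam_add)+
  then show ?thesis unfolding S_eq_T[OF assms(3)] using R_comp by simp
qed

lemma R_fix: "\<rho> \<in> R U \<Longrightarrow> s \<in> U \<Longrightarrow> \<rho> s = s"
proof -
  assume "\<rho> \<in> R U" and s: "s \<in> U"
  then have "\<rho> \<in> generate G (gens 1 U)" by (simp add: R_def)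
  then show ?thesis
  proof (induction)
    case (inv h)
    then obtain v where "h = T 1 v" "v \<in> Lam" "\<omega> s v = 0" using s by (auto simp: gens_def)
    then show ?case by (simp add: T_inv T_orth)
  qed (use s in \<open>auto simp: gens_def G_simps T_orth\<close>)
qed

lemma R_mono: "U' \<subseteq> U \<Longrightarrow> R U \<subseteq> R U'"
  unfolding R_def by (intro G.mono_generate) (auto simp: gens_def)

definition reach :: "'a set \<Rightarrow> 'a \<Rightarrow> 'a \<Rightarrow> bool" where
  "reach U x y \<longleftrightarrow> (\<exists>\<rho>\<in>R U. \<rho> x = y)"

text \<open>Stated backwards, in the shape of the step cases of
  \<open>euclid_induct\<close>.\<close>

lemma reach_step: "\<sigma> \<in> R U \<Longrightarrow> reach U (\<sigma> x) y \<Longrightarrow> reach U x y"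
  unfolding reach_def by (metis R_comp comp_apply)

lemma reach_refl: "reach U x x"
  unfolding reach_def using subgroup.one_closed[OF R_subgroup, of U]
  by (intro bexI[of _ id]) (simp_all add: G_simps(2))

lemma reach_trans: "reach U x y \<Longrightarrow> reach U y z \<Longrightarrow> reach U x z"
  unfolding reach_def by (metis R_comp comp_apply)

text \<open>The transvections along \<open>e\<close> and \<open>f\<close> act on their plane as
  elementary matrices, so Euclid's algorithm clears the coordinate of \<open>f\<close>;
  \<open>y\<close> is orthogonal to both and does not move.\<close>

lemma reach_plane:
  assumes ef: "e \<in> Lam" "f \<in> Lam" "\<omega> e f = 1" "\<forall>s\<in>U. \<omega> s e = 0" "\<forall>s\<in>U. \<omega> s f = 0"
    and y: "\<omega> y e = 0" "\<omega> y f = 0"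
  shows "\<exists>d::int. reach U (of_int a *\<^sub>R e + of_int b *\<^sub>R f + y) (of_int d *\<^sub>R e + y)"
proof (induction a b rule: euclid_induct)
  have fe: "\<omega> f e = -1" using skew[of f e] ef(3) by simp
  note R = R_T[OF ef(1,4), of 1] R_T[OF ef(1,4), of "-1"] R_T[OF ef(2,5), of 1] R_T[OF ef(2,5), of "-1"]
  {
    case (1 a b)
    have "T (of_int (-1)) e (of_int a *\<^sub>R e + of_int b *\<^sub>R f + y) = of_int (a + b) *\<^sub>R e + of_int b *\<^sub>R f + y"
      by (simp add: T_def fe y algebra_simps)
    with 1 show ?case using reach_step[OF R(2)] by metis
  next
    case (2 a b)
    have "T (of_int 1) e (of_int a *\<^sub>R e + of_int b *\<^sub>R f + y) = of_int (a - b) *\<^sub>R e + of_int b *\<^sub>R f + y"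
      by (simp add: T_def fe y algebra_simps)
    with 2 show ?case using reach_step[OF R(1)] by metis
  next
    case (3 a b)
    have "T (of_int 1) f (of_int a *\<^sub>R e + of_int b *\<^sub>R f + y) = of_int a *\<^sub>R e + of_int (b + a) *\<^sub>R f + y"
      by (simp add: T_def ef y algebra_simps)
    with 3 show ?case using reach_step[OF R(3)] by metis
  next
    case (4 a b)
    have "T (of_int (-1)) f (of_int a *\<^sub>R e + of_int b *\<^sub>R f + y) = of_int a *\<^sub>R e + of_int (b - a) *\<^sub>R f + y"
      by (simp add: T_def ef y algebra_simps)
    with 4 show ?case using reach_step[OF R(4)] by metis
  next
    case (5 d)
    show ?case using reach_refl[of U "of_int d *\<^sub>R e + y"] by (intro exI[of _ d]) simp
  }
qed

text \<open>Now the two coordinates belong to an isotropic pair. The maps \<open>S 1 e f'\<close>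
  and \<open>S 1 e' f\<close> act on it as elementary matrices, so Euclid's algorithm applies
  again.\<close>

lemma reach_merge:
  assumes e: "e \<in> Lam" "f \<in> Lam" "\<omega> e f = 1" "\<forall>s\<in>U. \<omega> s e = 0" "\<forall>s\<in>U. \<omega> s f = 0"
    and e': "e' \<in> Lam" "f' \<in> Lam" "\<omega> e' f' = 1" "\<forall>s\<in>U. \<omega> s e' = 0" "\<forall>s\<in>U. \<omega> s f' = 0"
    and o: "\<omega> e e' = 0" "\<omega> e f' = 0" "\<omega> e' f = 0"
    and y: "\<omega> y e = 0" "\<omega> y f = 0" "\<omega> y e' = 0" "\<omega> y f' = 0"
  shows "\<exists>d::int. reach U (of_int a *\<^sub>R e + of_int b *\<^sub>R e' + y) (of_int d *\<^sub>R e + y)"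
proof (induction a b rule: euclid_induct)
  note R = R_S[OF e(1) e'(2) o(2) e(4) e'(5), of 1] R_S[OF e(1) e'(2) o(2) e(4) e'(5), of "-1"]
    R_S[OF e'(1) e(2) o(3) e'(4) e(5), of 1] R_S[OF e'(1) e(2) o(3) e'(4) e(5), of "-1"]
  have o': "\<omega> e' e = 0" using o orth_sym by blast
  {
    case (1 a b)
    have "S (of_int 1) e f' (of_int a *\<^sub>R e + of_int b *\<^sub>R e' + y) = of_int (a + b) *\<^sub>R e + of_int b *\<^sub>R e' + y"
      by (simp add: S_def e e' o o' y algebra_simps)
    with 1 show ?case using reach_step[OF R(1)] by metis
  next
    case (2 a b)
    have "S (of_int (-1)) e f' (of_int a *\<^sub>R e + of_int b *\<^sub>R e' + y) = of_int (a - b) *\<^sub>R e + of_int b *\<^sub>R e' + y"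
      by (simp add: S_def e e' o o' y algebra_simps)
    with 2 show ?case using reach_step[OF R(2)] by metis
  next
    case (3 a b)
    have "S (of_int 1) e' f (of_int a *\<^sub>R e + of_int b *\<^sub>R e' + y) = of_int a *\<^sub>R e + of_int (b + a) *\<^sub>R e' + y"
      by (simp add: S_def e e' o o' y algebra_simps)
    with 3 show ?case using reach_step[OF R(3)] by metis
  next
    case (4 a b)
    have "S (of_int (-1)) e' f (of_int a *\<^sub>R e + of_int b *\<^sub>R e' + y) = of_int a *\<^sub>R e + of_int (b - a) *\<^sub>R e' + y"
      by (simp add: S_def e e' o o' y algebra_simps)
    with 4 show ?case using reach_step[OF R(4)] by metis
  next
    case (5 d)
    show ?case using reach_refl[of U "of_int d *\<^sub>R e + y"] by (intro exI[of _ d]) simp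
  }
qed


lemma reach_V3:
  assumes v: "v \<in> Lam" "\<forall>s\<in>{e1, f1, e2, f2}. \<omega> v s = 0"
  shows "\<exists>d::int. reach {e1, f1, e2, f2} v (of_int d *\<^sub>R e3)"
proof -
  obtain a b where ab: "\<omega> v e3 = of_int b" "\<omega> v f3 = of_int a" using v by (auto simp: Lam_def elim!: Ints_cases)
  have "v = of_int a *\<^sub>R e3 + of_int (- b) *\<^sub>R f3 + 0" using span[of v] v ab by simp
  then show ?thesis using reach_plane[of e3 f3 "{e1, f1, e2, f2}" 0 a "- b"] by (simp add: Lam_basis basis_simps)
qed

lemma reach_V23:
  assumes v: "v \<in> Lam" "\<forall>s\<in>{e1, f1}. \<omega> v s = 0"
  shows "\<exists>d::int. reach {e1, f1} v (of_int d *\<^sub>R e2)"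
proof -
  obtain a b c d where ab: "\<omega> v e2 = of_int b" "\<omega> v f2 = of_int a" "\<omega> v e3 = of_int d" "\<omega> v f3 = of_int c"
    using v by (auto simp: Lam_def elim!: Ints_cases)
  let ?y = "of_int c *\<^sub>R e3 + of_int (- d) *\<^sub>R f3"
  have v: "v = of_int a *\<^sub>R e2 + of_int (- b) *\<^sub>R f2 + ?y" using span[of v] v ab by simp
  obtain k where 1: "reach {e1, f1} v (of_int k *\<^sub>R e2 + ?y)"
    using reach_plane[of e2 f2 "{e1, f1}" ?y a "- b"] unfolding v by (auto simp: Lam_basis basis_simps)
  obtain l where 2: "reach {e1, f1} (of_int k *\<^sub>R e2 + ?y) (of_int l *\<^sub>R e3 + of_int k *\<^sub>R e2)"
    using reach_plane[of e3 f3 "{e1, f1}" "of_int k *\<^sub>R e2" c "- d"] by (auto simp: Lam_basis basis_simps add_ac)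
  obtain m where 3: "reach {e1, f1} (of_int l *\<^sub>R e3 + of_int k *\<^sub>R e2) (of_int m *\<^sub>R e2)"
    using reach_merge[of e2 f2 "{e1, f1}" e3 f3 0 k l] by (auto simp: Lam_basis basis_simps add_ac)
  show ?thesis using reach_trans[OF reach_trans[OF 1 2] 3] by blast
qed

lemma reach_V123:
  assumes v: "v \<in> Lam"
  shows "\<exists>d::int. reach {} v (of_int d *\<^sub>R e1)"
proof -
  obtain a b a2 b2 a3 b3 where v: "v = of_int a *\<^sub>R e1 + of_int b *\<^sub>R f1 + of_int a2 *\<^sub>R e2 + of_int b2 *\<^sub>R f2
      + of_int a3 *\<^sub>R e3 + of_int b3 *\<^sub>R f3"
    using Lam_obtain[OF v] .
  let ?y = "of_int a2 *\<^sub>R e2 + of_int b2 *\<^sub>R f2 + of_int a3 *\<^sub>R e3 + of_int b3 *\<^sub>R f3"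
  have y: "?y \<in> Lam" by (intro Lam_add Lam_scale Lam_basis) auto
  \<comment> \<open>The last two planes are reduced by an element fixing \<open>e1\<close> and
    \<open>f1\<close>, so the first two coordinates survive.\<close>
  obtain d where d: "reach {e1, f1} ?y (of_int d *\<^sub>R e2)"
    using reach_V23[OF y] by (auto simp: basis_simps)
  then obtain \<rho> where \<rho>: "\<rho> \<in> R {e1, f1}" "\<rho> ?y = of_int d *\<^sub>R e2" by (auto simp: reach_def)
  note lin = G_fun(1)[OF R_carrier[OF \<rho>(1)]]
  have "\<rho> v = \<rho> (of_int a *\<^sub>R e1 + of_int b *\<^sub>R f1 + ?y)" by (simp add: v add_ac)
  also have "\<dots> = of_int a *\<^sub>R e1 + of_int b *\<^sub>R f1 + of_int d *\<^sub>R e2"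
    using R_fix[OF \<rho>(1)] \<rho>(2) by (simp only: linear_add[OF lin] linear_scale[OF lin]) simp
  finally have 1: "reach {} v (of_int a *\<^sub>R e1 + of_int b *\<^sub>R f1 + of_int d *\<^sub>R e2)"
    using \<rho>(1) R_mono[of "{}" "{e1, f1}"] by (auto simp: reach_def)
  obtain k where 2: "reach {} (of_int a *\<^sub>R e1 + of_int b *\<^sub>R f1 + of_int d *\<^sub>R e2) (of_int k *\<^sub>R e1 + of_int d *\<^sub>R e2)"
    using reach_plane[of e1 f1 "{}" "of_int d *\<^sub>R e2" a b] by (auto simp: Lam_basis basis_simps)
  obtain m where 3: "reach {} (of_int k *\<^sub>R e1 + of_int d *\<^sub>R e2) (of_int m *\<^sub>R e1)"
    using reach_merge[of e1 f1 "{}" e2 f2 0 k d] by (auto simp: Lam_basis basis_simps)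
  show ?thesis using reach_trans[OF reach_trans[OF 1 2] 3] by blast
qed

text \<open>Move \<open>g e\<close> to a multiple of \<open>e\<close>; this is \<open>e\<close> up
  to sign, and the sign can be removed. The image of \<open>f\<close> then differs from
  \<open>f\<close> by a vector orthogonal to \<open>e\<close>, which the unipotent radical of the
  stabiliser of \<open>e\<close> cancels.\<close>

lemma R_fix_pair:
  assumes g: "g \<in> carrier G" "\<forall>s\<in>U. g s = s"
    and ef: "e \<in> Lam" "f \<in> Lam" "\<omega> e f = 1" "\<forall>s\<in>U. \<omega> s e = 0" "\<forall>s\<in>U. \<omega> s f = 0"
    and trans: "\<And>v. v \<in> Lam \<Longrightarrow> \<forall>s\<in>U. \<omega> v s = 0 \<Longrightarrow> \<exists>d::int. reach U v (of_int d *\<^sub>R e)"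
  shows "\<exists>\<rho>\<in>R U. \<rho> (g e) = e \<and> \<rho> (g f) = f"
proof -
  have fe: "\<omega> f e = -1" using skew[of f e] ef(3) by simp
  have pres: "\<omega> (\<rho> (g x)) (\<rho> (g y)) = \<omega> x y" if "\<rho> \<in> R U" for \<rho> x y
    using G_fun(2)[OF R_carrier[OF that]] G_fun(2)[OF g(1)] by simp
  have inLam: "\<rho> (g x) \<in> Lam" if "\<rho> \<in> R U" "x \<in> Lam" for \<rho> x
    using G_fun(3)[OF R_carrier[OF that(1)]] G_fun(3)[OF g(1)] that(2) by simp
  have sfix: "\<omega> s (\<rho> (g x)) = \<omega> s x" if "\<rho> \<in> R U" "s \<in> U" for \<rho> s x
    using pres[OF that(1), of s x] R_fix[OF that] g(2) that(2) by simp
  have "\<forall>s\<in>U. \<omega> (g e) s = 0"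
    using ef(4) g(2) G_fun(2)[OF g(1)] orth_sym by metis
  from trans[OF G_fun(3)[OF g(1) ef(1)] this] obtain d \<rho> where \<rho>: "\<rho> \<in> R U" "\<rho> (g e) = of_int d *\<^sub>R e"
    by (auto simp: reach_def)
  obtain \<sigma> where \<sigma>: "\<sigma> \<in> R U" "\<sigma> (g e) = e"
  proof -
    \<comment> \<open>Pairing \<open>d e\<close> with the image of \<open>f\<close> gives 1, so
      \<open>d\<close> divides 1.\<close>
    obtain k where "\<omega> e (\<rho> (g f)) = of_int k" using Lam_int[OF ef(1) inLam[OF \<rho>(1) ef(2)]] by (elim Ints_cases)
    then have "of_int (d * k) = (1 :: real)" using pres[OF \<rho>(1), of e f] \<rho>(2) ef(3) by simp
    then have "d * k = 1" by linarith
    then have d: "d = 1 \<or> d = -1" by (auto simp: zmult_eq_1_iff)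
    \<comment> \<open>A quarter turn of the plane of \<open>e\<close> and \<open>f\<close>; its
      square is minus the identity there.\<close>
    let ?\<tau> = "T (of_int 1) e \<circ> T (of_int 1) f \<circ> T (of_int 1) e"
    have \<tau>: "?\<tau> \<in> R U" by (intro R_comp R_T ef)
    have "?\<tau> (?\<tau> (- e)) = e" using ef(3) fe by (simp add: T_def)
    then have "(?\<tau> \<circ> ?\<tau> \<circ> \<rho>) (g e) = e" if "d = -1" using that \<rho>(2) by simp
    then show ?thesis using d that[of \<rho>] that[of "?\<tau> \<circ> ?\<tau> \<circ> \<rho>"] \<rho> R_comp \<tau> by auto
  qed
  define r where "r = \<sigma> (g f) - f"
  define a where "a = \<omega> r f"
  define r0 where "r0 = r - a *\<^sub>R e"
  have r: "r \<in> Lam" unfolding r_def by (intro Lam_diff inLam \<sigma> ef)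
  obtain k where a: "a = of_int k" unfolding a_def using Lam_int[OF r ef(2)] by (elim Ints_cases)
  have er: "\<omega> e r = 0" using pres[OF \<sigma>(1), of e f] \<sigma>(2) by (simp add: r_def)
  have r0: "r0 \<in> Lam" unfolding r0_def a by (intro Lam_diff r Lam_scale ef) simp
  have o: "\<omega> e r0 = 0" "\<omega> r0 e = 0" "\<omega> r0 f = 0" "\<omega> f r0 = 0"
    using er orth_sym[OF er] skew[of f r] by (simp_all add: r0_def ef(3) fe a_def)
  have sr0: "\<forall>s\<in>U. \<omega> s r0 = 0"
    using sfix[OF \<sigma>(1)] ef(4) by (simp add: r0_def r_def)
  \<comment> \<open>The image of \<open>f\<close> is \<open>f + a e + r0\<close>. Since
    \<open>\<omega> f e = -1\<close>, positive parameters subtract \<open>r0\<close> and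
    \<open>a e\<close>.\<close>
  have "S (of_int 1) e r0 \<in> R U" "T (of_int k) e \<in> R U" by (intro R_S R_T ef r0 o sr0)+
  then have "T (of_int k) e \<circ> S (of_int 1) e r0 \<circ> \<sigma> \<in> R U" using R_comp \<sigma>(1) by blast
  moreover have "T (of_int k) e (S (of_int 1) e r0 (\<sigma> (g e))) = e" by (simp add: \<sigma>(2) S_def T_def o)
  moreover have "T (of_int k) e (S (of_int 1) e r0 (\<sigma> (g f))) = f"
  proof -
    have "\<sigma> (g f) = f + a *\<^sub>R e + r0" by (simp add: r0_def r_def)
    then show ?thesis by (simp add: S_def T_def o fe ef(3) a algebra_simps)
  qed
  ultimately show ?thesis by (intro bexI[of _ "T (of_int k) e \<circ> S (of_int 1) e r0 \<circ> \<sigma>"]) auto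
qed

text \<open>The three pairs are corrected in turn, each time by an element fixing the pairs already
  in place, until the product fixes the whole basis and is the identity.\<close>

lemma R_all: "R {} = carrier G"
proof
  show "carrier G \<subseteq> R {}"
  proof
    fix g assume g: "g \<in> carrier G"
    obtain \<rho>1 where 1: "\<rho>1 \<in> R {}" "\<rho>1 (g e1) = e1" "\<rho>1 (g f1) = f1"
      using R_fix_pair[OF g, of "{}" e1 f1] reach_V123 by (auto simp: Lam_basis basis_simps)
    have g1: "\<rho>1 \<circ> g \<in> carrier G" using G.m_closed[OF R_carrier[OF 1(1)] g] by (simp add: G_simps(1))
    obtain \<rho>2 where 2: "\<rho>2 \<in> R {e1, f1}" "\<rho>2 (\<rho>1 (g e2)) = e2" "\<rho>2 (\<rho>1 (g f2)) = f2"
      using R_fix_pair[OF g1, of "{e1, f1}" e2 f2] reach_V23 1 by (auto simp: Lam_basis basis_simps)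
    have g2: "\<rho>2 \<circ> (\<rho>1 \<circ> g) \<in> carrier G" using G.m_closed[OF R_carrier[OF 2(1)] g1] by (simp add: G_simps(1))
    have fx2: "\<rho>2 e1 = e1" "\<rho>2 f1 = f1" using R_fix[OF 2(1)] by auto
    obtain \<rho>3 where 3: "\<rho>3 \<in> R {e1, f1, e2, f2}" "\<rho>3 (\<rho>2 (\<rho>1 (g e3))) = e3" "\<rho>3 (\<rho>2 (\<rho>1 (g f3))) = f3"
      using R_fix_pair[OF g2, of "{e1, f1, e2, f2}" e3 f3] reach_V3 1 2 fx2 by (auto simp: Lam_basis basis_simps)
    have fx3: "\<rho>3 e1 = e1" "\<rho>3 f1 = f1" "\<rho>3 e2 = e2" "\<rho>3 f2 = f2" using R_fix[OF 3(1)] by auto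
    define \<rho> where "\<rho> = \<rho>3 \<circ> (\<rho>2 \<circ> \<rho>1)"
    have \<rho>: "\<rho> \<in> R {}"
      unfolding \<rho>_def using 1 2 3 R_mono[of "{}"] by (intro R_comp) auto
    have h: "\<rho> \<circ> g \<in> carrier G" using G.m_closed[OF R_carrier[OF \<rho>] g] by (simp add: G_simps(1))
    note lin = G_fun(1)[OF h]
    have b: "(\<rho> \<circ> g) e1 = e1" "(\<rho> \<circ> g) f1 = f1" "(\<rho> \<circ> g) e2 = e2" "(\<rho> \<circ> g) f2 = f2" "(\<rho> \<circ> g) e3 = e3" "(\<rho> \<circ> g) f3 = f3"
      using 1 2 fx2 3 fx3 by (simp_all add: \<rho>_def)
    have "(\<rho> \<circ> g) x = x" for x
    proof -
      have "(\<rho> \<circ> g) (\<omega> x f1 *\<^sub>R e1 - \<omega> x e1 *\<^sub>R f1 + \<omega> x f2 *\<^sub>R e2 - \<omega> x e2 *\<^sub>R f2 + \<omega> x f3 *\<^sub>R e3 - \<omega> x e3 *\<^sub>R f3)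
         = \<omega> x f1 *\<^sub>R e1 - \<omega> x e1 *\<^sub>R f1 + \<omega> x f2 *\<^sub>R e2 - \<omega> x e2 *\<^sub>R f2 + \<omega> x f3 *\<^sub>R e3 - \<omega> x e3 *\<^sub>R f3"
        by (simp only: linear_add[OF lin] linear_diff[OF lin] linear_scale[OF lin] b)
      then show ?thesis using span[of x] by simp
    qed
    then have "\<rho> \<otimes>\<^bsub>G\<^esub> g = \<one>\<^bsub>G\<^esub>" unfolding G_simps(1,2) by (intro ext) (metis id_apply)
    then have "g = inv\<^bsub>G\<^esub> \<rho>" using G.inv_equality[of \<rho> g] G.inv_inv R_carrier[OF \<rho>] g
      by (metis G.inv_equality G.inv_inv)
    then show "g \<in> R {}" using subgroup.m_inv_closed[OF R_subgroup \<rho>] by simp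
  qed
qed (use R_carrier in blast)

end

section \<open>The quotient by the powers of transvections\<close>

context symplectic_lattice
begin

definition K :: "int \<Rightarrow> ('a \<Rightarrow> 'a) set" where
  "K N = generate G (gens (of_int N) {})"

lemma G_conj_T: "g \<in> carrier G \<Longrightarrow> v \<in> Lam \<Longrightarrow> q \<in> \<int> \<Longrightarrow> g \<otimes>\<^bsub>G\<^esub> T q v \<otimes>\<^bsub>G\<^esub> inv\<^bsub>G\<^esub> g = T q (g v)"
proof -
  assume a: "g \<in> carrier G" "v \<in> Lam" "q \<in> \<int>"
  have "g \<otimes>\<^bsub>G\<^esub> T q v = T q (g v) \<otimes>\<^bsub>G\<^esub> g"
    using T_conj[of g q v] a(1) by (simp add: G_simps)
  then show ?thesis using a T_carrier[OF G_fun(3)] T_carrier by (simp add: G.m_assoc)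
qed

lemma K_normal: "K N \<lhd> G"
  unfolding K_def
proof (rule G.normal_generateI)
  show "gens (of_int N) {} \<subseteq> carrier G" by (rule gens_carrier) simp
next
  fix h g assume "h \<in> gens (of_int N) {}" and g: "g \<in> carrier G"
  then obtain v where "h = T (of_int N) v" "v \<in> Lam" by (auto simp: gens_def)
  then show "g \<otimes>\<^bsub>G\<^esub> h \<otimes>\<^bsub>G\<^esub> inv\<^bsub>G\<^esub> g \<in> gens (of_int N) {}"
    using g G_conj_T[of g v "of_int N"] G_fun(3)[OF g, of v] by (auto simp: gens_def)
qed

lemma K_subgroup: "subgroup (K N) G"
  using K_normal normal_imp_subgroup by blast

lemma K_comp: "f \<in> K N \<Longrightarrow> g \<in> K N \<Longrightarrow> f \<circ> g \<in> K N"
  using subgroup.m_closed[OF K_subgroup, of f N g] by (simp add: G_simps(1))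

lemma K_T: "v \<in> Lam \<Longrightarrow> T (of_int N) v \<in> K N"
  unfolding K_def by (intro generate.incl) (auto simp: gens_def)

lemma K_T_mult: "v \<in> Lam \<Longrightarrow> T (of_int (k * N)) v \<in> K N"
proof -
  assume v: "v \<in> Lam"
  have 0: "id \<in> K N" using subgroup.one_closed[OF K_subgroup] by (simp add: G_simps(2))
  have n: "T (of_int (int n * N)) v \<in> K N" for n
  proof (induction n)
    case (Suc n)
    from K_comp[OF K_T[OF v] Suc] show ?case by (simp add: T_add algebra_simps)
  qed (use 0 in \<open>simp add: id_def\<close>)
  show ?thesis
  proof (cases "k \<ge> 0")
    case True
    then show ?thesis using n[of "nat k"] by simp
  next
    case False
    then have "inv\<^bsub>G\<^esub> (T (of_int (int (nat (- k)) * N)) v) \<in> K N" by (intro subgroup.m_inv_closed[OF K_subgroup] n)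
    then show ?thesis using False T_inv[OF v, of "of_int (int (nat (- k)) * N)"] by simp
  qed
qed

text \<open>Equality of the classes of \<open>T 1 x\<close> and \<open>T 1 y\<close> modulo
  \<open>K N\<close>, since \<open>T (- 1) y\<close> is the inverse of \<open>T 1 y\<close>.\<close>

definition sim :: "int \<Rightarrow> 'a \<Rightarrow> 'a \<Rightarrow> bool" where
  "sim N x y \<longleftrightarrow> T 1 x \<circ> T (- 1) y \<in> K N"

lemma sim_sym: "sim N x y \<Longrightarrow> x \<in> Lam \<Longrightarrow> y \<in> Lam \<Longrightarrow> sim N y x"
proof -
  assume a: "sim N x y" "x \<in> Lam" "y \<in> Lam"
  have "inv\<^bsub>G\<^esub> (T 1 x \<otimes>\<^bsub>G\<^esub> T (- 1) y) \<in> K N"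
    using a(1) unfolding sim_def by (intro subgroup.m_inv_closed[OF K_subgroup]) (simp add: G_simps(1))
  moreover have "inv\<^bsub>G\<^esub> (T 1 x \<otimes>\<^bsub>G\<^esub> T (- 1) y) = T 1 y \<otimes>\<^bsub>G\<^esub> T (- 1) x"
    using a(2,3) by (simp add: G.inv_mult_group T_carrier T_inv)
  ultimately show ?thesis by (simp add: sim_def G_simps(1))
qed

lemma sim_trans: "sim N x y \<Longrightarrow> sim N y z \<Longrightarrow> sim N x z"
proof -
  assume a: "sim N x y" "sim N y z"
  have "(T 1 x \<circ> T (- 1) y) \<circ> (T 1 y \<circ> T (- 1) z) = T 1 x \<circ> (T (- 1) y \<circ> T 1 y) \<circ> T (- 1) z"
    by (simp only: comp_assoc)
  also have "\<dots> = T 1 x \<circ> T (- 1) z" by (simp add: T_add)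
  finally show ?thesis using K_comp[OF a[unfolded sim_def]] by (simp add: sim_def)
qed

text \<open>Normality of \<open>K N\<close> lets two vectors be moved into a convenient position
  before they are compared.\<close>

lemma sim_conj:
  assumes s: "sim N (g x) (g y)" and g: "g \<in> carrier G" and xy: "x \<in> Lam" "y \<in> Lam"
  shows "sim N x y"
proof -
  let ?k = "T 1 x \<otimes>\<^bsub>G\<^esub> T (- 1) y"
  have c: "T 1 x \<in> carrier G" "T (- 1) y \<in> carrier G" using xy by (simp_all add: T_carrier)
  have cancel: "inv\<^bsub>G\<^esub> g \<otimes>\<^bsub>G\<^esub> (g \<otimes>\<^bsub>G\<^esub> z) = z" "g \<otimes>\<^bsub>G\<^esub> (inv\<^bsub>G\<^esub> g \<otimes>\<^bsub>G\<^esub> z) = z" if "z \<in> carrier G" for z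
    using g that by (simp_all add: G.m_assoc[symmetric])
  have "T 1 (g x) \<otimes>\<^bsub>G\<^esub> T (- 1) (g y) = (g \<otimes>\<^bsub>G\<^esub> T 1 x \<otimes>\<^bsub>G\<^esub> inv\<^bsub>G\<^esub> g) \<otimes>\<^bsub>G\<^esub> (g \<otimes>\<^bsub>G\<^esub> T (- 1) y \<otimes>\<^bsub>G\<^esub> inv\<^bsub>G\<^esub> g)"
    using g xy by (simp add: G_conj_T)
  also have "\<dots> = g \<otimes>\<^bsub>G\<^esub> ?k \<otimes>\<^bsub>G\<^esub> inv\<^bsub>G\<^esub> g"
    using g c by (simp add: G.m_assoc cancel)
  finally have k: "g \<otimes>\<^bsub>G\<^esub> ?k \<otimes>\<^bsub>G\<^esub> inv\<^bsub>G\<^esub> g \<in> K N" using s by (simp add: sim_def G_simps(1))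
  have "inv\<^bsub>G\<^esub> g \<otimes>\<^bsub>G\<^esub> (g \<otimes>\<^bsub>G\<^esub> ?k \<otimes>\<^bsub>G\<^esub> inv\<^bsub>G\<^esub> g) \<otimes>\<^bsub>G\<^esub> g \<in> K N"
    using normal.inv_op_closed1[OF K_normal g k] .
  moreover have "inv\<^bsub>G\<^esub> g \<otimes>\<^bsub>G\<^esub> (g \<otimes>\<^bsub>G\<^esub> ?k \<otimes>\<^bsub>G\<^esub> inv\<^bsub>G\<^esub> g) \<otimes>\<^bsub>G\<^esub> g = ?k"
    using g c by (simp add: G.m_assoc cancel)
  ultimately show ?thesis by (simp add: sim_def G_simps(1))
qed

text \<open>By orthogonality the quotient of the two transvections is \<open>S N x w\<close> times
  \<open>T (N * N) w\<close>, and \<open>S N x w\<close> is itself a product of \<open>N\<close>-th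
  powers of transvections, compare \<open>S_eq_T\<close>.\<close>

lemma sim_step:
  assumes "x \<in> Lam" "w \<in> Lam" "\<omega> x w = 0"
  shows "sim N (x + of_int N *\<^sub>R w) x"
proof -
  have wx: "\<omega> w x = 0" using assms(3) orth_sym by blast
  have "T (of_int N) (x + w) \<circ> T (of_int (- 1 * N)) x \<circ> T (of_int (- 1 * N)) w \<circ> T (of_int (N * N)) w \<in> K N"
    by (intro K_comp K_T K_T_mult Lam_add assms)
  moreover have "T (of_int N) (x + w) \<circ> T (of_int (- 1 * N)) x \<circ> T (of_int (- 1 * N)) w \<circ> T (of_int (N * N)) w
      = T 1 (x + of_int N *\<^sub>R w) \<circ> T (- 1) x"
    by (intro ext) (simp add: T_def assms(3) wx algebra_simps)
  ultimately show ?thesis by (simp add: sim_def)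
qed

text \<open>A shift not orthogonal to \<open>v\<close> needs a detour through a free plane. Moving
  \<open>v\<close> to \<open>d e1\<close> and \<open>w\<close> to \<open>a e1 + b f1 + c e2\<close>
  frees the third one. A shift by \<open>N\<close> times \<open>N w\<close> is obstructed by the
  pairing \<open>N d b\<close>, which the auxiliary \<open>N e3\<close> absorbs through
  \<open>d b f3\<close>. Only multiples of \<open>N\<close> can be absorbed in this way, hence the
  second factor \<open>N\<close>.\<close>

lemma sim_congruent:
  assumes v: "v \<in> Lam" "w \<in> Lam"
  shows "sim N (v + of_int (N * N) *\<^sub>R w) v"
proof -
  obtain d \<rho> where \<rho>: "\<rho> \<in> R {}" "\<rho> v = of_int d *\<^sub>R e1" using reach_V123[OF v(1)] by (auto simp: reach_def)
  note \<rho>c = R_carrier[OF \<rho>(1)]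
  note \<rho>l = G_fun(1)[OF \<rho>c]
  obtain a b a2 b2 a3 b3 where w: "\<rho> w = of_int a *\<^sub>R e1 + of_int b *\<^sub>R f1 + of_int a2 *\<^sub>R e2 + of_int b2 *\<^sub>R f2
      + of_int a3 *\<^sub>R e3 + of_int b3 *\<^sub>R f3"
    using Lam_obtain[OF G_fun(3)[OF \<rho>c v(2)]] .
  let ?y = "of_int a2 *\<^sub>R e2 + of_int b2 *\<^sub>R f2 + of_int a3 *\<^sub>R e3 + of_int b3 *\<^sub>R f3"
  have y: "?y \<in> Lam" by (intro Lam_add Lam_scale Lam_basis) auto
  obtain c where "reach {e1, f1} ?y (of_int c *\<^sub>R e2)"
    using reach_V23[OF y] by (auto simp: basis_simps)
  then obtain \<sigma> where \<sigma>: "\<sigma> \<in> R {e1, f1}" "\<sigma> ?y = of_int c *\<^sub>R e2" by (auto simp: reach_def)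
  note \<sigma>c = R_carrier[OF \<sigma>(1)]
  note \<sigma>l = G_fun(1)[OF \<sigma>c]
  have \<sigma>f: "\<sigma> e1 = e1" "\<sigma> f1 = f1" using R_fix[OF \<sigma>(1)] by auto
  let ?N = "of_int N :: real" and ?a = "of_int a :: real" and ?b = "of_int b :: real"
    and ?c = "of_int c :: real" and ?d = "of_int d :: real"
  let ?w = "?a *\<^sub>R e1 + ?b *\<^sub>R f1 + ?c *\<^sub>R e2"
  have "\<rho> w = ?a *\<^sub>R e1 + ?b *\<^sub>R f1 + ?y" by (simp add: w add_ac)
  then have 1: "\<sigma> (\<rho> w) = ?w" using \<sigma>(2) by (simp only: linear_add[OF \<sigma>l] linear_scale[OF \<sigma>l] \<sigma>f)
  have 2: "\<sigma> (\<rho> v) = ?d *\<^sub>R e1" by (simp add: \<rho>(2) linear_scale[OF \<sigma>l] \<sigma>f)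
  have 3: "\<sigma> (\<rho> (v + of_int (N * N) *\<^sub>R w)) = ?d *\<^sub>R e1 + (?N * ?N) *\<^sub>R ?w"
    by (simp only: linear_add[OF \<sigma>l] linear_scale[OF \<sigma>l] linear_add[OF \<rho>l] linear_scale[OF \<rho>l] 1 2 of_int_mult)
  (* Chain: p0 ~ p0 + N e3 ~ p2 ~ d e1. The summand d b f3 of u makes u orthogonal to p1. *)
  let ?p0 = "?d *\<^sub>R e1 + (?N * ?N) *\<^sub>R ?w"
  let ?p1 = "?p0 + ?N *\<^sub>R e3"
  let ?u = "(?d * ?b) *\<^sub>R f3 - ?N *\<^sub>R ?w"
  let ?p2 = "?d *\<^sub>R e1 + ?N *\<^sub>R (e3 + (?d * ?b) *\<^sub>R f3)"
  let ?q = "- (e3 + (?d * ?b) *\<^sub>R f3)"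
  have Lw: "?w \<in> Lam" by (intro Lam_add Lam_scale Lam_basis) auto
  have Lp0: "?p0 \<in> Lam" by (intro Lam_add Lam_scale Lam_basis Lw) auto
  have Lp1: "?p1 \<in> Lam" by (intro Lam_add Lp0 Lam_scale Lam_basis) auto
  have Lu: "?u \<in> Lam" by (intro Lam_diff Lw Lam_scale Lam_basis) auto
  have Lq: "?q \<in> Lam" by (intro Lam_minus Lam_add Lam_scale Lam_basis) auto
  have Lp2: "?p2 \<in> Lam" by (intro Lam_add Lam_scale Lam_basis) auto
  have Ld: "?d *\<^sub>R e1 \<in> Lam" by (intro Lam_scale Lam_basis) auto
  have "sim N ?p1 ?p0" by (rule sim_step[OF Lp0 Lam_basis(3)]) (simp add: basis_simps)
  moreover have "sim N (?p1 + ?N *\<^sub>R ?u) ?p1"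
    by (rule sim_step[OF Lp1 Lu]) (simp add: basis_simps algebra_simps)
  moreover have "?p1 + ?N *\<^sub>R ?u = ?p2" by (simp add: algebra_simps)
  moreover have "sim N (?p2 + ?N *\<^sub>R ?q) ?p2"
    by (rule sim_step[OF Lp2 Lq]) (simp add: basis_simps algebra_simps)
  moreover have "?p2 + ?N *\<^sub>R ?q = ?d *\<^sub>R e1" by (simp add: algebra_simps)
  ultimately have "sim N ?p2 ?p0" "sim N (?d *\<^sub>R e1) ?p2" using sim_trans by metis+
  then have "sim N ?p0 (?d *\<^sub>R e1)" using sim_trans sim_sym Lp0 Ld by metis
  then have "sim N (\<sigma> (\<rho> (v + of_int (N * N) *\<^sub>R w))) (\<sigma> (\<rho> v))" unfolding 3 2 .
  moreover have "v + of_int (N * N) *\<^sub>R w \<in> Lam" by (intro Lam_add Lam_scale v) auto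
  ultimately show ?thesis
    using sim_conj[OF sim_conj[OF _ \<sigma>c] \<rho>c] G_fun(3)[OF \<rho>c] v(1) by blast
qed

theorem finite_rcosets_K:
  assumes N: "N > 0"
  shows "finite (rcosets\<^bsub>G\<^esub> (K N))"
proof -
  interpret normal "K N" G by (rule K_normal)
  interpret F: group "G Mod K N" by (rule factorgroup_is_group)
  let ?\<pi> = "\<lambda>g. K N #>\<^bsub>G\<^esub> g"
  interpret \<pi>: group_hom G "G Mod K N" ?\<pi>
    by (intro group_hom.intro group_hom_axioms.intro r_coset_hom_Mod G.group_axioms F.group_axioms)
  define X where "X = ?\<pi> ` gens 1 {}"
  have gens: "gens 1 {} \<subseteq> carrier G" by (rule gens_carrier) simp
  have surj: "?\<pi> ` carrier G = carrier (G Mod K N)" by (auto simp: FactGroup_def RCOSETS_def)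
  have "finite (carrier (G Mod K N))"
  proof (rule F.finite_if_torsion_generators[of X "nat N"])
    show "X \<subseteq> carrier (G Mod K N)" using gens surj by (auto simp: X_def)
    show "generate (G Mod K N) X = carrier (G Mod K N)"
      using \<pi>.generate_img[OF gens] R_all surj by (simp add: X_def R_def)
    show "nat N > 0" using N by simp
    show "x [^]\<^bsub>G Mod K N\<^esub> nat N = \<one>\<^bsub>G Mod K N\<^esub>" if "x \<in> X" for x
    proof -
      obtain v where v: "x = ?\<pi> (T 1 v)" "v \<in> Lam" using \<open>x \<in> X\<close> by (auto simp: X_def gens_def)
      have "T 1 v [^]\<^bsub>G\<^esub> n = T (of_nat n) v" for n :: nat
        by (induction n) (auto simp: G_simps(1,2) T_add add_ac id_def)
      then have "x [^]\<^bsub>G Mod K N\<^esub> nat N = ?\<pi> (T (of_int N) v)"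
        using v N T_carrier[of v 1] \<pi>.hom_nat_pow[of "T 1 v" "nat N"] by simp
      also have "\<dots> = K N" by (intro G.coset_join2 K_subgroup K_T T_carrier v) simp
      finally show ?thesis by (simp add: FactGroup_def)
    qed
    show "inv\<^bsub>G Mod K N\<^esub> y \<otimes>\<^bsub>G Mod K N\<^esub> x \<otimes>\<^bsub>G Mod K N\<^esub> y \<in> X" if "x \<in> X" "y \<in> X" for x y
    proof -
      obtain v w where v: "x = ?\<pi> (T 1 v)" "v \<in> Lam" and w: "y = ?\<pi> (T 1 w)" "w \<in> Lam"
        using \<open>x \<in> X\<close> \<open>y \<in> X\<close> by (auto simp: X_def gens_def)
      let ?g = "T (- 1) w"
      have c: "T 1 v \<in> carrier G" "T 1 w \<in> carrier G" "?g \<in> carrier G" using v w by (simp_all add: T_carrier)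
      have gi: "inv\<^bsub>G\<^esub> ?g = T 1 w" using w(2) by (simp add: T_inv)
      have "inv\<^bsub>G Mod K N\<^esub> y \<otimes>\<^bsub>G Mod K N\<^esub> x \<otimes>\<^bsub>G Mod K N\<^esub> y = ?\<pi> (inv\<^bsub>G\<^esub> (T 1 w) \<otimes>\<^bsub>G\<^esub> T 1 v \<otimes>\<^bsub>G\<^esub> T 1 w)"
        using c by (simp add: v(1) w(1))
      also have "inv\<^bsub>G\<^esub> (T 1 w) \<otimes>\<^bsub>G\<^esub> T 1 v \<otimes>\<^bsub>G\<^esub> T 1 w = T 1 (?g v)"
        using G_conj_T[OF c(3) v(2), of 1] gi T_inv[OF w(2), of 1] by simp
      finally show ?thesis using G_fun(3)[OF c(3) v(2)] by (auto simp: X_def gens_def)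
    qed
    \<comment> \<open>By \<open>sim_congruent\<close> the residues of the six coordinates modulo
      \<open>N * N\<close> index all generators of the quotient.\<close>
    let ?I = "{0..<N * N}"
    let ?vec = "\<lambda>(a, b, c, d, e, f). of_int a *\<^sub>R e1 + of_int b *\<^sub>R f1 + of_int c *\<^sub>R e2 + of_int d *\<^sub>R f2 + of_int e *\<^sub>R e3 + of_int f *\<^sub>R f3"
    have "X \<subseteq> (\<lambda>t. ?\<pi> (T 1 (?vec t))) ` (?I \<times> ?I \<times> ?I \<times> ?I \<times> ?I \<times> ?I)"
    proof
      fix x assume "x \<in> X"
      then obtain v where v: "x = ?\<pi> (T 1 v)" "v \<in> Lam" by (auto simp: X_def gens_def)
      obtain a b c d e f where "v = of_int a *\<^sub>R e1 + of_int b *\<^sub>R f1 + of_int c *\<^sub>R e2 + of_int d *\<^sub>R f2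
          + of_int e *\<^sub>R e3 + of_int f *\<^sub>R f3"
        using Lam_obtain[OF v(2)] .
      then have abc: "v = ?vec (a, b, c, d, e, f)" by simp
      define M where "M = N * N"
      have M: "M > 0" using N by (simp add: M_def)
      let ?r = "?vec (a mod M, b mod M, c mod M, d mod M, e mod M, f mod M)"
      let ?s = "?vec (a div M, b div M, c div M, d div M, e div M, f div M)"
      have m: "of_int t *\<^sub>R z = of_int (t mod M) *\<^sub>R z + of_int M *\<^sub>R (of_int (t div M) *\<^sub>R z)" for t and z :: 'a
        by (metis (no_types, lifting) mod_mult_div_eq of_int_add of_int_mult scaleR_left.add scaleR_scaleR)
      have "v = ?r + of_int M *\<^sub>R ?s"
        unfolding abc case_prod_conv scaleR_right_distrib
        by (subst m[of a], subst m[of b], subst m[of c], subst m[of d], subst m[of e], subst m[of f]) (simp only: add_ac)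
      moreover have L: "?r \<in> Lam" "?s \<in> Lam" unfolding case_prod_conv by (intro Lam_add Lam_scale Lam_basis; simp)+
      ultimately have "sim N v ?r" using sim_congruent[OF L, of N] by (simp add: M_def)
      then have "T 1 v \<otimes>\<^bsub>G\<^esub> inv\<^bsub>G\<^esub> (T 1 ?r) \<in> K N" using T_inv[OF L(1), of 1] by (simp only: sim_def G_simps(1)) simp
      then have "T 1 v \<in> ?\<pi> (T 1 ?r)"
        using rcos_module_rev[OF G.group_axioms] T_carrier[OF v(2), of 1] T_carrier[OF L(1), of 1] by simp
      then have "x = ?\<pi> (T 1 ?r)"
        using G.repr_independence[OF _ T_carrier[OF L(1), of 1] K_subgroup] v(1) by simp
      then show "x \<in> (\<lambda>t. ?\<pi> (T 1 (?vec t))) ` (?I \<times> ?I \<times> ?I \<times> ?I \<times> ?I \<times> ?I)"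
        using M by (intro image_eqI[of _ _ "(a mod M, b mod M, c mod M, d mod M, e mod M, f mod M)"])
          (simp_all add: M_def[symmetric])
    qed
    then show "finite X" by (rule finite_subset) simp
  qed
  then show ?thesis by (simp add: FactGroup_def)
qed

end

section \<open>Integral matrices acting on real vectors\<close>

lemma group_GLZ: "group (GLZ n)"
  unfolding GLZ_def by (intro monoid.units_group ring.is_monoid ring_mat)

lemma GLZ_simps: "x \<otimes>\<^bsub>GLZ n\<^esub> y = x * y" "\<one>\<^bsub>GLZ n\<^esub> = 1\<^sub>m n"
  by (simp_all add: GLZ_def units_of_def ring_mat_simps)

lemma GLZ_carrier: "M \<in> carrier (GLZ n) \<Longrightarrow> M \<in> carrier_mat n n"
  by (simp add: GLZ_def units_of_def Units_def ring_mat_simps)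

lemma SpZ_simps: "x \<otimes>\<^bsub>SpZ \<Omega>\<^esub> y = x * y" "\<one>\<^bsub>SpZ \<Omega>\<^esub> = 1\<^sub>m (dim_row \<Omega>)"
  by (simp_all add: SpZ_def GLZ_simps)

lemma subgroup_SpZ:
  assumes \<Omega>: "\<Omega> \<in> carrier_mat n n"
  shows "subgroup (carrier (SpZ \<Omega>)) (GLZ n)"
proof -
  interpret group "GLZ n" by (rule group_GLZ)
  have eq: "carrier (SpZ \<Omega>) = {M \<in> carrier (GLZ n). transpose_mat M * \<Omega> * M = \<Omega>}"
    using \<Omega> by (simp add: SpZ_def)
  have comp: "transpose_mat (M * N) * \<Omega> * (M * N) = transpose_mat N * (transpose_mat M * \<Omega> * M) * N"
    if M: "M \<in> carrier_mat n n" and N: "N \<in> carrier_mat n n" for M N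
  proof -
    have c: "transpose_mat M \<in> carrier_mat n n" "transpose_mat N \<in> carrier_mat n n" "\<Omega> * M \<in> carrier_mat n n"
      "transpose_mat M * \<Omega> \<in> carrier_mat n n" using M N \<Omega> by auto
    have "transpose_mat (M * N) * \<Omega> * (M * N) = transpose_mat N * transpose_mat M * \<Omega> * (M * N)"
      by (simp only: transpose_mult[OF M N])
    also have "\<dots> = transpose_mat N * transpose_mat M * \<Omega> * M * N"
      by (rule assoc_mult_mat[symmetric, of _ n n _ n _ n]) (use M N \<Omega> c in auto)
    also have "transpose_mat N * transpose_mat M * \<Omega> = transpose_mat N * (transpose_mat M * \<Omega>)"
      by (rule assoc_mult_mat[OF c(2,1) \<Omega>])
    also have "transpose_mat N * (transpose_mat M * \<Omega>) * M = transpose_mat N * (transpose_mat M * \<Omega> * M)"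
      by (rule assoc_mult_mat[OF c(2,4) M])
    finally show ?thesis .
  qed
  let ?S = "{M \<in> carrier (GLZ n). transpose_mat M * \<Omega> * M = \<Omega>}"
  show ?thesis unfolding eq
  proof
    show "?S \<subseteq> carrier (GLZ n)" by (rule Collect_subset)
    show "\<one>\<^bsub>GLZ n\<^esub> \<in> ?S" using \<Omega> one_closed by (simp add: GLZ_simps)
  next
    fix M assume "M \<in> ?S"
    then have M: "M \<in> carrier (GLZ n)" "transpose_mat M * \<Omega> * M = \<Omega>" by blast+
    define N where "N = inv\<^bsub>GLZ n\<^esub> M"
    have N: "N \<in> carrier (GLZ n)" unfolding N_def using M(1) by (rule inv_closed)
    have MN: "M * N = 1\<^sub>m n" using r_inv[OF M(1)] by (simp only: N_def GLZ_simps)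
    have "transpose_mat N * (transpose_mat M * \<Omega> * M) * N = transpose_mat (M * N) * \<Omega> * (M * N)"
      by (rule comp[OF GLZ_carrier[OF M(1)] GLZ_carrier[OF N], symmetric])
    also have "\<dots> = \<Omega>" using \<Omega> by (simp add: MN)
    finally have "transpose_mat N * \<Omega> * N = \<Omega>" by (simp only: M(2))
    then show "inv\<^bsub>GLZ n\<^esub> M \<in> ?S" using N by (simp only: N_def mem_Collect_eq simp_thms)
  next
    fix M N assume "M \<in> ?S" "N \<in> ?S"
    then have M: "M \<in> carrier (GLZ n)" "transpose_mat M * \<Omega> * M = \<Omega>"
      and N: "N \<in> carrier (GLZ n)" "transpose_mat N * \<Omega> * N = \<Omega>" by blast+
    have "transpose_mat (M * N) * \<Omega> * (M * N) = \<Omega>"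
      by (simp only: comp[OF GLZ_carrier[OF M(1)] GLZ_carrier[OF N(1)]] M(2) N(2))
    moreover have "M * N \<in> carrier (GLZ n)" using m_closed[OF M(1) N(1)] by (simp only: GLZ_simps)
    ultimately show "M \<otimes>\<^bsub>GLZ n\<^esub> N \<in> ?S" by (simp only: GLZ_simps mem_Collect_eq simp_thms)
  qed
qed

lemma SpZ_eq: "\<Omega> \<in> carrier_mat n n \<Longrightarrow> SpZ \<Omega> = (GLZ n)\<lparr>carrier := carrier (SpZ \<Omega>)\<rparr>"
  by (simp add: SpZ_def)

lemma group_SpZ: "\<Omega> \<in> carrier_mat n n \<Longrightarrow> group (SpZ \<Omega>)"
  by (subst SpZ_eq) (assumption, rule group.subgroup_imp_group[OF group_GLZ subgroup_SpZ])

text \<open>Hypergeometric groups are generated inside \<open>GLZ n\<close>, but their index is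
  taken in \<open>SpZ \<Omega>\<close>.\<close>

lemma subgroup_generate_SpZ:
  assumes "\<Omega> \<in> carrier_mat n n" "X \<subseteq> carrier (SpZ \<Omega>)"
  shows "subgroup (generate (GLZ n) X) (SpZ \<Omega>)"
proof -
  interpret group "GLZ n" by (rule group_GLZ)
  have X: "X \<subseteq> carrier (GLZ n)" using assms subgroup.subset[OF subgroup_SpZ[OF assms(1)]] by blast
  show ?thesis
    by (subst SpZ_eq[OF assms(1)])
      (intro subgroup_incl generate_is_subgroup X subgroup_SpZ assms generate_subgroup_incl)
qed

lemma SpZ_carrier: "\<Omega> \<in> carrier_mat n n \<Longrightarrow> M \<in> carrier (SpZ \<Omega>) \<Longrightarrow> M \<in> carrier_mat n n"
  using subgroup.subset[OF subgroup_SpZ] GLZ_carrier by blast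

text \<open>Here \<open>\<phi>\<close> is any finite-valued invariant that separates cosets. In the
  application it combines a residue class with a coset in another group, so it is not asked to be a
  homomorphism.\<close>

lemma finite_rcosets_if:
  assumes "group G" "subgroup H G" "finite (\<phi> ` carrier G)"
    and "\<And>x y. x \<in> carrier G \<Longrightarrow> y \<in> carrier G \<Longrightarrow> \<phi> x = \<phi> y \<Longrightarrow> x \<otimes>\<^bsub>G\<^esub> inv\<^bsub>G\<^esub> y \<in> H"
  shows "finite (rcosets\<^bsub>G\<^esub> H)"
proof -
  interpret group G by fact
  have "H #>\<^bsub>G\<^esub> x = H #>\<^bsub>G\<^esub> inv_into (carrier G) \<phi> (\<phi> x)" if x: "x \<in> carrier G" for x
  proof -
    let ?y = "inv_into (carrier G) \<phi> (\<phi> x)"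
    have y: "?y \<in> carrier G" "\<phi> ?y = \<phi> x" using x by (auto intro: inv_into_into f_inv_into_f)
    then have "x \<in> H #>\<^bsub>G\<^esub> ?y"
      using subgroup.rcos_module_rev[OF assms(2,1) y(1) x] assms(4)[OF x y(1)] by simp
    then show ?thesis using repr_independence[OF _ y(1) assms(2)] by simp
  qed
  then have "rcosets\<^bsub>G\<^esub> H \<subseteq> (\<lambda>p. H #>\<^bsub>G\<^esub> inv_into (carrier G) \<phi> p) ` \<phi> ` carrier G"
    by (auto simp: RCOSETS_def)
  then show ?thesis using assms(3) finite_surj by blast
qed

section \<open>The action of matrices on real six-tuples\<close>

text \<open>Tuples carry a real vector space structure, as the abstract spaces above require, and
  explicit vectors can be computed by rewriting.\<close>

type_synonym vec6 = "real \<times> real \<times> real \<times> real \<times> real \<times> real"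

definition coord :: "vec6 \<Rightarrow> nat \<Rightarrow> real" where
  "coord = (\<lambda>(a, b, c, d, e, f) i. if i = 0 then a else if i = 1 then b else if i = 2 then c
     else if i = 3 then d else if i = 4 then e else if i = 5 then f else 0)"

definition of_coords :: "(nat \<Rightarrow> real) \<Rightarrow> vec6" where
  "of_coords h = (h 0, h 1, h 2, h 3, h 4, h 5)"

lemma coord_of_coords [simp]: "i < 6 \<Longrightarrow> coord (of_coords h) i = h i"
  by (auto simp: less_6 coord_def of_coords_def)

lemma coord_add [simp]: "coord (x + y) i = coord x i + coord y i"
  by (cases x; cases y) (simp add: coord_def)

lemma coord_scale [simp]: "coord (r *\<^sub>R x) i = r * coord x i"
  by (cases x) (simp add: coord_def)

lemma coord_diff [simp]: "coord (x - y) i = coord x i - coord y i"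
  by (cases x; cases y) (simp add: coord_def)

lemma coord_zero [simp]: "coord 0 i = 0"
  by (simp add: coord_def zero_prod_def)

lemma coord_eqI: "(\<And>i. i < 6 \<Longrightarrow> coord x i = coord y i) \<Longrightarrow> x = y"
proof -
  assume a: "\<And>i. i < 6 \<Longrightarrow> coord x i = coord y i"
  show ?thesis
    using a[of 0] a[of 1] a[of 2] a[of 3] a[of 4] a[of 5] by (cases x; cases y) (simp add: coord_def)
qed

definition act :: "int mat \<Rightarrow> vec6 \<Rightarrow> vec6" where
  "act M x = of_coords (\<lambda>i. \<Sum>j<6. of_int (M $$ (i, j)) * coord x j)"

definition form :: "int mat \<Rightarrow> real \<Rightarrow> vec6 \<Rightarrow> vec6 \<Rightarrow> real" where
  "form \<Omega> k x y = (\<Sum>i<6. \<Sum>j<6. coord x i * of_int (\<Omega> $$ (i, j)) * coord y j) / k"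

lemma index_mult_sum:
  fixes M N :: "int mat"
  shows "M \<in> carrier_mat n n \<Longrightarrow> N \<in> carrier_mat n n \<Longrightarrow> i < n \<Longrightarrow> j < n \<Longrightarrow>
    (M * N) $$ (i, j) = (\<Sum>k<n. M $$ (i, k) * N $$ (k, j))"
  by (simp add: scalar_prod_def atLeast0LessThan)

lemma act_mult:
  assumes "M \<in> carrier_mat 6 6" "N \<in> carrier_mat 6 6"
  shows "act (M * N) = act M \<circ> act N"
proof
  fix x
  show "act (M * N) x = (act M \<circ> act N) x"
  proof (rule coord_eqI)
    fix i :: nat assume i: "i < 6"
    have "coord (act (M * N) x) i = (\<Sum>j<6. of_int (\<Sum>k<6. M $$ (i, k) * N $$ (k, j)) * coord x j)"
      using i assms unfolding act_def by (simp add: index_mult_sum[of M 6 N] del: index_mult_mat)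
    also have "\<dots> = (\<Sum>j<6. \<Sum>k<6. of_int (M $$ (i, k)) * (of_int (N $$ (k, j)) * coord x j))"
      by (simp add: sum_distrib_right mult.assoc)
    also have "\<dots> = (\<Sum>k<6. \<Sum>j<6. of_int (M $$ (i, k)) * (of_int (N $$ (k, j)) * coord x j))"
      by (rule sum.swap)
    also have "\<dots> = coord ((act M \<circ> act N) x) i"
      using i by (simp add: act_def sum_distrib_left)
    finally show "coord (act (M * N) x) i = coord ((act M \<circ> act N) x) i" .
  qed
qed

lemma act_one: "act (1\<^sub>m 6) = id"
proof
  fix x
  show "act (1\<^sub>m 6) x = id x"
  proof (rule coord_eqI)
    fix i :: nat assume i: "i < 6"
    have "(\<Sum>j<6. of_int (1\<^sub>m 6 $$ (i, j)) * coord x j) = (\<Sum>j<6. if j = i then coord x j else 0)"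
      using i by (intro sum.cong) auto
    then show "coord (act (1\<^sub>m 6) x) i = coord (id x) i" using i by (simp add: act_def)
  qed
qed

lemma act_linear: "linear (act M)"
  by (rule linearI; rule coord_eqI) (simp_all add: act_def algebra_simps sum.distrib sum_distrib_left)

lemma act_inj:
  assumes "M \<in> carrier_mat 6 6" "N \<in> carrier_mat 6 6" "act M = act N"
  shows "M = N"
proof (rule eq_matI)
  fix i j assume "i < dim_row N" "j < dim_col N"
  then have ij: "i < 6" "j < 6" using assms(2) by auto
  let ?u = "of_coords (\<lambda>k. if k = j then 1 else 0)"
  have "coord (act A ?u) i = of_int (A $$ (i, j))" for A
  proof -
    have "coord (act A ?u) i = (\<Sum>k<6. of_int (A $$ (i, k)) * (if k = j then 1 else 0))" using ij by (simp add: act_def)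
    also have "\<dots> = (\<Sum>k<6. if k = j then of_int (A $$ (i, j)) else 0)" by (intro sum.cong) auto
    finally show ?thesis using ij by simp
  qed
  from this[of M] this[of N] show "M $$ (i, j) = N $$ (i, j)" using assms(3) by simp
qed (use assms in auto)

lemma symplectic_space_form:
  assumes "\<Omega> \<in> carrier_mat 6 6" "transpose_mat \<Omega> = - \<Omega>"
  shows "symplectic_space (form \<Omega> k)"
proof -
  have sk: "\<Omega> $$ (i, j) = - \<Omega> $$ (j, i)" if "i < 6" "j < 6" for i j
  proof -
    have "transpose_mat \<Omega> $$ (i, j) = (- \<Omega>) $$ (i, j)" using assms by simp
    then have "\<Omega> $$ (j, i) = - \<Omega> $$ (i, j)" using that assms(1) by simp
    then show ?thesis by simp
  qed
  have skew: "form \<Omega> k x y = - form \<Omega> k y x" for x y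
  proof -
    have "(\<Sum>i<6. \<Sum>j<6. coord x i * of_int (\<Omega> $$ (i, j)) * coord y j) = (\<Sum>j<6. \<Sum>i<6. coord x i * of_int (\<Omega> $$ (i, j)) * coord y j)"
      by (rule sum.swap)
    also have "\<dots> = (\<Sum>j<6. \<Sum>i<6. - (coord y j * of_int (\<Omega> $$ (j, i)) * coord x i))"
    proof (intro sum.cong refl)
      fix i j :: nat assume "i \<in> {..<6}" "j \<in> {..<6}"
      then have "\<Omega> $$ (j, i) = - \<Omega> $$ (i, j)" using sk by blast
      then show "coord x j * of_int (\<Omega> $$ (j, i)) * coord y i = - (coord y i * of_int (\<Omega> $$ (i, j)) * coord x j)" by simp
    qed
    also have "\<dots> = - (\<Sum>j<6. \<Sum>i<6. coord y j * of_int (\<Omega> $$ (j, i)) * coord x i)"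
      by (simp add: sum_negf)
    finally show ?thesis by (simp add: form_def)
  qed
  show ?thesis
  proof
    show "form \<Omega> k x x = 0" for x using skew[of x x] by simp
    show "form \<Omega> k (x + y) z = form \<Omega> k x z + form \<Omega> k y z" for x y z
      by (simp add: form_def algebra_simps sum.distrib add_divide_distrib)
    show "form \<Omega> k (c *\<^sub>R x) z = c * form \<Omega> k x z" for c x z
      by (simp add: form_def sum_distrib_left mult.assoc)
  qed (rule skew)
qed

lemma act_form:
  assumes \<Omega>: "\<Omega> \<in> carrier_mat 6 6" and M: "M \<in> carrier (SpZ \<Omega>)"
  shows "form \<Omega> k (act M x) (act M y) = form \<Omega> k x y"
proof -
  have Mc: "M \<in> carrier_mat 6 6" using SpZ_carrier[OF \<Omega> M] .
  have MO: "transpose_mat M * (\<Omega> * M) = \<Omega>"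
    using M assoc_mult_mat[of "transpose_mat M" 6 6 \<Omega> 6 M 6] \<Omega> Mc by (simp add: SpZ_def)
  have ent: "(\<Sum>i<6. \<Sum>j<6. M $$ (i, k) * \<Omega> $$ (i, j) * M $$ (j, l)) = \<Omega> $$ (k, l)" if "k < 6" "l < 6" for k l
  proof -
    have "\<Omega> $$ (k, l) = (\<Sum>i<6. transpose_mat M $$ (k, i) * (\<Omega> * M) $$ (i, l))"
      using MO index_mult_sum[of "transpose_mat M" 6 "\<Omega> * M" k l] that \<Omega> Mc by simp
    also have "\<dots> = (\<Sum>i<6. M $$ (i, k) * (\<Sum>j<6. \<Omega> $$ (i, j) * M $$ (j, l)))"
      using that \<Omega> Mc by (intro sum.cong refl) (simp add: index_mult_sum[of \<Omega> 6 M] del: index_mult_mat)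
    finally show ?thesis by (simp add: sum_distrib_left mult.assoc)
  qed
  let ?m = "\<lambda>i j. of_int (M $$ (i, j)) :: real" and ?o = "\<lambda>i j. of_int (\<Omega> $$ (i, j)) :: real"
  have ent': "(\<Sum>i<6. \<Sum>j<6. ?m i k * ?o i j * ?m j l) = ?o k l" if "k < 6" "l < 6" for k l
    using arg_cong[OF ent[OF that], of real_of_int] by simp
  have "(\<Sum>i<6. \<Sum>j<6. coord (act M x) i * ?o i j * coord (act M y) j)
      = (\<Sum>i<6. \<Sum>j<6. \<Sum>k<6. \<Sum>l<6. coord x k * coord y l * (?m i k * ?o i j * ?m j l))"
  proof (intro sum.cong refl)
    fix i j :: nat assume "i \<in> {..<6}" "j \<in> {..<6}"
    then have "coord (act M x) i * ?o i j * coord (act M y) j = (\<Sum>k<6. ?m i k * coord x k) * ?o i j * (\<Sum>l<6. ?m j l * coord y l)"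
      by (simp add: act_def)
    also have "\<dots> = (\<Sum>k<6. \<Sum>l<6. ?m i k * coord x k * ?o i j * (?m j l * coord y l))"
      by (simp only: sum_distrib_right[of _ _ "?o i j"] sum_product)
    also have "\<dots> = (\<Sum>k<6. \<Sum>l<6. coord x k * coord y l * (?m i k * ?o i j * ?m j l))"
      by (simp only: mult_ac)
    finally show "coord (act M x) i * ?o i j * coord (act M y) j = (\<Sum>k<6. \<Sum>l<6. coord x k * coord y l * (?m i k * ?o i j * ?m j l))" .
  qed
  also have "\<dots> = (\<Sum>i<6. \<Sum>k<6. \<Sum>j<6. \<Sum>l<6. coord x k * coord y l * (?m i k * ?o i j * ?m j l))"
    by (intro sum.cong refl sum.swap)
  also have "\<dots> = (\<Sum>k<6. \<Sum>i<6. \<Sum>j<6. \<Sum>l<6. coord x k * coord y l * (?m i k * ?o i j * ?m j l))"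
    by (rule sum.swap)
  also have "\<dots> = (\<Sum>k<6. \<Sum>i<6. \<Sum>l<6. \<Sum>j<6. coord x k * coord y l * (?m i k * ?o i j * ?m j l))"
    by (intro sum.cong refl sum.swap)
  also have "\<dots> = (\<Sum>k<6. \<Sum>l<6. \<Sum>i<6. \<Sum>j<6. coord x k * coord y l * (?m i k * ?o i j * ?m j l))"
    by (intro sum.cong refl sum.swap)
  also have "\<dots> = (\<Sum>k<6. \<Sum>l<6. coord x k * ?o k l * coord y l)"
  proof (intro sum.cong refl)
    fix k l :: nat assume "k \<in> {..<6}" "l \<in> {..<6}"
    then have "(\<Sum>i<6. \<Sum>j<6. coord x k * coord y l * (?m i k * ?o i j * ?m j l)) = coord x k * coord y l * ?o k l"
      unfolding sum_distrib_left[symmetric] using ent' by simp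
    then show "(\<Sum>i<6. \<Sum>j<6. coord x k * coord y l * (?m i k * ?o i j * ?m j l)) = coord x k * ?o k l * coord y l"
      by (simp only: mult_ac)
  qed
  finally show ?thesis by (simp add: form_def)
qed

lemma act_isometry:
  assumes \<Omega>: "\<Omega> \<in> carrier_mat 6 6" "transpose_mat \<Omega> = - \<Omega>" and M: "M \<in> carrier (SpZ \<Omega>)"
  shows "symplectic_space.isometry (form \<Omega> k) (act M)" "inv_into UNIV (act M) = act (inv\<^bsub>SpZ \<Omega>\<^esub> M)"
proof -
  interpret S: group "SpZ \<Omega>" by (rule group_SpZ[OF \<Omega>(1)])
  let ?N = "inv\<^bsub>SpZ \<Omega>\<^esub> M"
  have dim: "dim_row \<Omega> = 6" using \<Omega>(1) by auto
  have N: "?N \<in> carrier (SpZ \<Omega>)" using M by (rule S.inv_closed)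
  have "M * ?N = 1\<^sub>m 6" "?N * M = 1\<^sub>m 6" using S.r_inv[OF M] S.l_inv[OF M] by (simp_all only: SpZ_simps dim)
  then have id: "act M \<circ> act ?N = id" "act ?N \<circ> act M = id"
    using act_mult[OF SpZ_carrier[OF \<Omega>(1) M] SpZ_carrier[OF \<Omega>(1) N]]
      act_mult[OF SpZ_carrier[OF \<Omega>(1) N] SpZ_carrier[OF \<Omega>(1) M]] act_one by simp_all
  show "inv_into UNIV (act M) = act ?N" by (rule inv_unique_comp[OF id])
  show "symplectic_space.isometry (form \<Omega> k) (act M)"
    unfolding symplectic_space.isometry_def[OF symplectic_space_form[OF \<Omega>]]
    using act_linear o_bij[OF id(2,1)] act_form[OF \<Omega>(1) M] by blast
qed

lemma isom_group_act:
  assumes \<Omega>: "\<Omega> \<in> carrier_mat 6 6" "transpose_mat \<Omega> = - \<Omega>" and \<Gamma>: "subgroup \<Gamma> (SpZ \<Omega>)"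
  shows "symplectic_space.isom_group (form \<Omega> k) (act ` \<Gamma>)"
  unfolding symplectic_space.isom_group_def[OF symplectic_space_form[OF \<Omega>]]
proof (intro conjI ballI)
  have c: "M \<in> carrier (SpZ \<Omega>)" if "M \<in> \<Gamma>" for M using subgroup.mem_carrier[OF \<Gamma> that] .
  have "1\<^sub>m 6 \<in> \<Gamma>" using subgroup.one_closed[OF \<Gamma>] \<Omega>(1) by (simp add: SpZ_simps)
  then show "id \<in> act ` \<Gamma>" using act_one by (metis image_eqI)
  show "f \<circ> g \<in> act ` \<Gamma>" if fg: "f \<in> act ` \<Gamma>" "g \<in> act ` \<Gamma>" for f g
  proof -
    obtain M N where MN: "f = act M" "M \<in> \<Gamma>" "g = act N" "N \<in> \<Gamma>" using fg by blast
    have "M * N \<in> \<Gamma>" using subgroup.m_closed[OF \<Gamma> MN(2,4)] by (simp only: SpZ_simps)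
    then show ?thesis using act_mult[OF SpZ_carrier[OF \<Omega>(1) c[OF MN(2)]] SpZ_carrier[OF \<Omega>(1) c[OF MN(4)]]] MN(1,3)
      by (metis image_eqI)
  qed
  show "symplectic_space.isometry (form \<Omega> k) g" "inv_into UNIV g \<in> act ` \<Gamma>" if "g \<in> act ` \<Gamma>" for g
    using that act_isometry[OF \<Omega> c] subgroup.m_inv_closed[OF \<Gamma>] by auto
qed

section \<open>Integral vectors, residues and the criterion for finite index\<close>

definition integral :: "vec6 \<Rightarrow> bool" where
  "integral x \<longleftrightarrow> (\<forall>i<6. coord x i \<in> \<int>)"

lemma act_integral: "integral x \<Longrightarrow> integral (act M x)"
  by (auto simp: integral_def act_def intro!: Ints_sum Ints_mult)

lemma zspan_integral: "x \<in> zspan Y \<Longrightarrow> (\<And>y. y \<in> Y \<Longrightarrow> integral y) \<Longrightarrow> integral x"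
  by (induction rule: zspan.induct) (auto simp: integral_def)

text \<open>For an integral basis this places \<open>c Z^6\<close> inside \<open>Lam\<close>, which
  is what ties residues of matrices modulo \<open>c\<close> to the lattice.\<close>

lemma form_integral:
  assumes "\<And>i. i < 6 \<Longrightarrow> coord z i / of_int c \<in> \<int>" "integral e"
  shows "form \<Omega> (of_int c) z e \<in> \<int>"
proof -
  have "form \<Omega> (of_int c) z e = (\<Sum>i<6. \<Sum>j<6. (coord z i / of_int c) * of_int (\<Omega> $$ (i, j)) * coord e j)"
    by (simp add: form_def sum_divide_distrib)
  also have "\<dots> \<in> \<int>"
    using assms by (intro Ints_sum Ints_mult) (auto simp: integral_def)
  finally show ?thesis .
qed

text \<open>An extensional function, so that equality is congruence of all entries and the values
  form a finite set.\<close>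

definition residue :: "int \<Rightarrow> int mat \<Rightarrow> nat \<times> nat \<Rightarrow> int" where
  "residue c M = (\<lambda>p\<in>{..<6} \<times> {..<6}. M $$ p mod c)"

lemma finite_residues: "c > 0 \<Longrightarrow> finite (residue c ` X)"
  by (rule finite_subset[of _ "PiE ({..<6} \<times> {..<6}) (\<lambda>_. {0..<c})"])
    (auto simp: residue_def intro!: finite_PiE split: if_splits)

text \<open>The image of \<open>\<Gamma>\<close> contains some \<open>L.K (N * c)\<close>. A matrix
  \<open>M\<close> is recorded by its residue class modulo \<open>c\<close> and by the coset of
  \<open>M\<close> times the inverse of a representative of that class, a product that preserves
  \<open>Lam\<close>. Both data range over finite sets, and together they determine the coset of
  \<open>\<Gamma>\<close>.\<close>

theorem finite_index_criterion:
  fixes \<Omega> :: "int mat" and \<kappa> c :: int and v e1 e2 e3 f1 f2 f3 :: vec6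
  defines "\<omega> \<equiv> form \<Omega> (of_int \<kappa>)"
  assumes \<Omega>: "\<Omega> \<in> carrier_mat 6 6" "transpose_mat \<Omega> = - \<Omega>"
    and \<Gamma>: "subgroup \<Gamma> (SpZ \<Omega>)" and pos: "\<kappa> > 0" "c > 0"
    and v: "symplectic_space.T \<omega> 1 v \<in> act ` \<Gamma>" "integral v" "\<And>x. integral x \<Longrightarrow> \<omega> x v \<in> \<int>"
    and g: "g \<in> act ` \<Gamma>" "\<omega> v (g v) = 1 \<or> \<omega> v (g v) = -1"
    and Y: "finite Y" "\<And>y. y \<in> Y \<Longrightarrow> \<exists>h\<in>act ` \<Gamma>. y = h v" "\<And>y. y \<in> Y \<Longrightarrow> \<omega> y v \<noteq> 0 \<or> \<omega> y (g v) \<noteq> 0"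
    and L: "symplectic_lattice (form \<Omega> (of_int c)) e1 e2 e3 f1 f2 f3"
    and eY: "{e1, e2, e3, f1, f2, f3} \<subseteq> zspan Y"
  shows "finite_index_subgroup \<Gamma> (SpZ \<Omega>)"
proof -
  interpret \<omega>: symplectic_space \<omega> unfolding \<omega>_def by (rule symplectic_space_form[OF \<Omega>])
  interpret L: symplectic_lattice "form \<Omega> (of_int c)" e1 e2 e3 f1 f2 f3 by (rule L)
  interpret S: group "SpZ \<Omega>" by (rule group_SpZ[OF \<Omega>(1)])
  have H: "\<omega>.isom_group (act ` \<Gamma>)" unfolding \<omega>_def by (rule isom_group_act[OF \<Omega> \<Gamma>])
  note S_mat = SpZ_carrier[OF \<Omega>(1)]
  have dim: "dim_row \<Omega> = 6" using \<Omega>(1) by auto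
  have \<Gamma>c: "M \<in> carrier (SpZ \<Omega>)" if "M \<in> \<Gamma>" for M using subgroup.mem_carrier[OF \<Gamma> that] .
  have orb: "\<omega> x (h v) \<in> \<int>" "integral (h v)" "\<omega>.T 1 (h v) \<in> act ` \<Gamma>" if hx: "h \<in> act ` \<Gamma>" "integral x" for h x
  proof -
    obtain M where M: "h = act M" "M \<in> \<Gamma>" using hx(1) by blast
    let ?N = "inv\<^bsub>SpZ \<Omega>\<^esub> M"
    have "\<omega> x (h v) = \<omega> (act ?N x) (act ?N (act M v))"
      unfolding \<omega>_def M(1) using act_form[OF \<Omega>(1) S.inv_closed[OF \<Gamma>c[OF M(2)]]] by simp
    also have "act ?N (act M v) = v"
      using act_isometry(1)[OF \<Omega> \<Gamma>c[OF M(2)], of 1] act_isometry(2)[OF \<Omega> \<Gamma>c[OF M(2)]]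
      by (metis bij_is_inj inv_f_f symplectic_space.isometry_def[OF symplectic_space_form[OF \<Omega>]])
    finally show "\<omega> x (h v) \<in> \<int>" using v(3)[OF act_integral[OF hx(2)]] by simp
    show "integral (h v)" unfolding M(1) by (rule act_integral[OF v(2)])
    show "\<omega>.T 1 (h v) \<in> act ` \<Gamma>" by (rule \<omega>.H_T_image[OF H v(1) hx(1)])
  qed
  have id: "id \<in> act ` \<Gamma>" using \<omega>.H_id[OF H] .
  have Yint: "integral y" if "y \<in> Y" for y using Y(2)[OF that] orb(2)[OF _ v(2)] by auto
  \<comment> \<open>A pairing of -1 becomes 1 when the two vectors are exchanged.\<close>
  obtain w1 w2 where w: "\<omega> w1 w2 = 1" "{w1, w2} = {v, g v}"
  proof (cases "\<omega> v (g v) = 1")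
    case True
    then show ?thesis using that[of v "g v"] by blast
  next
    case False
    then have "\<omega> (g v) v = 1" using g(2) \<omega>.skew[of "g v" v] by simp
    then show ?thesis using that[of "g v" v] by blast
  qed
  have w12: "\<exists>h\<in>act ` \<Gamma>. w1 = h v" "\<exists>h\<in>act ` \<Gamma>. w2 = h v"
  proof -
    have "\<exists>h\<in>act ` \<Gamma>. v = h v" using id by (intro bexI[of _ id]) simp_all
    moreover have "\<exists>h\<in>act ` \<Gamma>. g v = h v" using g(1) by blast
    ultimately show "\<exists>h\<in>act ` \<Gamma>. w1 = h v" "\<exists>h\<in>act ` \<Gamma>. w2 = h v"
      using w(2) unfolding doubleton_eq_iff by metis+
  qed
  obtain N :: int where N: "N > 0" "\<And>x. x \<in> zspan Y \<Longrightarrow> \<omega>.T (of_int N) x \<in> act ` \<Gamma>"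
  proof -
    have "\<exists>N::int. N > 0 \<and> (\<forall>x\<in>zspan Y. \<omega>.T (of_int N) x \<in> act ` \<Gamma>)"
    proof (rule \<omega>.transvections_in_group[OF H w(1)])
      show "\<omega>.T 1 w1 \<in> act ` \<Gamma>" "\<omega>.T 1 w2 \<in> act ` \<Gamma>" using w12 orb(3)[OF _ v(2)] by auto
      show "finite Y" by (rule Y(1))
      fix y assume y: "y \<in> Y"
      show "\<omega>.T 1 y \<in> act ` \<Gamma>" using Y(2)[OF y] orb(3)[OF _ v(2)] by auto
      show "\<omega> y w1 \<in> \<int>" "\<omega> y w2 \<in> \<int>" using w12 orb(1)[OF _ Yint[OF y]] by auto
      show "\<omega> y w1 \<noteq> 0 \<or> \<omega> y w2 \<noteq> 0" using Y(3)[OF y] w(2) by (auto simp: doubleton_eq_iff)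
      show "\<omega> y y' \<in> \<int>" if "y' \<in> Y" for y' using Y(2)[OF that] orb(1)[OF _ Yint[OF y]] by auto
    qed
    then show ?thesis using that by blast
  qed
  have eint: "integral e1" "integral e2" "integral e3" "integral f1" "integral f2" "integral f3"
    by (rule zspan_integral[OF _ Yint]; use eY in simp)+
  have Lam_Y: "x \<in> zspan Y" if x: "x \<in> L.Lam" for x
  proof -
    obtain a1 b1 a2 b2 a3 b3 :: int where "x = of_int a1 *\<^sub>R e1 + of_int b1 *\<^sub>R f1 + of_int a2 *\<^sub>R e2
        + of_int b2 *\<^sub>R f2 + of_int a3 *\<^sub>R e3 + of_int b3 *\<^sub>R f3"
      using L.Lam_obtain[OF x] .
    moreover have "\<dots> \<in> zspan Y" using eY by (intro zspan_add zspan_scale) auto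
    ultimately show ?thesis by simp
  qed
  have T_in: "L.T (of_int (N * c)) x \<in> act ` \<Gamma>" "L.T (- of_int (N * c)) x \<in> act ` \<Gamma>" if "x \<in> L.Lam" for x
  proof -
    \<comment> \<open>Dividing the form by a number is offset by multiplying the parameter by it. So
      the power \<open>N * c\<close> at scale \<open>1/c\<close> is the power
      \<open>N * \<kappa>\<close> at scale \<open>1/\<kappa>\<close>, a multiple of
      \<open>N\<close>.\<close>
    have eq: "L.T (q * of_int c) x = \<omega>.T (q * of_int \<kappa>) x" for q
    proof
      fix z
      have "of_int c * form \<Omega> (of_int c) z x = of_int \<kappa> * \<omega> z x" using pos by (simp add: form_def \<omega>_def)
      then show "L.T (q * of_int c) x z = \<omega>.T (q * of_int \<kappa>) x z"
        by (simp only: L.T_def \<omega>.T_def mult.assoc)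
    qed
    have "\<omega>.T (of_int \<kappa> * of_int N) x \<in> act ` \<Gamma>" "\<omega>.T (of_int (- \<kappa>) * of_int N) x \<in> act ` \<Gamma>"
      by (rule \<omega>.H_T_int[OF H N(2)[OF Lam_Y[OF that]]])+
    then show "L.T (of_int (N * c)) x \<in> act ` \<Gamma>" "L.T (- of_int (N * c)) x \<in> act ` \<Gamma>"
      using eq[of "of_int N"] eq[of "- of_int N"] by (simp_all add: mult.commute)
  qed
  have KH: "k \<in> act ` \<Gamma>" if "k \<in> L.K (N * c)" for k
    using that unfolding L.K_def
  proof (induction rule: generate.induct)
    case one
    then show ?case using id by (simp only: L.G_simps)
  next
    case (incl h)
    then show ?case using T_in(1) by (auto simp: L.gens_def)
  next
    case (inv h)
    then obtain x where "h = L.T (of_int (N * c)) x" "x \<in> L.Lam" by (auto simp: L.gens_def)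
    then show ?case using T_in(2) L.T_inv[of x "of_int (N * c)"] by simp
  next
    case (eng h1 h2)
    then show ?case using \<omega>.H_comp[OF H] by (simp only: L.G_simps)
  qed
  have cong: "act (M * inv\<^bsub>SpZ \<Omega>\<^esub> M') x \<in> L.Lam"
    if M: "M \<in> carrier (SpZ \<Omega>)" "M' \<in> carrier (SpZ \<Omega>)" "residue c M = residue c M'" and x: "x \<in> L.Lam" for M M' x
  proof -
    let ?N = "inv\<^bsub>SpZ \<Omega>\<^esub> M'"
    define u where "u = act ?N x"
    have Nc: "?N \<in> carrier_mat 6 6" using S_mat[OF S.inv_closed[OF M(2)]] .
    have u: "integral u" unfolding u_def using act_integral zspan_integral[OF Lam_Y[OF x] Yint] by blast
    have "M' * ?N = 1\<^sub>m 6" using S.r_inv[OF M(2)] by (simp only: SpZ_simps dim)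
    then have "act M' u = x" using fun_cong[OF act_mult[OF S_mat[OF M(2)] Nc], of x] by (simp add: u_def act_one)
    moreover have "act (M * ?N) x = act M u" using fun_cong[OF act_mult[OF S_mat[OF M(1)] Nc], of x] by (simp add: u_def)
    \<comment> \<open>The vector \<open>u\<close> is integral, so the displacement
      \<open>(M - M') u\<close> lies in \<open>c Z^6\<close> and therefore in
      \<open>Lam\<close>.\<close>
    ultimately have split: "act (M * ?N) x = x + (act M u - act M' u)" by simp
    have "coord (act M u - act M' u) i / of_int c \<in> \<int>" if i: "i < 6" for i
    proof -
      have "coord (act M u - act M' u) i / of_int c = (\<Sum>j<6. of_int (M $$ (i, j) - M' $$ (i, j)) / of_int c * coord u j)"
        using i by (simp add: act_def sum_subtractf[symmetric] sum_divide_distrib algebra_simps diff_divide_distrib)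
      also have "\<dots> \<in> \<int>"
      proof (intro Ints_sum Ints_mult)
        fix j :: nat assume j: "j \<in> {..<6}"
        show "coord u j \<in> \<int>" using u j by (simp add: integral_def)
        have "M $$ (i, j) mod c = M' $$ (i, j) mod c"
          using fun_cong[OF M(3), of "(i, j)"] i j by (simp add: residue_def)
        then obtain q where "M $$ (i, j) - M' $$ (i, j) = c * q" by (metis mod_eq_dvd_iff dvdE)
        then show "of_int (M $$ (i, j) - M' $$ (i, j)) / of_int c \<in> (\<int> :: real set)" using pos by simp
      qed
      finally show ?thesis .
    qed
    then have "act M u - act M' u \<in> L.Lam"
      unfolding L.Lam_def using form_integral eint by blast
    then show ?thesis unfolding split by (rule L.Lam_add[OF x])
  qed
  have cong_G: "act (M * inv\<^bsub>SpZ \<Omega>\<^esub> M') \<in> carrier L.G"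
    if M: "M \<in> carrier (SpZ \<Omega>)" "M' \<in> carrier (SpZ \<Omega>)" "residue c M = residue c M'" for M M'
  proof -
    have P: "M * inv\<^bsub>SpZ \<Omega>\<^esub> M' \<in> carrier (SpZ \<Omega>)" "M' * inv\<^bsub>SpZ \<Omega>\<^esub> M \<in> carrier (SpZ \<Omega>)"
      using S.m_closed[OF M(1) S.inv_closed[OF M(2)]] S.m_closed[OF M(2) S.inv_closed[OF M(1)]]
      by (simp_all only: SpZ_simps)
    have "inv\<^bsub>SpZ \<Omega>\<^esub> (M * inv\<^bsub>SpZ \<Omega>\<^esub> M') = M' * inv\<^bsub>SpZ \<Omega>\<^esub> M"
      using S.inv_mult_group[OF M(1) S.inv_closed[OF M(2)]] S.inv_inv[OF M(2)] by (simp only: SpZ_simps)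
    then have inv: "inv_into UNIV (act (M * inv\<^bsub>SpZ \<Omega>\<^esub> M')) = act (M' * inv\<^bsub>SpZ \<Omega>\<^esub> M)"
      using act_isometry(2)[OF \<Omega> P(1)] by simp
    note iso = act_isometry(1)[OF \<Omega> P(1), of "of_int c"]
    have surj: "act (M * inv\<^bsub>SpZ \<Omega>\<^esub> M') (act (M' * inv\<^bsub>SpZ \<Omega>\<^esub> M) x) = x" for x
      using iso inv by (metis L.isometry_def bij_is_surj surj_f_inv_f)
    have "act (M * inv\<^bsub>SpZ \<Omega>\<^esub> M') ` L.Lam = L.Lam"
    proof
      show "act (M * inv\<^bsub>SpZ \<Omega>\<^esub> M') ` L.Lam \<subseteq> L.Lam" using cong[OF M] by blast
      \<comment> \<open>Exchanging the two matrices gives the inverse map, which also sends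
        \<open>Lam\<close> into itself.\<close>
      show "L.Lam \<subseteq> act (M * inv\<^bsub>SpZ \<Omega>\<^esub> M') ` L.Lam"
        using cong[OF M(2,1) M(3)[symmetric]] surj by (metis image_eqI subsetI)
    qed
    then show ?thesis using iso by (simp add: L.G_simps)
  qed
  define rep where "rep M = inv_into (carrier (SpZ \<Omega>)) (residue c) (residue c M)" for M
  have rep: "rep M \<in> carrier (SpZ \<Omega>)" "residue c (rep M) = residue c M" if "M \<in> carrier (SpZ \<Omega>)" for M
    unfolding rep_def using that by (auto intro: inv_into_into f_inv_into_f)
  let ?\<pi> = "\<lambda>M. L.K (N * c) #>\<^bsub>L.G\<^esub> act (M * inv\<^bsub>SpZ \<Omega>\<^esub> (rep M))"
  have "finite (rcosets\<^bsub>SpZ \<Omega>\<^esub> \<Gamma>)"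
  proof (rule finite_rcosets_if[OF S.group_axioms \<Gamma>, where \<phi> = "\<lambda>M. (residue c M, ?\<pi> M)"])
    have "?\<pi> M \<in> rcosets\<^bsub>L.G\<^esub> L.K (N * c)" if "M \<in> carrier (SpZ \<Omega>)" for M
      using cong_G[OF that rep(1)[OF that] rep(2)[OF that, symmetric]] by (auto simp: RCOSETS_def)
    then have "(\<lambda>M. (residue c M, ?\<pi> M)) ` carrier (SpZ \<Omega>) \<subseteq> (residue c ` carrier (SpZ \<Omega>)) \<times> rcosets\<^bsub>L.G\<^esub> L.K (N * c)"
      by auto
    moreover have "finite ((residue c ` carrier (SpZ \<Omega>)) \<times> rcosets\<^bsub>L.G\<^esub> L.K (N * c))"
      using finite_residues[OF pos(2)] L.finite_rcosets_K[of "N * c"] N(1) pos by simp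
    ultimately show "finite ((\<lambda>M. (residue c M, ?\<pi> M)) ` carrier (SpZ \<Omega>))" by (rule finite_subset)
  next
    fix M M' assume M: "M \<in> carrier (SpZ \<Omega>)" and M': "M' \<in> carrier (SpZ \<Omega>)"
      and eq: "(residue c M, ?\<pi> M) = (residue c M', ?\<pi> M')"
    define m where "m = inv\<^bsub>SpZ \<Omega>\<^esub> (rep M)"
    \<comment> \<open>Equal residues have the same representative, so one factor \<open>m\<close>
      corrects both matrices and cancels at the end.\<close>
    have rr: "rep M' = rep M" using eq by (simp add: rep_def)
    have m: "m \<in> carrier (SpZ \<Omega>)" unfolding m_def using rep(1)[OF M] by (rule S.inv_closed)
    have in_G: "act (M * m) \<in> carrier L.G"
      unfolding m_def using cong_G[OF M rep(1)[OF M] rep(2)[OF M, symmetric]] .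
    have "act (M * m) \<in> L.K (N * c) #>\<^bsub>L.G\<^esub> act (M * m)"
      by (rule L.G.rcos_self[OF in_G L.K_subgroup])
    also have "\<dots> = L.K (N * c) #>\<^bsub>L.G\<^esub> act (M' * m)" using eq rr by (simp add: m_def)
    finally obtain k where "k \<in> L.K (N * c)" "act (M * m) = k \<circ> act (M' * m)"
      by (auto simp: r_coset_def L.G_simps)
    then obtain \<gamma> where \<gamma>: "\<gamma> \<in> \<Gamma>" "act (M * m) = act \<gamma> \<circ> act (M' * m)" using KH by blast
    have c: "M * m \<in> carrier (SpZ \<Omega>)" "M' * m \<in> carrier (SpZ \<Omega>)"
      using S.m_closed[OF M m] S.m_closed[OF M' m] by (simp_all only: SpZ_simps)
    have "act (M * m) = act (\<gamma> * (M' * m))"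
      using \<gamma>(2) act_mult[OF S_mat[OF \<Gamma>c[OF \<gamma>(1)]] S_mat[OF c(2)]] by simp
    then have "M * m = \<gamma> * (M' * m)"
      using act_inj S_mat[OF c(1)] S_mat[OF \<Gamma>c[OF \<gamma>(1)]] S_mat[OF c(2)] mult_carrier_mat by blast
    then have "M \<otimes>\<^bsub>SpZ \<Omega>\<^esub> m = (\<gamma> \<otimes>\<^bsub>SpZ \<Omega>\<^esub> M') \<otimes>\<^bsub>SpZ \<Omega>\<^esub> m"
      using S.m_assoc[OF \<Gamma>c[OF \<gamma>(1)] M' m] by (simp only: SpZ_simps)
    then have "M = \<gamma> \<otimes>\<^bsub>SpZ \<Omega>\<^esub> M'"
      using S.right_cancel[OF m M S.m_closed[OF \<Gamma>c[OF \<gamma>(1)] M']] by simp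
    then have "M \<otimes>\<^bsub>SpZ \<Omega>\<^esub> inv\<^bsub>SpZ \<Omega>\<^esub> M' = \<gamma>"
      using S.inv_solve_right'[OF \<Gamma>c[OF \<gamma>(1)] M M'] M by simp
    then show "M \<otimes>\<^bsub>SpZ \<Omega>\<^esub> inv\<^bsub>SpZ \<Omega>\<^esub> M' \<in> \<Gamma>" using \<gamma>(1) by simp
  qed
  then show ?thesis using \<Gamma> by (simp add: finite_index_subgroup_def)
qed

section \<open>The groups C-47 and C-55\<close>

lemma sum6: "(\<Sum>i<6. f i) = f 0 + f 1 + f 2 + f 3 + f 4 + (f (5::nat) :: 'a::comm_monoid_add)"
proof -
  have "{..<6 :: nat} = {0, 1, 2, 3, 4, 5}" by (auto simp: less_6)
  then show ?thesis by (simp add: add_ac)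
qed

lemma coord_simps [simp]: "coord (a, b, c, d, e, f) 0 = a" "coord (a, b, c, d, e, f) 1 = b" "coord (a, b, c, d, e, f) (Suc 0) = b"
  "coord (a, b, c, d, e, f) 2 = c" "coord (a, b, c, d, e, f) 3 = d" "coord (a, b, c, d, e, f) 4 = e" "coord (a, b, c, d, e, f) 5 = f"
  by (simp_all add: coord_def)

lemma act_rows:
  assumes "length rs = 6"
  shows "act (mat_of_rows_list 6 rs) x = of_coords (\<lambda>i. of_int (rs ! i ! 0) * coord x 0 + of_int (rs ! i ! 1) * coord x 1 + of_int (rs ! i ! 2) * coord x 2
    + of_int (rs ! i ! 3) * coord x 3 + of_int (rs ! i ! 4) * coord x 4 + of_int (rs ! i ! 5) * coord x 5)"
  using assms by (simp add: act_def of_coords_def sum6 rows_index_6)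

definition companion_step :: "int \<Rightarrow> int \<Rightarrow> int \<Rightarrow> int \<Rightarrow> int \<Rightarrow> vec6 \<Rightarrow> vec6" where
  "companion_step c1 c2 c3 c4 c5 = (\<lambda>(x0, x1, x2, x3, x4, x5).
     (- x5, x0 - of_int c1 * x5, x1 - of_int c2 * x5, x2 - of_int c3 * x5, x3 - of_int c4 * x5, x4 - of_int c5 * x5))"

definition companion_unstep :: "int \<Rightarrow> int \<Rightarrow> int \<Rightarrow> int \<Rightarrow> int \<Rightarrow> vec6 \<Rightarrow> vec6" where
  "companion_unstep c1 c2 c3 c4 c5 = (\<lambda>(x0, x1, x2, x3, x4, x5).
     (x1 - of_int c1 * x0, x2 - of_int c2 * x0, x3 - of_int c3 * x0, x4 - of_int c4 * x0, x5 - of_int c5 * x0, - x0))"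

lemma step_unstep: "companion_step c1 c2 c3 c4 c5 \<circ> companion_unstep c1 c2 c3 c4 c5 = id"
  by (auto simp: companion_step_def companion_unstep_def)

lemma act_companion:
  "act (companion_mat [:1, c1, c2, c3, c4, c5, 1:]) = companion_step c1 c2 c3 c4 c5"
  unfolding companion_mat_6 by (rule ext) (auto simp: act_rows of_coords_def companion_step_def)

text \<open>\<open>P\<close> stands for the last clause of \<open>isom_group\<close>, whose
  unfolding is passed in whole; explicit words are then checked letter by letter.\<close>

lemma foldr_comp_in:
  assumes "id \<in> H \<and> (\<forall>f\<in>H. \<forall>g\<in>H. f \<circ> g \<in> H) \<and> P" "set fs \<subseteq> H"
  shows "foldr (\<circ>) fs id \<in> H"
  using assms(2) by (induction fs) (use assms(1) in \<open>simp_all add: id_def[symmetric]\<close>)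

lemma orbit_step:
  assumes "id \<in> H \<and> (\<forall>f\<in>H. \<forall>g\<in>H. f \<circ> g \<in> H) \<and> P" "a \<in> H" "\<exists>h\<in>H. y = h v"
  shows "\<exists>h\<in>H. a y = h v"
  using assms by (metis comp_apply)

lemma form47: "form \<Omega>47 k (x0, x1, x2, x3, x4, x5) (y0, y1, y2, y3, y4, y5) =
  (x0 * (29 * y1 - 50 * y2 + 51 * y3 - 28 * y4 + y5)
   + x1 * (- 29 * y0 + 29 * y2 - 50 * y3 + 51 * y4 - 28 * y5)
   + x2 * (50 * y0 - 29 * y1 + 29 * y3 - 50 * y4 + 51 * y5)
   + x3 * (- 51 * y0 + 50 * y1 - 29 * y2 + 29 * y4 - 50 * y5)
   + x4 * (28 * y0 - 51 * y1 + 50 * y2 - 29 * y3 + 29 * y5)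
   + x5 * (- y0 + 28 * y1 - 51 * y2 + 50 * y3 - 29 * y4)) / k"
  by (simp add: form_def sum6 \<Omega>47_def rows_index_6 algebra_simps)

lemma form55: "form \<Omega>55 k (x0, x1, x2, x3, x4, x5) (y0, y1, y2, y3, y4, y5) =
  (x0 * (y1 + 6 * y2 + 3 * y3 + 4 * y4 + 5 * y5)
   + x1 * (- y0 + y2 + 6 * y3 + 3 * y4 + 4 * y5)
   + x2 * (- 6 * y0 - y1 + y3 + 6 * y4 + 3 * y5)
   + x3 * (- 3 * y0 - 6 * y1 - y2 + y4 + 6 * y5)
   + x4 * (- 4 * y0 - 3 * y1 - 6 * y2 - y3 + y5)
   + x5 * (- 5 * y0 - 4 * y1 - 3 * y2 - 6 * y3 - y4)) / k"
  by (simp add: form_def sum6 \<Omega>55_def rows_index_6 algebra_simps)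

text \<open>The vectors \<open>e\<^sub>i, f\<^sub>i\<close> come from a basis of the span of the \<open>A\<^sup>i v\<close> adapted to the elementary
  divisors \<open>1, 1, d\<close> of the form there; the first two \<open>e\<^sub>i\<close> are multiplied by \<open>d\<close> so that all three
  pairings agree. Here \<open>d = 36\<close> for C-47 and \<open>d = 8\<close> for C-55.\<close>

lemma finite_index_47: "finite_index_subgroup \<Gamma>47 (SpZ \<Omega>47)"
proof -
  let ?A = "companion_step (-1) 0 0 0 (-1)" and ?a = "companion_unstep (-1) 0 0 0 (-1)"
  let ?B = "companion_step 4 8 10 8 4" and ?b = "companion_unstep 4 8 10 8 4"
  \<comment> \<open>The rightmost letter acts first. What matters is that the first coordinate of
    \<open>?g ?v\<close> is \<open>- 1\<close>.\<close>
  let ?g = "foldr (\<circ>) [?A, ?B, ?B, ?B, ?B, ?B, ?a, ?a, ?B, ?B, ?B, ?B, ?B, ?B, ?A, ?A, ?b, ?b, ?b, ?b, ?b, ?b, ?A, ?A, ?B, ?B, ?B, ?B, ?B, ?B, ?a, ?a, ?B, ?B, ?B, ?B, ?B, ?B, ?A, ?A, ?B, ?B, ?B, ?B, ?B, ?B, ?a, ?a, ?B, ?a, ?B, ?a, ?B, ?a, ?B, ?a, ?B, ?A] id"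
  \<comment> \<open>The coefficients of \<open>g47 - f47\<close>. The two companion matrices differ
    only in the last column, so \<open>?B \<circ> ?a\<close> adds to \<open>x\<close> its first
    coordinate times this vector.\<close>
  let ?v = "(0, 5, 8, 10, 8, 5) :: vec6"
  let ?y1 = "(- 5, 5, 5, 8, 10, 13) :: vec6" and ?y2 = "(- 13, 8, 5, 5, 8, 23) :: vec6" and ?y3 = "(- 23, 10, 8, 5, 5, 31) :: vec6"
    and ?y4 = "(- 31, 8, 10, 8, 5, 36) :: vec6" and ?y5 = "(- 36, 5, 8, 10, 8, 41) :: vec6"
  let ?Y = "{?v, ?y1, ?y2, ?y3, ?y4, ?y5}"
  let ?e1 = "(0, 180, 288, 360, 288, 180) :: vec6" and ?f1 = "(- 1, 3, 20, 10, - 15, - 17) :: vec6"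
  let ?e2 = "(0, - 1260, - 972, - 2268, - 3060, - 2808) :: vec6" and ?f2 = "(0, 138, 155, 248, 287, 216) :: vec6"
  let ?e3 = "(0, - 2484, - 2808, - 4464, - 5148, - 3852) :: vec6" and ?f3 = "(0, 180, 180, 324, 396, 324) :: vec6"
  \<comment> \<open>\<open>\<Omega>47\<close> sends \<open>?v\<close> to 36 times the first unit
    vector; at this scale the pairing of \<open>x\<close> with \<open>?v\<close> is the first
    coordinate of \<open>x\<close>.\<close>
  let ?\<omega> = "form \<Omega>47 (of_int 36)"
  have \<Omega>: "\<Omega>47 \<in> carrier_mat 6 6" "transpose_mat \<Omega>47 = - \<Omega>47"
    using \<Omega>47_symplectic by (simp_all add: symplectic_form_mat_def)
  interpret \<omega>: symplectic_space ?\<omega> by (rule symplectic_space_form[OF \<Omega>])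
  have deg: "degree f47 = 6" by (simp add: f47_def)
  have gen: "\<Gamma>47 = generate (GLZ 6) {companion_mat f47, companion_mat g47}"
    by (simp only: \<Gamma>47_def hypergeometric_group_def deg)
  have \<Gamma>: "subgroup \<Gamma>47 (SpZ \<Omega>47)"
    unfolding gen by (rule subgroup_generate_SpZ[OF \<Omega>(1)]) (simp add: \<Omega>47_preserved)
  have H: "\<omega>.isom_group (act ` \<Gamma>47)" by (rule isom_group_act[OF \<Omega> \<Gamma>])
  have "act (companion_mat f47) \<in> act ` \<Gamma>47" "act (companion_mat g47) \<in> act ` \<Gamma>47"
    unfolding gen by (intro imageI generate.incl; simp)+
  then have AB: "?A \<in> act ` \<Gamma>47" "?B \<in> act ` \<Gamma>47"
    by (simp_all add: f47_def g47_def act_companion)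
  then have ab: "?a \<in> act ` \<Gamma>47" "?b \<in> act ` \<Gamma>47"
    using \<omega>.H_inv_eq[OF H _ step_unstep] by blast+
  note gens = AB ab
  have g: "?g \<in> act ` \<Gamma>47"
    by (intro foldr_comp_in[OF H[unfolded \<omega>.isom_group_def]]) (use gens in auto)
  have gv: "?g ?v = (- 1, 787092648, 1637159793, 1624661251, 565143204, - 506841627)"
    by (simp add: companion_step_def companion_unstep_def)
  have gv1: "?\<omega> ?v (?g ?v) = 1 \<or> ?\<omega> ?v (?g ?v) = -1" unfolding gv by (simp add: form47)
  have v: "?\<omega> x ?v = coord x 0" for x by (cases x) (simp add: form47 algebra_simps)
  have Tv: "\<omega>.T 1 ?v = ?B \<circ> ?a"
  proof
    fix x
    show "\<omega>.T 1 ?v x = (?B \<circ> ?a) x"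
      unfolding \<omega>.T_def v by (cases x) (simp add: companion_step_def companion_unstep_def)
  qed
  have Y: "?y1 = ?A ?v" "?y2 = ?A ?y1" "?y3 = ?A ?y2" "?y4 = ?A ?y3" "?y5 = ?A ?y4"
    by (simp_all add: companion_step_def)
  note orb = orbit_step[OF H[unfolded \<omega>.isom_group_def] AB(1)]
  have o0: "\<exists>h\<in>act ` \<Gamma>47. ?v = h ?v" using \<omega>.H_id[OF H] by (intro bexI[of _ id]) simp_all
  note o1 = orb[OF o0, folded Y] note o2 = orb[OF o1, folded Y] note o3 = orb[OF o2, folded Y]
  note o4 = orb[OF o3, folded Y] note o5 = orb[OF o4, folded Y]
  \<comment> \<open>The scale 1296 is the 36 of \<open>?\<omega>\<close> times the largest
    elementary divisor 36.\<close>
  have L: "symplectic_lattice (form \<Omega>47 (of_int 1296)) ?e1 ?e2 ?e3 ?f1 ?f2 ?f3"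
  proof (intro symplectic_lattice.intro symplectic_space_form \<Omega> symplectic_lattice_axioms.intro)
    fix x :: vec6
    show "x = form \<Omega>47 (of_int 1296) x ?f1 *\<^sub>R ?e1 - form \<Omega>47 (of_int 1296) x ?e1 *\<^sub>R ?f1
      + form \<Omega>47 (of_int 1296) x ?f2 *\<^sub>R ?e2 - form \<Omega>47 (of_int 1296) x ?e2 *\<^sub>R ?f2
      + form \<Omega>47 (of_int 1296) x ?f3 *\<^sub>R ?e3 - form \<Omega>47 (of_int 1296) x ?e3 *\<^sub>R ?f3"
      by (cases x) (simp add: form47 field_simps)
  qed (simp_all add: form47)
  have Yz: "?v \<in> zspan ?Y" "?y1 \<in> zspan ?Y" "?y2 \<in> zspan ?Y" "?y3 \<in> zspan ?Y" "?y4 \<in> zspan ?Y" "?y5 \<in> zspan ?Y"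
    by (intro zspan_base; simp)+
  have comb: "of_int a *\<^sub>R ?v + of_int b *\<^sub>R ?y1 + of_int c *\<^sub>R ?y2 + of_int d *\<^sub>R ?y3 + of_int e *\<^sub>R ?y4 + of_int f *\<^sub>R ?y5
      \<in> zspan ?Y" for a b c d e f
    by (intro zspan_add zspan_scale Yz)
  \<comment> \<open>The coefficient rows belong, in this order, to \<open>?e1\<close>,
    \<open>?f1\<close>, \<open>?e2\<close>, \<open>?f2\<close>, \<open>?e3\<close>,
    \<open>?f3\<close>.\<close>
  have eY: "{?e1, ?e2, ?e3, ?f1, ?f2, ?f3} \<subseteq> zspan ?Y"
    using comb[of 36 0 0 0 0 0] comb[of 5 "-6" 0 0 1 0] comb[of "-504" 756 "-1008" 468 288 "-288"] comb[of 10 23 "-2" 4 "-7" 1] comb[of "-162" "-457" 83 "-97" 119 "-7"] comb[of 35 "-21" 51 "-21" "-21" 16] by simp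
  show ?thesis
  proof (rule finite_index_criterion[OF \<Omega> \<Gamma> _ _ _ _ _ g _ _ _ _ L eY])
    show "\<omega>.T 1 ?v \<in> act ` \<Gamma>47" unfolding Tv by (rule \<omega>.H_comp[OF H AB(2) ab(1)])
    show "integral ?v" by (auto simp: integral_def less_6)
    show "?\<omega> x ?v \<in> \<int>" if "integral x" for x using that unfolding v by (simp add: integral_def)
    show "?\<omega> ?v (?g ?v) = 1 \<or> ?\<omega> ?v (?g ?v) = -1" by (rule gv1)
    show "\<exists>h\<in>act ` \<Gamma>47. y = h ?v" if "y \<in> ?Y" for y using that o0 o1 o2 o3 o4 o5 by blast
    \<comment> \<open>The vectors \<open>?y1\<close> to \<open>?y5\<close> have nonzero first
      coordinate, hence nonzero pairing with \<open>?v\<close>; \<open>?v\<close> itself is paired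
      with \<open>?g ?v\<close>.\<close>
    show "?\<omega> y ?v \<noteq> 0 \<or> ?\<omega> y (?g ?v) \<noteq> 0" if "y \<in> ?Y" for y
    proof (cases "y = ?v")
      case True
      have "?\<omega> ?v (?g ?v) \<noteq> 0" using gv1 by linarith
      then show ?thesis unfolding True by (rule disjI2)
    next
      case False
      then show ?thesis using that unfolding v by (intro disjI1) auto
    qed
  qed simp_all
qed

lemma finite_index_55: "finite_index_subgroup \<Gamma>55 (SpZ \<Omega>55)"
proof -
  let ?A = "companion_step (-2) 1 0 1 (-2)" and ?a = "companion_unstep (-2) 1 0 1 (-2)"
  let ?B = "companion_step 2 0 (-2) 0 2" and ?b = "companion_unstep 2 0 (-2) 0 2"
  let ?g = "foldr (\<circ>) [?b, ?a, ?a, ?a, ?a, ?a, ?b, ?b, ?A, ?A, ?A, ?A, ?B, ?A, ?A, ?A, ?A, ?B, ?A, ?A, ?A, ?A, ?B, ?A, ?A, ?A, ?A, ?B, ?A, ?A, ?A, ?A, ?B, ?A, ?A, ?A, ?A, ?B, ?A, ?A, ?A, ?A, ?A, ?B, ?B, ?A] id"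
  \<comment> \<open>The coefficients of \<open>g55 - f55\<close>; \<open>\<Omega>55\<close> sends
    this vector to 8 times the first unit vector.\<close>
  let ?v = "(0, 4, - 1, - 2, - 1, 4) :: vec6"
  let ?y1 = "(- 4, 8, 0, - 1, - 6, 7) :: vec6" and ?y2 = "(- 7, 10, 1, 0, - 8, 8) :: vec6" and ?y3 = "(- 8, 9, 2, 1, - 8, 8) :: vec6"
    and ?y4 = "(- 8, 8, 1, 2, - 7, 8) :: vec6" and ?y5 = "(- 8, 8, 0, 1, - 6, 9) :: vec6"
  let ?Y = "{?v, ?y1, ?y2, ?y3, ?y4, ?y5}"
  let ?e1 = "(- 24, 48, 0, - 8, - 24, 40) :: vec6" and ?f1 = "(0, 0, - 1, 0, 3, 2) :: vec6"
  let ?e2 = "(48, - 88, - 8, 8, 88, - 48) :: vec6" and ?f2 = "(- 4, 8, 0, - 1, - 6, 7) :: vec6"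
  let ?e3 = "(8, - 16, 0, 0, 16, - 16) :: vec6" and ?f3 = "(0, 0, 0, 0, 0, - 8) :: vec6"
  let ?\<omega> = "form \<Omega>55 (of_int 8)"
  have \<Omega>: "\<Omega>55 \<in> carrier_mat 6 6" "transpose_mat \<Omega>55 = - \<Omega>55"
    using \<Omega>55_symplectic by (simp_all add: symplectic_form_mat_def)
  interpret \<omega>: symplectic_space ?\<omega> by (rule symplectic_space_form[OF \<Omega>])
  have deg: "degree f55 = 6" by (simp add: f55_def)
  have gen: "\<Gamma>55 = generate (GLZ 6) {companion_mat f55, companion_mat g55}"
    by (simp only: \<Gamma>55_def hypergeometric_group_def deg)
  have \<Gamma>: "subgroup \<Gamma>55 (SpZ \<Omega>55)"
    unfolding gen by (rule subgroup_generate_SpZ[OF \<Omega>(1)]) (simp add: \<Omega>55_preserved)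
  have H: "\<omega>.isom_group (act ` \<Gamma>55)" by (rule isom_group_act[OF \<Omega> \<Gamma>])
  have "act (companion_mat f55) \<in> act ` \<Gamma>55" "act (companion_mat g55) \<in> act ` \<Gamma>55"
    unfolding gen by (intro imageI generate.incl; simp)+
  then have AB: "?A \<in> act ` \<Gamma>55" "?B \<in> act ` \<Gamma>55"
    by (simp_all add: f55_def g55_def act_companion)
  then have ab: "?a \<in> act ` \<Gamma>55" "?b \<in> act ` \<Gamma>55"
    using \<omega>.H_inv_eq[OF H _ step_unstep] by blast+
  note gens = AB ab
  have g: "?g \<in> act ` \<Gamma>55"
    by (intro foldr_comp_in[OF H[unfolded \<omega>.isom_group_def]]) (use gens in auto)
  \<comment> \<open>The first coordinate 1 makes the pairing of \<open>?v\<close> with this vector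
    equal to -1, the second alternative of the criterion.\<close>
  have gv: "?g ?v = (1, - 275602, - 259221, 60404, 472858, 99436)"
    by (simp add: companion_step_def companion_unstep_def)
  have gv1: "?\<omega> ?v (?g ?v) = 1 \<or> ?\<omega> ?v (?g ?v) = -1" unfolding gv by (simp add: form55)
  have v: "?\<omega> x ?v = coord x 0" for x by (cases x) (simp add: form55 algebra_simps)
  have Tv: "\<omega>.T 1 ?v = ?B \<circ> ?a"
  proof
    fix x
    show "\<omega>.T 1 ?v x = (?B \<circ> ?a) x"
      unfolding \<omega>.T_def v by (cases x) (simp add: companion_step_def companion_unstep_def)
  qed
  have Y: "?y1 = ?A ?v" "?y2 = ?A ?y1" "?y3 = ?A ?y2" "?y4 = ?A ?y3" "?y5 = ?A ?y4"
    by (simp_all add: companion_step_def)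
  note orb = orbit_step[OF H[unfolded \<omega>.isom_group_def] AB(1)]
  have o0: "\<exists>h\<in>act ` \<Gamma>55. ?v = h ?v" using \<omega>.H_id[OF H] by (intro bexI[of _ id]) simp_all
  note o1 = orb[OF o0, folded Y] note o2 = orb[OF o1, folded Y] note o3 = orb[OF o2, folded Y]
  note o4 = orb[OF o3, folded Y] note o5 = orb[OF o4, folded Y]
  \<comment> \<open>The scale 64 is the 8 of \<open>?\<omega>\<close> times the largest elementary
    divisor 8.\<close>
  have L: "symplectic_lattice (form \<Omega>55 (of_int 64)) ?e1 ?e2 ?e3 ?f1 ?f2 ?f3"
  proof (intro symplectic_lattice.intro symplectic_space_form \<Omega> symplectic_lattice_axioms.intro)
    fix x :: vec6
    show "x = form \<Omega>55 (of_int 64) x ?f1 *\<^sub>R ?e1 - form \<Omega>55 (of_int 64) x ?e1 *\<^sub>R ?f1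
      + form \<Omega>55 (of_int 64) x ?f2 *\<^sub>R ?e2 - form \<Omega>55 (of_int 64) x ?e2 *\<^sub>R ?f2
      + form \<Omega>55 (of_int 64) x ?f3 *\<^sub>R ?e3 - form \<Omega>55 (of_int 64) x ?e3 *\<^sub>R ?f3"
      by (cases x) (simp add: form55 field_simps)
  qed (simp_all add: form55)
  have Yz: "?v \<in> zspan ?Y" "?y1 \<in> zspan ?Y" "?y2 \<in> zspan ?Y" "?y3 \<in> zspan ?Y" "?y4 \<in> zspan ?Y" "?y5 \<in> zspan ?Y"
    by (intro zspan_base; simp)+
  have comb: "of_int a *\<^sub>R ?v + of_int b *\<^sub>R ?y1 + of_int c *\<^sub>R ?y2 + of_int d *\<^sub>R ?y3 + of_int e *\<^sub>R ?y4 + of_int f *\<^sub>R ?y5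
      \<in> zspan ?Y" for a b c d e f
    by (intro zspan_add zspan_scale Yz)
  have eY: "{?e1, ?e2, ?e3, ?f1, ?f2, ?f3} \<subseteq> zspan ?Y"
    using comb[of 8 "-8" 8 0 0 0] comb[of 2 "-2" 0 0 1 0] comb[of 16 "-16" "-16" 8 8 0] comb[of 0 1 0 0 0 0] comb[of 2 "-7" 4 0 "-2" 1] comb[of "-1" "-4" 8 "-4" "-1" 0] by simp
  show ?thesis
  proof (rule finite_index_criterion[OF \<Omega> \<Gamma> _ _ _ _ _ g _ _ _ _ L eY])
    show "\<omega>.T 1 ?v \<in> act ` \<Gamma>55" unfolding Tv by (rule \<omega>.H_comp[OF H AB(2) ab(1)])
    show "integral ?v" by (auto simp: integral_def less_6)
    show "?\<omega> x ?v \<in> \<int>" if "integral x" for x using that unfolding v by (simp add: integral_def)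
    show "?\<omega> ?v (?g ?v) = 1 \<or> ?\<omega> ?v (?g ?v) = -1" by (rule gv1)
    show "\<exists>h\<in>act ` \<Gamma>55. y = h ?v" if "y \<in> ?Y" for y using that o0 o1 o2 o3 o4 o5 by blast
    show "?\<omega> y ?v \<noteq> 0 \<or> ?\<omega> y (?g ?v) \<noteq> 0" if "y \<in> ?Y" for y
    proof (cases "y = ?v")
      case True
      have "?\<omega> ?v (?g ?v) \<noteq> 0" using gv1 by linarith
      then show ?thesis unfolding True by (rule disjI2)
    next
      case False
      then show ?thesis using that unfolding v by (intro disjI1) auto
    qed
  qed simp_all
qed

theorem theorem1:
  shows "finite_index_subgroup \<Gamma>47 (SpZ \<Omega>47) \<and>
         finite_index_subgroup \<Gamma>55 (SpZ \<Omega>55) \<and>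
         arithmetic_subgroup \<Omega>47 \<Gamma>47 \<and>
         arithmetic_subgroup \<Omega>55 \<Gamma>55"
  using finite_index_47 finite_index_55 by (simp add: arithmetic_subgroup_def)

end
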